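(* Let $W$ be a finite Coxeter group with set of simple reflections $S$. Suppose that for every $L\subseteq S$ and every $W_L$-conjugacy class $C$ of cuspidal elements of $W_L$ with fixed representative $w_C$, there exist linear characters $\widetilde\varphi_{w_C},\widetilde\psi_{w_C}$ of $C_W(w_C)$ such that $\widetilde\Phi_L=\sum_{C\in\mathcal C_L}\operatorname{Ind}_{C_W(w_C)}^{N_W(W_L)}\widetilde\varphi_{w_C}$, $\widetilde\Psi_L=\sum_{C\in\mathcal C_L}\operatorname{Ind}_{C_W(w_C)}^{N_W(W_L)}\widetilde\psi_{w_C}$, and $\widetilde\psi_{w_C}=\widetilde\varphi_{w_C}\epsilon\alpha_L$ for all $C\in\mathcal C_L$. Then for each $w$ in a set $\mathcal R$ of representatives of the conjugacy classes of $W$ there are linear characters $\widetilde\varphi_w,\widetilde\psi_w$ of $C_W(w)$ such that (i) $\rho_W=\sum_{w\in\mathcal R}\operatorname{Ind}_{C_W(w)}^W\widetilde\varphi_w$; (ii) $\omega_W=\sum_{w\in\mathcal R}\operatorname{Ind}_{C_W(w)}^W\widetilde\psi_w$; (iii) $\widetilde\psi_w=\widetilde\varphi_w\epsilon\alpha_w$ for all $w\in\mathcal R$.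
   Context: $W$ has length function $\ell$ and acts on the right as a reflection group on $V=\mathbb R^{|S|}$ (and $V_{\mathbb C}$). Write $x^w=w^{-1}xw$, $J^w=\{s^w:s\in J\}$. $\epsilon$ is the sign character, $\rho_W$ the regular character. For $w\in W$, $\alpha_w(c)=\det(c|_{\operatorname{Fix}(w)})$ for $c\in C_W(w)$. For $J\subseteq S$: $W_J=\langle J\rangle$; $X_J=\{w:\ell(sw)>\ell(w)\ \forall s\in J\}$; $x_J=\sum_{x\in X_J}x^{-1}$; $X_J^\sharp=\{x\in X_J:J^x\subseteq S\}$; $N_J=\{x\in X_J:J^x=J\}$, so $N_W(W_J)=W_J\rtimes N_J$. With $m_{KL}=|X_K\cap X_L^\sharp|$ for $L\subseteq K$ and $0$ otherwise (an invertible matrix), elements $e_L$ are defined by $x_K=\sum_Lm_{KL}e_L$. For $L\subseteq S$, $\widetilde\Phi_L$ is the character of $N_W(W_L)$ acting by right multiplication on $e_L\mathbb CW_L$. Orlik–Solomon algebra: $T$ the reflections, $H_t$ their hyperplanes in $V_{\mathbb C}$; $A(W)$ is generated by $a_t$ ($t\in T$) with $a_ta_{t'}=-a_{t'}a_t$ and $\sum_{i=1}^p(-1)^ia_{t_1}\cdots\widehat{a_{t_i}}\cdots a_{t_p}=0$ for linearly dependent $\{H_{t_1},\dots,H_{t_p}\}$; $W$ acts by $a_t.w=a_{t^w}$; $\omega_W$ is the character of $A(W)$. For $X=\operatorname{Fix}(W_L)$ of codimension $p$, $A_X$ is the span of all $a_{t_1}\cdots a_{t_p}$ with $H_{t_1}\cap\dots\cap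 H_{t_p}=X$, and $\widetilde\Psi_L$ is the character of $N_W(W_L)$ on $A_X$. It is known that $\rho_W=\sum_{[L]}\operatorname{Ind}_{N_W(W_L)}^W\widetilde\Phi_L$ and $\omega_W=\sum_{[L]}\operatorname{Ind}_{N_W(W_L)}^W\widetilde\Psi_L$, summing over representatives of the $W$-conjugacy classes of subsets $L\subseteq S$. $\alpha_L(w)=\det(w|_{\operatorname{Fix}(W_L)})$ for $w\in N_W(W_L)$. $w\in W_L$ is cuspidal in $W_L$ if it has no nonzero fixed vector in the orthogonal complement of $\operatorname{Fix}(W_L)$; $\mathcal C_L$ is the set of $W_L$-classes of cuspidal elements of $W_L$; for such $w$, $C_W(w)\le N_W(W_L)$. *)

theory Defs
  imports "HOL-Analysis.Analysis"
begin

type_synonym 'n rmat = "real^'n^'n"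

section \<open>Words, generated subgroups, length, Coxeter systems\<close>

definition mprod :: "('n::finite) rmat list \<Rightarrow> 'n rmat" where
  "mprod ws = foldr (**) ws (mat 1)"

text \<open>Subgroup generated by a set of involutions (finite case: the monoid closure).\<close>
definition gen :: "('n::finite) rmat set \<Rightarrow> 'n rmat set" where
  "gen L = {mprod ws | ws. set ws \<subseteq> L}"

text \<open>Length function with respect to S.\<close>
definition len :: "('n::finite) rmat set \<Rightarrow> 'n rmat \<Rightarrow> nat" where
  "len S w = (LEAST k. \<exists>ws. length ws = k \<and> set ws \<subseteq> S \<and> mprod ws = w)"

text \<open>Orthogonal reflection of V = R^n (V acted on from the right: v v* r).\<close>
definition is_reflection :: "('n::finite) rmat \<Rightarrow> bool" where
  "is_reflection r \<longleftrightarrow> orthogonal_matrix r \<and> r ** r = mat 1 \<and> r \<noteq> mat 1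
     \<and> dim {v. v v* r = v} = CARD('n) - 1"

text \<open>Coxeter system, via the exchange condition.\<close>
definition exchange_cond :: "('n::finite) rmat set \<Rightarrow> bool" where
  "exchange_cond S \<longleftrightarrow> (\<forall>ws s. set ws \<subseteq> S \<and> s \<in> S \<and> length ws = len S (mprod ws)
      \<and> len S (s ** mprod ws) < length ws
      \<longrightarrow> (\<exists>i<length ws. s ** mprod ws = mprod (take i ws @ drop (Suc i) ws)))"

definition fixW :: "('n::finite) rmat set \<Rightarrow> (real^'n) set" where
  "fixW H = {v. \<forall>u\<in>H. v v* u = v}"

text \<open>A finite Coxeter group W with simple reflections S, realised as an essential
  reflection group on V = R^|S| (acting on the right).\<close>
definition finite_coxeter :: "('n::finite) rmat set \<Rightarrow> 'n rmat set \<Rightarrow> bool" where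
  "finite_coxeter W S \<longleftrightarrow> finite W \<and> W = gen S \<and> (\<forall>s\<in>S. is_reflection s)
     \<and> card S = CARD('n) \<and> exchange_cond S \<and> fixW W = {0}"

section \<open>Group-theoretic notions\<close>

text \<open>x^w = w^{-1} x w\<close>
definition conjg :: "('n::finite) rmat \<Rightarrow> 'n rmat \<Rightarrow> 'n rmat" where
  "conjg x w = matrix_inv w ** x ** w"

definition cent :: "('n::finite) rmat set \<Rightarrow> 'n rmat \<Rightarrow> 'n rmat set" where
  "cent W w = {c\<in>W. c ** w = w ** c}"

definition normalizer :: "('n::finite) rmat set \<Rightarrow> 'n rmat set \<Rightarrow> 'n rmat set" where
  "normalizer W H = {n\<in>W. (\<lambda>h. conjg h n) ` H = H}"

definition conj_classes :: "('n::finite) rmat set \<Rightarrow> 'n rmat set set" where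
  "conj_classes W = {(\<lambda>x. conjg w x) ` W | w. w \<in> W}"

text \<open>Linear character of a subgroup H: a homomorphism H \<rightarrow> C^*.\<close>
definition lin_char :: "('n::finite) rmat set \<Rightarrow> ('n rmat \<Rightarrow> complex) \<Rightarrow> bool" where
  "lin_char H f \<longleftrightarrow> (\<forall>h\<in>H. f h \<noteq> 0) \<and> (\<forall>h\<in>H. \<forall>k\<in>H. f (h ** k) = f h * f k)"

text \<open>Induced class function Ind_H^G chi.\<close>
definition ind :: "('n::finite) rmat set \<Rightarrow> 'n rmat set \<Rightarrow> ('n rmat \<Rightarrow> complex) \<Rightarrow> 'n rmat \<Rightarrow> complex" where
  "ind G H f g = (\<Sum>x\<in>G. if conjg g x \<in> H then f (conjg g x) else 0) / of_nat (card H)"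

definition reg_char :: "('n::finite) rmat set \<Rightarrow> 'n rmat \<Rightarrow> complex" where
  "reg_char W g = (if g = mat 1 then of_nat (card W) else 0)"

definition sgn_char :: "('n::finite) rmat set \<Rightarrow> 'n rmat \<Rightarrow> complex" where
  "sgn_char S w = (-1) ^ len S w"

section \<open>Determinant of a restriction\<close>

text \<open>det(c|_U) for a subspace U of V (V acted on from the right), computed
  in a basis of U via the Leibniz formula.\<close>
definition det_restr :: "('n::finite) rmat \<Rightarrow> (real^'n) set \<Rightarrow> real" where
  "det_restr c U = (SOME d. \<exists>bs M. distinct bs \<and> independent (set bs) \<and> span (set bs) = U
      \<and> (\<forall>j<length bs. bs!j v* c = (\<Sum>i<length bs. M i j *\<^sub>R bs!i))
      \<and> d = (\<Sum>p | p permutes {..<length bs}. of_int (sign p) * (\<Prod>i<length bs. M (p i) i)))"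

text \<open>alpha_w(c) = det(c|Fix(w)); alpha_L(n) = det(n|Fix(W_L)).\<close>
definition alpha :: "('n::finite) rmat \<Rightarrow> 'n rmat \<Rightarrow> complex" where
  "alpha w c = complex_of_real (det_restr c {v. v v* w = v})"

definition alphaL :: "('n::finite) rmat set \<Rightarrow> 'n rmat \<Rightarrow> complex" where
  "alphaL L n = complex_of_real (det_restr n (fixW (gen L)))"

section \<open>Cuspidal classes\<close>

definition cuspidal :: "('n::finite) rmat set \<Rightarrow> 'n rmat \<Rightarrow> bool" where
  "cuspidal L w \<longleftrightarrow> w \<in> gen L \<and>
     (\<forall>v. (\<forall>u\<in>fixW (gen L). v \<bullet> u = 0) \<and> v v* w = v \<longrightarrow> v = 0)"

text \<open>\<C>_L: the W_L-conjugacy classes of cuspidal elements of W_L.\<close>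
definition cusp_classes :: "('n::finite) rmat set \<Rightarrow> 'n rmat set set" where
  "cusp_classes L = {(\<lambda>u. conjg w u) ` gen L | w. cuspidal L w}"

section \<open>Finite-dimensional linear algebra on coordinate spaces 'x => complex\<close>

definition cspan :: "('x \<Rightarrow> complex) set \<Rightarrow> ('x \<Rightarrow> complex) set" where
  "cspan A = {v. \<exists>F c. finite F \<and> F \<subseteq> A \<and> v = (\<lambda>x. \<Sum>a\<in>F. c a * a x)}"

definition lincomb :: "(nat \<Rightarrow> complex) \<Rightarrow> ('x \<Rightarrow> complex) list \<Rightarrow> 'x \<Rightarrow> complex" where
  "lincomb c bs = (\<lambda>x. \<Sum>i<length bs. c i * (bs!i) x)"

text \<open>Trace of the map induced by f on the quotient U/U' (U' \<subseteq> U subspaces,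
  both f-stable), computed in a basis of U modulo U'. With U' = {0} this is
  the trace of f restricted to U.\<close>
definition qtrace :: "(('x \<Rightarrow> complex) \<Rightarrow> ('x \<Rightarrow> complex)) \<Rightarrow> ('x \<Rightarrow> complex) set
      \<Rightarrow> ('x \<Rightarrow> complex) set \<Rightarrow> complex" where
  "qtrace f U U' = (SOME t. \<exists>bs M. set bs \<subseteq> U
      \<and> (\<forall>c. lincomb c bs \<in> U' \<longrightarrow> (\<forall>i<length bs. c i = 0))
      \<and> (\<forall>u\<in>U. \<exists>c. (\<lambda>x. u x - lincomb c bs x) \<in> U')
      \<and> (\<forall>j<length bs. (\<lambda>x. f (bs!j) x - lincomb (\<lambda>i. M i j) bs x) \<in> U')
      \<and> t = (\<Sum>j<length bs. M j j))"

section \<open>Solomon's elements e_L and the characters Phi_L\<close>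

definition Xset :: "('n::finite) rmat set \<Rightarrow> 'n rmat set \<Rightarrow> 'n rmat set \<Rightarrow> 'n rmat set" where
  "Xset W S J = {w\<in>W. \<forall>s\<in>J. len S (s ** w) > len S w}"

definition Xsharp :: "('n::finite) rmat set \<Rightarrow> 'n rmat set \<Rightarrow> 'n rmat set \<Rightarrow> 'n rmat set" where
  "Xsharp W S J = {x\<in>Xset W S J. (\<lambda>s. conjg s x) ` J \<subseteq> S}"

definition mcoef :: "('n::finite) rmat set \<Rightarrow> 'n rmat set \<Rightarrow> 'n rmat set \<Rightarrow> 'n rmat set \<Rightarrow> nat" where
  "mcoef W S K L = (if L \<subseteq> K then card (Xset W S K \<inter> Xsharp W S L) else 0)"

text \<open>Group algebra CW = functions W \<rightarrow> C; x_K = sum of x^{-1}, x \<in> X_K.\<close>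
definition xel :: "('n::finite) rmat set \<Rightarrow> 'n rmat set \<Rightarrow> 'n rmat set \<Rightarrow> 'n rmat \<Rightarrow> complex" where
  "xel W S K = (\<lambda>g. if g \<in> matrix_inv ` Xset W S K then 1 else 0)"

definition eel :: "('n::finite) rmat set \<Rightarrow> 'n rmat set \<Rightarrow> 'n rmat set \<Rightarrow> 'n rmat \<Rightarrow> complex" where
  "eel W S = (THE e. (\<forall>K. K \<subseteq> S \<longrightarrow>
        xel W S K = (\<lambda>g. \<Sum>L\<in>Pow S. of_nat (mcoef W S K L) * e L g))
     \<and> (\<forall>L. \<not> L \<subseteq> S \<longrightarrow> e L = (\<lambda>_. 0)))"

definition delta :: "('n::finite) rmat \<Rightarrow> 'n rmat \<Rightarrow> complex" where
  "delta x = (\<lambda>g. if g = x then 1 else 0)"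

text \<open>Multiplication in CW.\<close>
definition gmult :: "('n::finite) rmat set \<Rightarrow> ('n rmat \<Rightarrow> complex) \<Rightarrow> ('n rmat \<Rightarrow> complex) \<Rightarrow> 'n rmat \<Rightarrow> complex" where
  "gmult W a b = (\<lambda>g. \<Sum>h\<in>W. a h * b (matrix_inv h ** g))"

text \<open>e_L CW_L\<close>
definition eCWL :: "('n::finite) rmat set \<Rightarrow> 'n rmat set \<Rightarrow> 'n rmat set \<Rightarrow> ('n rmat \<Rightarrow> complex) set" where
  "eCWL W S L = {gmult W (eel W S L) a | a. \<forall>g. g \<notin> gen L \<longrightarrow> a g = 0}"

text \<open>Phi~_L(n): trace of right multiplication by n on e_L CW_L.\<close>
definition PhiL :: "('n::finite) rmat set \<Rightarrow> 'n rmat set \<Rightarrow> 'n rmat set \<Rightarrow> 'n rmat \<Rightarrow> complex" where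
  "PhiL W S L n = qtrace (\<lambda>a. gmult W a (delta n)) (eCWL W S L) {\<lambda>_. 0}"

section \<open>Orlik--Solomon algebra\<close>

text \<open>The reflections T of W.\<close>
definition refls :: "('n::finite) rmat set \<Rightarrow> 'n rmat set \<Rightarrow> 'n rmat set" where
  "refls W S = {conjg s x | s x. s \<in> S \<and> x \<in> W}"

definition inter_hyps :: "('n::finite) rmat list \<Rightarrow> (real^'n) set" where
  "inter_hyps ts = {v. \<forall>t\<in>set ts. v v* t = v}"

definition codim :: "(real^('n::finite)) set \<Rightarrow> nat" where
  "codim U = CARD('n) - dim U"

text \<open>{H_t1,...,H_tp} linearly dependent: rank (= codimension) of the intersection < p.\<close>
definition os_dep :: "('n::finite) rmat list \<Rightarrow> bool" where
  "os_dep ts \<longleftrightarrow> codim (inter_hyps ts) < length ts"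

text \<open>Exterior algebra on generators a_t, realised as alternating functions on lists:
  mono ts is the monomial a_t1 ... a_tp.\<close>
definition mono :: "'a list \<Rightarrow> 'a list \<Rightarrow> complex" where
  "mono ts = (\<lambda>us. if distinct ts \<and> distinct us \<and> set us = set ts
      then of_int (sign (THE \<sigma>. \<sigma> permutes {..<length ts} \<and> (\<forall>i<length ts. us!i = ts!(\<sigma> i))))
      else 0)"

definition os_E :: "('n::finite) rmat set \<Rightarrow> 'n rmat set \<Rightarrow> ('n rmat list \<Rightarrow> complex) set" where
  "os_E W S = cspan {mono ts | ts. set ts \<subseteq> refls W S}"

text \<open>The two-sided ideal generated by the Orlik--Solomon relations.\<close>
definition os_I :: "('n::finite) rmat set \<Rightarrow> 'n rmat set \<Rightarrow> ('n rmat list \<Rightarrow> complex) set" where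
  "os_I W S = cspan {(\<lambda>x. \<Sum>i<length ts. (-1)^(Suc i) * mono (us @ take i ts @ drop (Suc i) ts @ vs) x)
      | us ts vs. set (us @ ts @ vs) \<subseteq> refls W S \<and> os_dep ts}"

text \<open>a_t . w = a_{t^w}\<close>
definition os_act :: "('n::finite) rmat \<Rightarrow> ('n rmat list \<Rightarrow> complex) \<Rightarrow> ('n rmat list \<Rightarrow> complex)" where
  "os_act w v = (\<lambda>us. v (map (\<lambda>t. w ** t ** matrix_inv w) us))"

text \<open>omega_W: character of W on A(W) = E / I.\<close>
definition omegaW :: "('n::finite) rmat set \<Rightarrow> 'n rmat set \<Rightarrow> 'n rmat \<Rightarrow> complex" where
  "omegaW W S w = qtrace (os_act w) (os_E W S) (os_I W S)"

text \<open>A_X (as subspace (span of monomials + I)/I of A(W)), X = Fix(W_L).\<close>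
definition os_AX :: "('n::finite) rmat set \<Rightarrow> 'n rmat set \<Rightarrow> 'n rmat set \<Rightarrow> ('n rmat list \<Rightarrow> complex) set" where
  "os_AX W S L = {(\<lambda>x. u x + i x) | u i.
      u \<in> cspan {mono ts | ts. set ts \<subseteq> refls W S \<and> length ts = codim (fixW (gen L))
                          \<and> inter_hyps ts = fixW (gen L)}
      \<and> i \<in> os_I W S}"

definition PsiL :: "('n::finite) rmat set \<Rightarrow> 'n rmat set \<Rightarrow> 'n rmat set \<Rightarrow> 'n rmat \<Rightarrow> complex" where
  "PsiL W S L n = qtrace (os_act n) (os_AX W S L) (os_I W S)"

end

(*
  Both known decompositions are re-proved here in the form needed. Functions on W are functions on the
  chambers of the Coxeter complex, and left multiplication by x_K becomes the sum of the operators
  "project the chamber onto a face of type K". For each parabolic subgroup P there is an idempotent E_P of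
  the face algebra; the E_P are complete, their images are independent, and the defining relation
  x_K = sum m_KL e_L is solved by averages of these idempotents over the faces of type L. Hence e_L CW_L is
  the image of E_P for P = W_L and CW is the direct sum of these images over all P. In the same way the
  relations of the Orlik-Solomon algebra are homogeneous for the grading by flats, and flats correspond to
  parabolic subgroups. Since W permutes both families of summands, traces turn into induced characters.

  Comparing degrees in rho_W then shows that every conjugacy class of W contains exactly one of the
  cuspidal representatives attached to representatives of the classes of subsets L, and transporting the
  given characters to the chosen representatives of the classes of W gives the claim.

  The hypotheses allow realisations in which the elements of S are not the walls of a single chamber of V
  (two reflections with axes at angle 2 pi / 5, say). Therefore all arguments about chambers and faces are
  made in the group, starting from the exchange condition, and V enters only through fixed spaces. The
  bridge is that any k reflections lie in a parabolic subgroup of rank at most k, together with Carter's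
  factorisation of w into codim Fix(w) reflections.
*)
theory Submission
  imports Defs
begin

section \<open>Orthogonal matrices and reflections\<close>

text \<open>The averages solve the defining relation of the e_L because m_KL is a multiplicity in
  the face semigroup. Fix a face Z of type K and a face H of type L whose chambers lie in Z. Then
  exactly m_KL faces G have support inside that of Z and satisfy ZG = H. Expanding the projection
  onto Z by the idempotents below its support and sorting the terms by the product ZG produces these
  coefficients. Products of faces are accessible without geometry because walls alone determine the
  projection of a chamber g onto Z: it is the unique chamber of Z lying on the same side as g of
  every wall through Z. Arguments on faces thus become set algebra with the sets of reflections
  separating a chamber from 1. Independence of the images of the E_P rests on triangularity: E_Q E_P
  = 0 unless Q is contained in P. For the Orlik-Solomon algebra it rests on projections of the
  exterior algebra to single flats. These preserve the ideal because the terms of a relation that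
  lie over the wrong flat are monomials of dependent lists, hence in the ideal one by one.\<close>

lemma orth_inv:
  fixes g :: "('n::finite) rmat"
  assumes "orthogonal_matrix g"
  shows "matrix_inv g = transpose g"
proof -
  have *: "g ** transpose g = mat 1" "transpose g ** g = mat 1"
    using assms by (auto simp: orthogonal_matrix_def)
  then have "g ** matrix_inv g = mat 1 \<and> matrix_inv g ** g = mat 1"
    unfolding matrix_inv_def by (rule someI[of "\<lambda>A. g ** A = mat 1 \<and> A ** g = mat 1", OF conjI])
  then show ?thesis
    by (metis *(2) matrix_mul_assoc matrix_mul_lid matrix_mul_rid)
qed

lemma orth_matrix_inv: "orthogonal_matrix (g :: ('n::finite) rmat) \<Longrightarrow> orthogonal_matrix (matrix_inv g)"
  by (simp add: orth_inv)

lemma orth_cancel: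
  fixes g :: "('n::finite) rmat"
  assumes "orthogonal_matrix g"
  shows "matrix_inv g ** g = mat 1" "g ** matrix_inv g = mat 1"
    "matrix_inv g ** (g ** x) = x" "g ** (matrix_inv g ** x) = x"
    "matrix_inv (matrix_inv g) = g"
  using assms by (auto simp: orth_inv orth_matrix_inv orthogonal_matrix_def matrix_mul_assoc)

lemma orth_inv_mult:
  fixes g h :: "('n::finite) rmat"
  assumes "orthogonal_matrix g" "orthogonal_matrix h"
  shows "matrix_inv (g ** h) = matrix_inv h ** matrix_inv g"
  using assms by (simp add: orth_inv orthogonal_matrix_mul matrix_transpose_mul)

lemma matrix_inv_one [simp]: "matrix_inv (mat 1 :: ('n::finite) rmat) = mat 1"
  by (simp add: orth_inv orthogonal_matrix_id)

lemma orth_inner: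
  fixes g :: "('n::finite) rmat"
  assumes "orthogonal_matrix g"
  shows "(u v* g) \<bullet> (v v* g) = u \<bullet> v"
  using assms
  by (metis dot_lmul_matrix orthogonal_matrix_def vector_matrix_mul_assoc vector_matrix_mul_rid
      vector_transpose_matrix)

lemma linear_vmult: "linear (\<lambda>v :: real^'n. v v* (g :: ('n::finite) rmat))"
  by (auto intro!: linearI simp: vector_matrix_left_distrib scaleR_vector_matrix_assoc)

definition Fix :: "('n::finite) rmat \<Rightarrow> (real^'n) set" where
  "Fix g = {v. v v* g = v}"

lemma subspace_Fix: "subspace (Fix g)"
  unfolding Fix_def subspace_def
  by (auto simp: vector_matrix_left_distrib scaleR_vector_matrix_assoc)

lemma fixW_Fix: "fixW H = (\<Inter>u\<in>H. Fix u)"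
  by (auto simp: fixW_def Fix_def)

lemma subspace_fixW: "subspace (fixW H)"
  unfolding fixW_Fix by (intro subspace_Inter) (auto simp: subspace_Fix)

text \<open>The definition prescribes only an orthogonal involution and the dimension of its fixed
  space. For a unit normal \<open>a\<close> of that hyperplane, \<open>a v* r + a\<close> is fixed,
  hence orthogonal to \<open>a\<close>; since \<open>a v* r - a\<close> is orthogonal to all fixed
  vectors, it is also orthogonal to \<open>a v* r\<close>, hence to itself.\<close>

lemma is_reflection_root:
  fixes r :: "('n::finite) rmat"
  assumes "is_reflection r"
  obtains a where "norm a = 1" "\<And>v. v v* r = v - (2 * (v \<bullet> a)) *\<^sub>R a" "Fix r = {v. v \<bullet> a = 0}"
proof -
  have o: "orthogonal_matrix r" and i: "r ** r = mat 1" and d: "dim (Fix r) = CARD('n) - 1"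
    using assms by (auto simp: is_reflection_def Fix_def)
  have c: "CARD('n) \<ge> 1" by (simp add: Suc_leI)
  have "Fix r \<noteq> UNIV"
  proof
    assume "Fix r = UNIV"
    with d have "CARD('n) = CARD('n) - 1" by simp
    with c show False by linarith
  qed
  then have "dim (Fix r) < DIM(real^'n)"
    using d c by simp
  then obtain b where b: "b \<noteq> 0" "\<And>v. v \<in> span (Fix r) \<Longrightarrow> orthogonal b v"
    using orthogonal_to_subspace_exists by metis
  define a where "a = b /\<^sub>R norm b"
  have na: "norm a = 1" using b by (simp add: a_def)
  have sF: "span (Fix r) = Fix r" by (simp add: span_eq_iff subspace_Fix)
  have "Fix r \<subseteq> {v. a \<bullet> v = 0}"
    using b sF by (auto simp: a_def orthogonal_def)
  moreover have "dim {v. a \<bullet> v = 0} = CARD('n) - 1"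
    using dim_hyperplane[of a] na by fastforce
  ultimately have F: "Fix r = {v. a \<bullet> v = 0}"
    using subspace_Fix subspace_hyperplane d by (metis subspace_dim_equal order_refl)
  have ar: "a v* r + a \<in> Fix r"
    by (simp add: Fix_def vector_matrix_left_distrib vector_matrix_mul_assoc i add.commute)
  have "(a v* r - a) \<bullet> w = 0" if "w \<in> Fix r" for w
    using that F orth_inner[OF o, of a w]
    by (auto simp: Fix_def inner_diff_left)
  moreover have "(a v* r) \<bullet> (a v* r) = 1"
    using orth_inner[OF o, of a a] na by (simp add: norm_eq_1)
  moreover have "(a v* r + a) \<bullet> a = 0" using ar F by (auto simp: inner_commute)
  moreover have "(a v* r - a) \<bullet> (a v* r + a) = 0" using calculation(1) ar by blast
  moreover have "w \<bullet> w = 0" if "w = a v* r + a" for w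
  proof -
    have "a \<bullet> (a v* r + a) = 0" using calculation(3) by (simp add: inner_commute)
    moreover have "(a v* r) \<bullet> (a v* r + a) = 0"
      using \<open>(a v* r - a) \<bullet> (a v* r + a) = 0\<close> calculation by (simp add: inner_diff_left)
    ultimately show ?thesis using that by (simp add: inner_add_left)
  qed
  ultimately have "a v* r + a = 0" by auto
  then have ra: "a v* r = - a" by (simp add: eq_neg_iff_add_eq_0)
  have f: "v v* r = v - (2 * (v \<bullet> a)) *\<^sub>R a" for v
  proof -
    have "v - (v \<bullet> a) *\<^sub>R a \<in> Fix r"
      unfolding F using na by (simp add: inner_diff_right norm_eq_1 inner_commute)
    then have "v v* r - (v \<bullet> a) *\<^sub>R (a v* r) = v - (v \<bullet> a) *\<^sub>R a"
      by (simp add: Fix_def vector_matrix_mult_diff_distrib scaleR_vector_matrix_assoc)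
    then show ?thesis
      unfolding ra by (simp add: algebra_simps flip: scaleR_left.add)
  qed
  show ?thesis
    using that[OF na f] F by (simp add: inner_commute)
qed

text \<open>An orthogonal change of basis taking a coordinate axis to the root makes the matrix
  diagonal with a single entry -1. The determinant later serves as the sign character and controls
  the parity of the length.\<close>

lemma det_reflection:
  fixes r :: "('n::finite) rmat"
  assumes "is_reflection r"
  shows "det r = -1"
proof -
  obtain a where na: "norm a = 1" and f: "\<And>v. v v* r = v - (2 * (v \<bullet> a)) *\<^sub>R a"
    using is_reflection_root[OF assms] by metis
  obtain A k where A: "orthogonal_matrix A" and Ak: "A *v (axis k 1) = a"
    using orthogonal_matrix_exists_basis[OF na] by metis
  define B where "B = A"
  have B: "orthogonal_matrix B" using A by (simp add: B_def)
  have Bk: "axis k 1 v* transpose B = a" using Ak by (simp add: B_def)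
  let ?D = "transpose B ** r ** B"
  have ax: "axis i 1 v* ?D = (if i = k then - axis i 1 else axis i 1)" for i
  proof -
    let ?v = "axis i 1 v* transpose B"
    have dd: "?v \<bullet> a = (axis i 1 :: real^'n) \<bullet> axis k 1"
      unfolding Bk[symmetric] by (rule orth_inner) (simp add: B)
    have bk1: "?v v* B = axis i 1"
      using B by (simp add: vector_matrix_mul_assoc orthogonal_matrix_def del: vector_transpose_matrix)
    have bk2: "a v* B = axis k 1"
      unfolding Bk[symmetric] using B
      by (simp add: vector_matrix_mul_assoc orthogonal_matrix_def del: vector_transpose_matrix)
    have "axis i 1 v* ?D = (?v v* r) v* B"
      by (simp only: vector_matrix_mul_assoc matrix_mul_assoc)
    also have "\<dots> = axis i 1 - (2 * (?v \<bullet> a)) *\<^sub>R axis k 1"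
      unfolding f by (simp add: vector_matrix_mult_diff_distrib scaleR_vector_matrix_assoc bk1 bk2
          del: vector_transpose_matrix)
    also have "\<dots> = (if i = k then - axis i 1 else axis i 1)"
      unfolding dd by (auto simp: inner_axis_axis algebra_simps scaleR_2)
    finally show ?thesis .
  qed
  have ent: "M $ i $ j = (axis i 1 v* M) $ j" for i j and M :: "'n rmat"
  proof -
    have "(axis i 1 v* M) $ j = (\<Sum>k\<in>UNIV. if k = i then M $ k $ j else 0)"
      unfolding vector_matrix_mult_def axis_def vec_lambda_beta by (rule sum.cong) auto
    then show ?thesis by simp
  qed
  have "det ?D = (\<Prod>i\<in>UNIV. ?D $ i $ i)"
    by (rule det_diagonal) (auto simp: ent[of ?D] ax, auto simp: axis_def)
  also have "\<dots> = (\<Prod>i\<in>UNIV. if i = k then -1 else 1)"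
    by (rule prod.cong) (auto simp: ent[of ?D] ax)
  also have "\<dots> = -1" by simp
  finally have "det ?D = -1" .
  moreover have "det ?D = det r * (det B * det B)"
    by (simp add: det_mul det_transpose)
  moreover have "det B * det B = 1"
    using det_orthogonal_matrix[OF B] by auto
  ultimately show ?thesis by simp
qed

section \<open>Words and generated subgroups\<close>

lemma mprod_Nil [simp]: "mprod [] = mat 1" and mprod_Cons [simp]: "mprod (w # ws) = w ** mprod ws"
  by (simp_all add: mprod_def)

lemma mprod_append [simp]: "mprod (us @ ws) = mprod us ** mprod ws"
  by (induction us) (auto simp: matrix_mul_assoc)

lemma gen_one [intro, simp]: "mat 1 \<in> gen L"
  unfolding gen_def by (auto intro!: exI[of _ "[]"])

lemma gen_base: "s \<in> L \<Longrightarrow> s \<in> gen L"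
  unfolding gen_def by (auto intro!: exI[of _ "[s]"])

lemma gen_mult: "g \<in> gen L \<Longrightarrow> h \<in> gen L \<Longrightarrow> g ** h \<in> gen L"
  unfolding gen_def by (smt (verit) mem_Collect_eq mprod_append set_append Un_subset_iff)

lemma gen_mono: "L \<subseteq> K \<Longrightarrow> gen L \<subseteq> gen K"
  unfolding gen_def by auto

lemma gen_induct [consumes 1, case_names one step]:
  assumes "g \<in> gen L" "P (mat 1)" "\<And>s g. s \<in> L \<Longrightarrow> g \<in> gen L \<Longrightarrow> P g \<Longrightarrow> P (s ** g)"
  shows "P g"
proof -
  obtain ws where ws: "set ws \<subseteq> L" "g = mprod ws" using assms(1) by (auto simp: gen_def)
  have "P (mprod ws)" using ws(1)
  proof (induction ws)
    case (Cons s ws)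
    then have "mprod ws \<in> gen L" by (auto simp: gen_def)
    with Cons assms(3) show ?case by auto
  qed (simp add: assms(2))
  then show ?thesis using ws by simp
qed

lemma fixW_gen: "fixW (gen L) = fixW L"
proof
  show "fixW (gen L) \<subseteq> fixW L" using gen_base by (auto simp: fixW_def)
  show "fixW L \<subseteq> fixW (gen L)"
  proof
    fix v assume v: "v \<in> fixW L"
    have "v v* g = v" if "g \<in> gen L" for g
      using that by (induction rule: gen_induct) (use v in \<open>auto simp: fixW_def vector_matrix_mul_assoc[symmetric]\<close>)
    then show "v \<in> fixW (gen L)" by (simp add: fixW_def)
  qed
qed

lemma conjg_one [simp]: "conjg g (mat 1) = g"
  by (simp add: conjg_def)


section \<open>Length, reflections and inversion sets\<close>

locale coxeter_group =
  fixes W S :: "('n::finite) rmat set"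
  assumes fc: "finite_coxeter W S"
begin

abbreviation T where "T \<equiv> refls W S"

lemma finite_W: "finite W" and W_gen: "W = gen S"
  and S_refl: "s \<in> S \<Longrightarrow> is_reflection s"
  and card_S: "card S = CARD('n)" and exchange: "exchange_cond S" and essential: "fixW W = {0}"
  using fc by (auto simp: finite_coxeter_def)

lemma S_sub: "S \<subseteq> W"
  unfolding W_gen using gen_base by auto

lemma finite_S: "finite S"
  using S_sub finite_W finite_subset by blast

lemma S_orth: "s \<in> S \<Longrightarrow> orthogonal_matrix s" and S_sq: "s \<in> S \<Longrightarrow> s ** s = mat 1"
  using S_refl by (auto simp: is_reflection_def)

lemma gen_sub: "K \<subseteq> S \<Longrightarrow> gen K \<subseteq> W"
  unfolding W_gen by (rule gen_mono)

lemma W_orth: "g \<in> W \<Longrightarrow> orthogonal_matrix g"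
  unfolding W_gen by (induction rule: gen_induct) (auto simp: orthogonal_matrix_id orthogonal_matrix_mul S_orth)

lemma S_inv: "s \<in> S \<Longrightarrow> matrix_inv s = s"
  by (metis S_orth S_sq matrix_mul_rid orth_cancel(3))

lemma gen_inv:
  assumes "g \<in> gen K" "K \<subseteq> S"
  shows "matrix_inv g \<in> gen K"
  using assms(1)
proof (induction rule: gen_induct)
  case (step s g)
  have "orthogonal_matrix s" "orthogonal_matrix g" "matrix_inv s = s"
    using step assms gen_sub[of K] by (auto intro: W_orth S_orth S_inv)
  then have "matrix_inv (s ** g) = matrix_inv g ** s"
    by (simp add: orth_inv_mult)
  with step show ?case using gen_mult gen_base by metis
qed simp

lemma W_one [simp]: "mat 1 \<in> W"
  and W_mult [simp]: "g \<in> W \<Longrightarrow> h \<in> W \<Longrightarrow> g ** h \<in> W"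
  and W_inv [simp]: "g \<in> W \<Longrightarrow> matrix_inv g \<in> W"
  using gen_inv[of _ S] gen_mult[of _ S] by (auto simp: W_gen)

lemma S_W [simp]: "s \<in> S \<Longrightarrow> s \<in> W"
  using S_sub by auto

lemmas W_cancel [simp] = orth_cancel[OF W_orth]

lemma W_inv_mult [simp]: "g \<in> W \<Longrightarrow> h \<in> W \<Longrightarrow> matrix_inv (g ** h) = matrix_inv h ** matrix_inv g"
  by (simp add: W_orth orth_inv_mult)

lemmas mm = matrix_mul_assoc[symmetric]

lemma S_cancel: "s \<in> S \<Longrightarrow> s ** (s ** x) = x"
  by (simp add: matrix_mul_assoc S_sq)

lemma W_left_cancel: "g \<in> W \<Longrightarrow> g ** x = g ** y \<longleftrightarrow> x = y"
  by (metis W_cancel(3))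

lemma W_right_cancel: "g \<in> W \<Longrightarrow> x ** g = y ** g \<longleftrightarrow> x = y"
  by (metis W_cancel(2) matrix_mul_assoc matrix_mul_rid)

lemma conjg_W [simp]: "g \<in> W \<Longrightarrow> h \<in> W \<Longrightarrow> conjg g h \<in> W"
  by (simp add: conjg_def)

lemma conjg_mult: "g \<in> W \<Longrightarrow> h \<in> W \<Longrightarrow> conjg x (g ** h) = conjg (conjg x g) h"
  by (simp add: conjg_def mm)

lemma conjg_inv_l [simp]: "g \<in> W \<Longrightarrow> conjg (conjg x (matrix_inv g)) g = x"
  and conjg_inv_r [simp]: "g \<in> W \<Longrightarrow> conjg (conjg x g) (matrix_inv g) = x"
  by (simp_all add: conjg_def mm)

lemma conjg_hom: "g \<in> W \<Longrightarrow> conjg (x ** y) g = conjg x g ** conjg y g"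
  by (simp add: conjg_def mm)

lemma T_I: "s \<in> S \<Longrightarrow> x \<in> W \<Longrightarrow> conjg s x \<in> T"
  by (auto simp: refls_def)

lemma T_E:
  assumes "t \<in> T" obtains s x where "s \<in> S" "x \<in> W" "t = conjg s x"
  using assms by (auto simp: refls_def)

lemma S_T: "s \<in> S \<Longrightarrow> s \<in> T"
  using T_I[of s "mat 1"] by simp

lemma T_W [simp]: "t \<in> T \<Longrightarrow> t \<in> W"
  by (auto elim!: T_E)

lemma finite_T: "finite T"
  using finite_W by (rule finite_subset[rotated]) (auto intro: T_W)

lemma T_conjg: "t \<in> T \<Longrightarrow> x \<in> W \<Longrightarrow> conjg t x \<in> T"
  by (metis T_E T_I W_mult conjg_mult)

lemma T_sq: "t \<in> T \<Longrightarrow> t ** t = mat 1"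
  by (elim T_E) (simp add: conjg_def mm S_cancel)

lemma T_inv: "t \<in> T \<Longrightarrow> matrix_inv t = t"
  by (elim T_E) (simp add: conjg_def mm S_inv)

lemma T_cancel: "t \<in> T \<Longrightarrow> t ** (t ** x) = x"
  by (simp add: matrix_mul_assoc T_sq)

section \<open>Length, parity and the folding condition\<close>

lemma len_le: "set ws \<subseteq> S \<Longrightarrow> len S (mprod ws) \<le> length ws"
  unfolding len_def by (rule Least_le) auto

lemma len_word:
  assumes "w \<in> W"
  obtains ws where "set ws \<subseteq> S" "mprod ws = w" "length ws = len S w"
proof -
  have "\<exists>k ws. length ws = k \<and> set ws \<subseteq> S \<and> mprod ws = w"
    using assms by (auto simp: W_gen gen_def)
  then have "\<exists>ws. length ws = len S w \<and> set ws \<subseteq> S \<and> mprod ws = w"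
    unfolding len_def by (rule LeastI_ex)
  then show ?thesis using that by blast
qed

lemma word_W: "set ws \<subseteq> S \<Longrightarrow> mprod ws \<in> W"
  by (auto simp: W_gen gen_def)

lemma det_word: "set ws \<subseteq> S \<Longrightarrow> det (mprod ws) = (-1) ^ length ws"
  by (induction ws) (auto simp: det_mul det_reflection S_refl)

lemma det_len: "w \<in> W \<Longrightarrow> det w = (-1) ^ len S w"
  by (metis len_word det_word)

lemma sgn_char_det: "w \<in> W \<Longrightarrow> sgn_char S w = complex_of_real (det w)"
  by (simp add: sgn_char_def det_len)

lemma len_one [simp]: "len S (mat 1) = 0"
  using len_le[of "[]"] by simp

lemma len_0_iff: "w \<in> W \<Longrightarrow> len S w = 0 \<longleftrightarrow> w = mat 1"
  by (metis len_one len_word length_0_conv mprod_Nil)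

lemma len_S_mult_neq:
  assumes "s \<in> S" "w \<in> W" shows "len S (s ** w) \<noteq> len S w"
proof
  assume "len S (s ** w) = len S w"
  then have "det (s ** w) = det w" using assms by (simp add: det_len)
  moreover have "det w \<noteq> 0" using assms by (simp add: det_len)
  ultimately show False using assms by (simp add: det_mul det_reflection S_refl)
qed

lemma len_mult_S_le: 
  assumes "s \<in> S" "w \<in> W" shows "len S (w ** s) \<le> Suc (len S w)"
proof -
  obtain ws where "set ws \<subseteq> S" "mprod ws = w" "length ws = len S w" by (rule len_word[OF assms(2)])
  then show ?thesis using len_le[of "ws @ [s]"] assms by simp
qed

text \<open>The folding condition, and the one place where the exchange condition enters: passing
  from the chamber \<open>w\<close> to its neighbour \<open>w ** r\<close> can leave the half-space
  of \<open>s\<close> only through the wall of \<open>s\<close> itself. Exchange is applied to a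
  reduced word of \<open>w ** r\<close> that ends in \<open>r\<close>.\<close>

lemma len_cross:
  assumes s: "s \<in> S" and r: "r \<in> S" and w: "w \<in> W"
    and up: "len S w < len S (s ** w)" and down: "len S (s ** (w ** r)) < len S (w ** r)"
  shows "s ** w = w ** r"
proof -
  have swr: "s ** (w ** r) = (s ** w) ** r" by (simp add: mm)
  have 1: "len S (s ** w) \<le> Suc (len S (s ** (w ** r)))"
    using len_mult_S_le[of r "s ** w ** r"] s r w by (simp add: mm S_sq)
  have lwr: "len S (w ** r) = Suc (len S w)"
    using 1 up down len_mult_S_le[OF r w] by linarith
  obtain ws where ws: "set ws \<subseteq> S" "mprod ws = w" "length ws = len S w" by (rule len_word[OF w])
  let ?ws = "ws @ [r]"
  have "\<exists>i<length ?ws. s ** mprod ?ws = mprod (take i ?ws @ drop (Suc i) ?ws)"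
  proof (rule exchange[unfolded exchange_cond_def, rule_format])
    show "set ?ws \<subseteq> S \<and> s \<in> S \<and> length ?ws = len S (mprod ?ws) \<and> len S (s ** mprod ?ws) < length ?ws"
      using ws r s lwr down by simp
  qed
  then obtain i where "i < length ?ws" "s ** mprod ?ws = mprod (take i ?ws @ drop (Suc i) ?ws)" by blast
  moreover have "mprod ?ws = w ** r" using ws by simp
  ultimately have i: "i \<le> length ws" "s ** (w ** r) = mprod (take i ?ws @ drop (Suc i) ?ws)"
    by auto
  \<comment> \<open>If the deleted letter is the appended \<open>r\<close>, the claim follows. If it
    is an earlier one, cancelling \<open>r\<close> writes \<open>s ** w\<close> with fewer letters
    than \<open>w\<close>, against the assumption that \<open>s\<close> lengthens
    \<open>w\<close>.\<close>
  show ?thesis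
  proof (cases "i = length ws")
    case True
    then have "s ** (w ** r) = w" using i ws by simp
    then show ?thesis using s r w by (metis S_sq matrix_mul_assoc matrix_mul_rid)
  next
    case False
    then have "i < length ws" using i by simp
    then have "s ** (w ** r) = mprod (take i ws @ drop (Suc i) ws) ** r" using i(2) by (simp add: mm)
    then have "s ** w = mprod (take i ws @ drop (Suc i) ws)"
      using r by (metis S_W W_right_cancel matrix_mul_assoc)
    moreover have "set (take i ws @ drop (Suc i) ws) \<subseteq> S"
      using ws(1) by (auto dest: in_set_takeD in_set_dropD)
    ultimately have "len S (s ** w) \<le> length (take i ws @ drop (Suc i) ws)"
      using len_le by metis
    then show ?thesis using up ws \<open>i < length ws\<close> by simp
  qed
qed

section \<open>Half-spaces and inversion sets\<close>

lemma side_cross: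
  assumes s: "s \<in> S" and r: "r \<in> S" and w: "w \<in> W"
  shows "(len S w < len S (s ** w)) \<noteq> (len S (w ** r) < len S (s ** (w ** r))) \<longleftrightarrow> s ** w = w ** r"
proof -
  have ne: "len S (s ** w) \<noteq> len S w" "len S (s ** (w ** r)) \<noteq> len S (w ** r)"
    by (rule len_S_mult_neq; simp add: assms)+
  have wrr: "w ** r ** r = w" by (simp add: mm S_sq r)
  have eq: "s ** (w ** r) = w" if "s ** w = w ** r" using that wrr by (simp add: matrix_mul_assoc)
  have "s ** w = w ** r" if "\<not> len S w < len S (s ** w)" "len S (w ** r) < len S (s ** (w ** r))"
  proof -
    have "s ** (w ** r) = (w ** r) ** r"
      by (rule len_cross) (use that s r w ne wrr in auto)
    then show ?thesis using s wrr by (metis S_cancel)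
  qed
  moreover have "s ** w = w ** r" if "len S w < len S (s ** w)" "\<not> len S (w ** r) < len S (s ** (w ** r))"
    by (rule len_cross) (use that s r w ne in auto)
  ultimately show ?thesis using eq ne by fastforce
qed

text \<open>One of the two half-spaces of the reflection \<open>conjg s x\<close>, as a property of
  the chamber \<open>w\<close>. Left translation by \<open>x\<close> moves the wall to that of the
  simple reflection \<open>s\<close>, where the comparison of lengths is governed by the folding
  condition. The pair (x, s) determines which of the two half-spaces is meant.\<close>

definition side :: "'n rmat \<Rightarrow> 'n rmat \<Rightarrow> 'n rmat \<Rightarrow> bool" where
  "side x s w \<longleftrightarrow> len S (x ** w) < len S (s ** (x ** w))"

lemma side_cross':
  assumes "s \<in> S" "r \<in> S" "w \<in> W" "x \<in> W"
  shows "side x s w \<noteq> side x s (w ** r) \<longleftrightarrow> conjg s x ** w = w ** r"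
proof -
  have "side x s w \<noteq> side x s (w ** r) \<longleftrightarrow> s ** (x ** w) = (x ** w) ** r"
    using side_cross[of s r "x ** w"] assms by (simp add: side_def mm)
  also have "\<dots> \<longleftrightarrow> conjg s x ** w = w ** r"
    using assms W_left_cancel[of "matrix_inv x" "s ** (x ** w)" "x ** (w ** r)"]
    by (simp add: conjg_def mm)
  finally show ?thesis .
qed

lemma gen_rev_induct [consumes 1, case_names one step]:
  assumes "g \<in> gen L" "P (mat 1)" "\<And>s g. s \<in> L \<Longrightarrow> g \<in> gen L \<Longrightarrow> P g \<Longrightarrow> P (g ** s)"
  shows "P g"
proof -
  obtain ws where ws: "set ws \<subseteq> L" "g = mprod ws" using assms(1) by (auto simp: gen_def)
  have "P (mprod ws)" using ws(1)
  proof (induction ws rule: rev_induct)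
    case (snoc s ws)
    then have "mprod ws \<in> gen L" by (auto simp: gen_def)
    with snoc assms(3) show ?case by auto
  qed (simp add: assms(2))
  then show ?thesis using ws by simp
qed

text \<open>Two half-spaces of the same reflection have the same boundary in the Cayley graph,
  which is connected, so they are equal or complementary.\<close>
lemma side_indep:
  assumes "w \<in> W" "s \<in> S" "x \<in> W" "s' \<in> S" "x' \<in> W" "conjg s x = conjg s' x'"
  shows "side x s w \<noteq> side x s (mat 1) \<longleftrightarrow> side x' s' w \<noteq> side x' s' (mat 1)"
  using assms(1) unfolding W_gen
proof (induction rule: gen_rev_induct)
  case (step r w)
  then show ?case
    using side_cross'[of s r w x] side_cross'[of s' r w x'] assms(2-) by (auto simp: W_gen[symmetric])
qed simp

text \<open>The inversion set of \<open>w\<close>: the reflections separating \<open>w\<close> from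
  1. The description by lengths is recovered in \<open>N_len\<close>; starting from separation makes
  the cocycle rule \<open>N_mult\<close> nearly immediate.\<close>

definition N :: "'n rmat \<Rightarrow> 'n rmat set" where
  "N w = {t. \<exists>s\<in>S. \<exists>x\<in>W. t = conjg s x \<and> (side x s w \<noteq> side x s (mat 1))}"

lemma N_iff:
  assumes "s \<in> S" "x \<in> W" "w \<in> W"
  shows "conjg s x \<in> N w \<longleftrightarrow> (side x s w \<noteq> side x s (mat 1))"
proof
  assume "conjg s x \<in> N w"
  then obtain s' x' where h: "s' \<in> S" "x' \<in> W" "conjg s x = conjg s' x'"
    "side x' s' w \<noteq> side x' s' (mat 1)"
    unfolding N_def by blast
  show "side x s w \<noteq> side x s (mat 1)"
    by (rule iffD2[OF side_indep[OF assms(3,1,2) h(1,2,3)] h(4)])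
next
  assume "side x s w \<noteq> side x s (mat 1)"
  then show "conjg s x \<in> N w" unfolding N_def using assms by blast
qed

lemma N_sub: "N w \<subseteq> T"
  unfolding N_def refls_def by blast

lemma N_one [simp]: "N (mat 1) = {}"
  by (simp add: N_def)

lemma N_mult:
  assumes "u \<in> W" "w \<in> W" "t \<in> T"
  shows "t \<in> N (u ** w) \<longleftrightarrow> (t \<in> N u) \<noteq> (conjg t u \<in> N w)"
proof -
  obtain s x where t: "s \<in> S" "x \<in> W" "t = conjg s x" using T_E[OF assms(3)] .
  have "conjg t u = conjg s (x ** u)" using assms t by (simp add: conjg_mult)
  then have "conjg t u \<in> N w \<longleftrightarrow> side x s (u ** w) \<noteq> side x s u"
    using N_iff[of s "x ** u" w] assms t by (simp add: side_def mm)
  then show ?thesis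
    using N_iff[of s x] assms t by auto
qed

lemma N_S:
  assumes "s \<in> S" shows "N s = {s}"
proof -
  have "t \<in> N s \<longleftrightarrow> t = s" if tT: "t \<in> T" for t
  proof -
    obtain r x where t: "r \<in> S" "x \<in> W" "t = conjg r x" using T_E[OF tT] .
    then show ?thesis using side_cross'[of r s "mat 1" x] N_iff[of r x s] assms by auto
  qed
  then show ?thesis using N_sub S_T assms by blast
qed

lemma N_S_iff: "s \<in> S \<Longrightarrow> w \<in> W \<Longrightarrow> s \<in> N w \<longleftrightarrow> len S (s ** w) < len S w"
  using N_iff[of s "mat 1" w] len_0_iff[of s] len_S_mult_neq[of s w] len_S_mult_neq[of s "mat 1"]
  by (auto simp: side_def)

text \<open>Strong exchange, for words that need not be reduced. The gallery spelled by
  \<open>ws\<close> has to cross the wall of \<open>t\<close>; removing the letter at a crossing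
  reflects the part of the gallery before it. In the induction \<open>t\<close> is either the first
  letter or is conjugated by it.\<close>

lemma N_delete:
  assumes "set ws \<subseteq> S" "t \<in> N (mprod ws)"
  shows "\<exists>i<length ws. t ** mprod ws = mprod (take i ws @ drop (Suc i) ws)"
  using assms
proof (induction ws arbitrary: t)
  case (Cons s ws)
  then have s: "s \<in> S" and w: "mprod ws \<in> W" by (auto intro: word_W)
  have t: "t \<in> T" using Cons N_sub by auto
  show ?case
  proof (cases "t = s")
    case True
    then show ?thesis by (intro exI[of _ 0]) (simp add: S_cancel s)
  next
    case False
    then have "conjg t s \<in> N (mprod ws)"
      using Cons.prems N_mult[of s "mprod ws" t] s w t N_S[OF s] by auto
    with Cons obtain i where i: "i < length ws" "conjg t s ** mprod ws = mprod (take i ws @ drop (Suc i) ws)"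
      by auto
    then have "s ** (t ** (s ** mprod ws)) = mprod (take i ws @ drop (Suc i) ws)"
      using s by (simp add: conjg_def mm S_inv)
    then have "t ** (s ** mprod ws) = s ** mprod (take i ws @ drop (Suc i) ws)"
      using s by (metis S_cancel)
    then show ?thesis using i(1) by (intro exI[of _ "Suc i"]) simp
  qed
qed simp

lemma T_in_N_self:
  assumes "t \<in> T" shows "t \<in> N t"
proof -
  obtain s x where t: "s \<in> S" "x \<in> W" "t = conjg s x" using T_E[OF assms] .
  have "len S (s ** x) \<noteq> len S x" using t by (intro len_S_mult_neq)
  then show ?thesis
    using t N_iff[of s x t] assms by (auto simp: side_def conjg_def mm S_cancel)
qed

text \<open>Deletion in a reduced word gives one direction. For the other, \<open>t\<close> inverts
  itself, so if it is not an inversion of \<open>w\<close> it is one of \<open>t ** w\<close>, to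
  which the first direction applies.\<close>

lemma N_len:
  assumes "t \<in> T" "w \<in> W" shows "t \<in> N w \<longleftrightarrow> len S (t ** w) < len S w"
proof -
  have *: "len S (t ** w) < len S w" if tN: "t \<in> N w" and wW: "w \<in> W" for w
  proof -
    obtain ws where ws: "set ws \<subseteq> S" "mprod ws = w" "length ws = len S w" by (rule len_word[OF wW])
    then obtain i where i: "i<length ws" "t ** w = mprod (take i ws @ drop (Suc i) ws)"
      using N_delete tN by blast
    have "set (take i ws @ drop (Suc i) ws) \<subseteq> S"
      using ws(1) by (auto dest: in_set_takeD in_set_dropD)
    then have "len S (t ** w) \<le> length (take i ws @ drop (Suc i) ws)"
      using len_le i(2) by metis
    then show ?thesis using i ws by simp
  qed
  show ?thesis
  proof (cases "t \<in> N w")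
    case False
    have "conjg t t = t" using assms by (simp add: conjg_def T_sq T_inv)
    then have "t \<in> N (t ** w)" using False assms N_mult[of t w t] T_in_N_self by auto
    from *[OF this] show ?thesis using False assms by (simp add: T_cancel)
  qed (use * assms in auto)
qed

section \<open>Inversions in standard parabolic subgroups and minimal coset representatives\<close>

lemma N_gen:
  assumes "u \<in> gen K" "K \<subseteq> S" shows "N u \<subseteq> gen K"
  using assms(1)
proof (induction rule: gen_induct)
  case (step s g)
  have s: "s \<in> S" "g \<in> W" using step assms gen_sub by auto
  show ?case
  proof
    fix t assume t: "t \<in> N (s ** g)"
    then have tT: "t \<in> T" using N_sub by auto
    then have "t = s \<or> conjg t s \<in> N g" using N_mult[of s g t] s t N_S by auto
    then show "t \<in> gen K"
    proof
      assume "conjg t s \<in> N g"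
      then have "conjg t s \<in> gen K" using step.IH by blast
      then have "s ** (conjg t s ** s) \<in> gen K"
        using step by (intro gen_mult) (auto simp: gen_base)
      then show ?thesis using s by (simp add: conjg_def mm S_inv S_cancel S_sq)
    qed (use step gen_base in auto)
  qed
qed simp

text \<open>The word chosen is a shortest one among words with letters in \<open>K\<close>, not a
  reduced word over \<open>S\<close>. Deletion keeps the letters in \<open>K\<close>, so its first
  letter must be a descent, and no comparison between the length in W_K and the length in W is
  required.\<close>

lemma gen_descent:
  assumes "u \<in> gen K" "K \<subseteq> S" "u \<noteq> mat 1"
  obtains s where "s \<in> K" "s \<in> N u"
proof -
  let ?P = "\<lambda>k. \<exists>ws. length ws = k \<and> set ws \<subseteq> K \<and> mprod ws = u"
  have "\<exists>k. ?P k" using assms by (auto simp: gen_def)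
  then have "?P (Least ?P)" by (rule LeastI_ex)
  then obtain ws where ws: "length ws = Least ?P" "set ws \<subseteq> K" "mprod ws = u" by blast
  have min: "length ws \<le> length vs" if "set vs \<subseteq> K" "mprod vs = u" for vs
    unfolding ws(1) using that by (auto intro: Least_le)
  obtain s vs where w: "ws = s # vs" using ws(3) assms(3) by (cases ws) auto
  have s: "s \<in> S" and vs: "set vs \<subseteq> S" using w ws assms by auto
  have "s \<in> N u"
  proof (rule ccontr)
    assume "s \<notin> N u"
    then have "s \<in> N (mprod vs)"
      using N_mult[of s "mprod vs" s] ws w s vs N_S[OF s] S_T word_W
      by (auto simp: conjg_def S_inv S_sq)
    then obtain i where i: "i < length vs" "s ** mprod vs = mprod (take i vs @ drop (Suc i) vs)"
      using N_delete vs by blast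
    have "set (take i vs @ drop (Suc i) vs) \<subseteq> K"
      using w ws by (auto dest: in_set_takeD in_set_dropD)
    from min[OF this] i w ws(3) show False by simp
  qed
  then show ?thesis using that w ws by auto
qed

lemma N_empty: "w \<in> W \<Longrightarrow> N w = {} \<Longrightarrow> w = mat 1"
  using gen_descent[of w S] W_gen by blast

text \<open>Splitting off the unique descent leaves an element without inversions. This is the
  criterion by which conjugates of simple reflections are later recognised as simple again.\<close>

lemma N_eq_one:
  assumes "w \<in> W" "N w = {t}" shows "w = t" "t \<in> S"
proof -
  have "w \<noteq> mat 1" using assms by auto
  then obtain s where s: "s \<in> S" "s \<in> N w" using gen_descent[of w S] assms W_gen by auto
  then have t: "t = s" using assms by auto
  have "N (s ** w) = {}"
  proof (rule ccontr)
    assume "N (s ** w) \<noteq> {}"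
    then obtain r where r: "r \<in> N (s ** w)" by auto
    then have rT: "r \<in> T" using N_sub by auto
    have "(r = s) \<noteq> (conjg r s = s)" using N_mult[of s w r] s assms t rT r N_S by auto
    moreover have "conjg r s = s \<longleftrightarrow> r = s"
      using s by (auto simp: conjg_def S_inv S_sq mm) (metis S_cancel S_sq S_W W_right_cancel matrix_mul_lid)
    ultimately show False by simp
  qed
  then have "s ** w = mat 1" using s assms by (intro N_empty) auto
  then have "w = s" using s by (metis S_cancel matrix_mul_rid)
  then show "w = t" "t \<in> S" using t s by auto
qed

text \<open>The definition of X_K excludes simple inversions; in fact no reflection of W_K is
  inverted. A shortest element of the coset W_K x inverts no reflection of W_K, because such a
  reflection would shorten it, and the factor by which it differs from \<open>x\<close> turns out to
  be trivial.\<close>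

lemma Xset_iff:
  assumes K: "K \<subseteq> S"
  shows "x \<in> Xset W S K \<longleftrightarrow> x \<in> W \<and> N x \<inter> gen K = {}"
proof
  assume x: "x \<in> Xset W S K"
  then have xW: "x \<in> W" by (simp add: Xset_def)
  have noK: "s \<notin> N x" if "s \<in> K" for s
  proof -
    have "s \<in> S" "len S x < len S (s ** x)" using x that K by (auto simp: Xset_def)
    then show ?thesis using xW by (simp add: N_S_iff)
  qed
  let ?A = "(\<lambda>u. u ** x) ` gen K"
  have "x \<in> ?A" by (rule image_eqI[of _ _ "mat 1"]) auto
  from ex_has_least_nat[where P = "\<lambda>y. y \<in> ?A" and m = "len S", OF this]
  obtain y where y: "y \<in> ?A" "\<And>z. z \<in> ?A \<Longrightarrow> len S y \<le> len S z"
    by blast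
  then obtain u where u: "u \<in> gen K" "y = u ** x" by auto
  have uW: "u \<in> W" using u gen_sub K by auto
  have Ny: "N y \<inter> gen K = {}"
  proof (rule ccontr)
    assume "\<not> ?thesis"
    then obtain t where t: "t \<in> N y" "t \<in> gen K" by auto
    then have "len S (t ** y) < len S y" using N_len[of t y] N_sub u xW uW by auto
    moreover have "t ** y \<in> ?A" unfolding u(2) matrix_mul_assoc by (rule imageI) (simp add: gen_mult t u)
    ultimately show False using y(2) by (meson leD)
  qed
  let ?v = "matrix_inv u"
  have v: "?v \<in> gen K" using u gen_inv K by simp
  have xv: "x = ?v ** y" using u uW by simp
  \<comment> \<open>Conjugation by \<open>?v\<close> keeps \<open>t\<close> inside W_K, where
    \<open>y\<close> has no inversions, so only the factor \<open>?v\<close> contributes. A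
    nontrivial \<open>?v\<close> would then pass one of its descents in \<open>K\<close> on to
    \<open>x\<close>.\<close>
  have "t \<in> N x \<longleftrightarrow> t \<in> N ?v" if "t \<in> gen K" "t \<in> T" for t
  proof -
    have "conjg t ?v \<in> gen K" using that u v uW by (auto simp: conjg_def intro!: gen_mult)
    then have "conjg t ?v \<notin> N y" using Ny by blast
    moreover have "?v \<in> W" "y \<in> W" using uW xW u(2) by simp_all
    ultimately show ?thesis using N_mult[of ?v y t] that(2) unfolding xv[symmetric] by blast
  qed
  moreover have "?v = mat 1"
  proof (rule ccontr)
    assume "?v \<noteq> mat 1"
    then obtain s where s: "s \<in> K" "s \<in> N ?v" by (rule gen_descent[OF v K])
    then have "s \<in> T" "s \<in> gen K" using K S_T gen_base by blast+
    then have "s \<in> N x" using calculation[of s] s by blast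
    with s noK show False by blast
  qed
  ultimately show "x \<in> W \<and> N x \<inter> gen K = {}"
    using xW N_sub by auto
next
  assume x: "x \<in> W \<and> N x \<inter> gen K = {}"
  have "len S x < len S (s ** x)" if "s \<in> K" for s
  proof -
    have s: "s \<in> S" using that K by auto
    then have "s \<notin> N x" using x gen_base[OF that] by auto
    then have "\<not> len S (s ** x) < len S x" using s x by (simp add: N_S_iff)
    then show ?thesis using len_S_mult_neq[of s x] s x by linarith
  qed
  then show "x \<in> Xset W S K" using x by (simp add: Xset_def)
qed

text \<open>A reflection not inverted by an element of maximal length would lengthen it, so
  everything is inverted. The element serves to produce the face opposite to a given one; for this
  its conjugation has to preserve \<open>S\<close>.\<close>

lemma longest:
  obtains w0 where "w0 \<in> W" "N w0 = T" "N (matrix_inv w0) = T" "\<And>s. s \<in> S \<Longrightarrow> conjg s (matrix_inv w0) \<in> S"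
proof -
  have "finite (len S ` W)" "len S ` W \<noteq> {}" using finite_W W_one by (auto simp del: W_one)
  then obtain w0 where w0: "w0 \<in> W" "\<And>w. w \<in> W \<Longrightarrow> len S w \<le> len S w0"
    by (metis (no_types, lifting) Max_in Max_ge imageE imageI)
  have N0: "N w0 = T"
  proof
    show "T \<subseteq> N w0"
    proof
      fix t assume t: "t \<in> T"
      show "t \<in> N w0"
      proof (rule ccontr)
        assume n: "t \<notin> N w0"
        have "conjg t t = t" using t by (simp add: conjg_def T_sq T_inv)
        then have "t \<in> N (t ** w0)" using n w0 t N_mult[of t w0 t] T_in_N_self by auto
        then have "len S w0 < len S (t ** w0)" using N_len[of t "t ** w0"] t w0 by (simp add: T_cancel)
        then show False using w0(2)[of "t ** w0"] t w0(1) by simp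
      qed
    qed
  qed (rule N_sub)
  have Ni: "N (matrix_inv w0) = T"
  proof -
    have "t \<in> N (matrix_inv w0)" if "t \<in> T" for t
      using N_mult[of "matrix_inv w0" w0 t] that w0 N0 T_conjg by auto
    then show ?thesis using N_sub by auto
  qed
  have "conjg s (matrix_inv w0) \<in> S" if s: "s \<in> S" for s
  proof -
    let ?t = "conjg s (matrix_inv w0)"
    have tT: "?t \<in> T" using T_I w0 s by auto
    have eq: "?t = w0 ** s ** matrix_inv w0" using w0 by (simp add: conjg_def mm)
    \<comment> \<open>In the product of \<open>w0\<close>, \<open>s\<close> and the inverse of
      \<open>w0\<close> the outer factors invert every reflection and cancel, which leaves the
      single wall contributed by \<open>s\<close>.\<close>
    have "r \<in> N ?t \<longleftrightarrow> r = ?t" if r: "r \<in> T" for r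
    proof -
      have c: "conjg r w0 \<in> T" using r w0 T_conjg by auto
      have "r \<in> N ?t \<longleftrightarrow> (r \<in> N (w0 ** s)) \<noteq> (conjg r (w0 ** s) \<in> N (matrix_inv w0))"
        unfolding eq using N_mult[of "w0 ** s" "matrix_inv w0" r] w0 s r by auto
      also have "\<dots> \<longleftrightarrow> r \<notin> N (w0 ** s)" using Ni T_conjg[OF r, of "w0 ** s"] w0 s by auto
      also have "\<dots> \<longleftrightarrow> conjg r w0 = s"
        using N_mult[of w0 s r] w0 s r N0 N_S by auto
      also have "\<dots> \<longleftrightarrow> r = ?t" using w0 s by auto
      finally show ?thesis .
    qed
    then have "N ?t = {?t}" using N_sub tT by auto
    then show ?thesis using N_eq_one(2)[of ?t ?t] tT by simp
  qed
  then show ?thesis using that w0(1) N0 Ni by blast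
qed

end


section \<open>Faces and parabolic subgroups\<close>

context coxeter_group
begin

section \<open>Walls separating chambers\<close>

lemma mprod_rev:
  assumes "set ws \<subseteq> S" shows "mprod (rev ws) = matrix_inv (mprod ws)"
  using assms
proof (induction ws)
  case (Cons s ws)
  then have "mprod ws \<in> W" "s \<in> S" by (auto intro: word_W)
  with Cons show ?case by (simp add: S_inv)
qed simp

lemma len_inv:
  assumes "w \<in> W" shows "len S (matrix_inv w) = len S w"
proof -
  have *: "len S (matrix_inv w) \<le> len S w" if w: "w \<in> W" for w
  proof -
    obtain ws where ws: "set ws \<subseteq> S" "mprod ws = w" "length ws = len S w" by (rule len_word[OF w])
    then show ?thesis using len_le[of "rev ws"] mprod_rev[of ws] by simp
  qed
  show ?thesis using *[of w] *[of "matrix_inv w"] assms by simp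
qed

lemma N_inv:
  assumes "x \<in> W" "r \<in> T"
  shows "conjg r x \<in> N (matrix_inv x) \<longleftrightarrow> r \<in> N x"
  using N_mult[of x "matrix_inv x" r] assms by simp

lemma conjg_inj: "g \<in> W \<Longrightarrow> conjg x g = conjg y g \<longleftrightarrow> x = y"
  by (metis conjg_inv_r)

text \<open>The walls (for the action on the right) separating the chamber \<open>g\<close> from the chamber \<open>1\<close>.\<close>
definition M :: "'n rmat \<Rightarrow> 'n rmat set" where
  "M g = N (matrix_inv g)"

lemma M_sub: "M g \<subseteq> T"
  unfolding M_def by (rule N_sub)

lemma M_one [simp]: "M (mat 1) = {}"
  by (simp add: M_def)

lemma M_mult:
  assumes "u \<in> W" "g \<in> W" "t \<in> T"
  shows "t \<in> M (u ** g) \<longleftrightarrow> (t \<in> M g) \<noteq> (conjg t (matrix_inv g) \<in> M u)"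
  using N_mult[of "matrix_inv g" "matrix_inv u" t] assms by (simp add: M_def)

lemma M_inj:
  assumes "g \<in> W" "h \<in> W" "M g = M h" shows "g = h"
proof -
  let ?u = "h ** matrix_inv g"
  have eq: "?u ** g = h" using assms by (simp add: mm)
  have "r \<notin> M ?u" if r: "r \<in> T" for r
  proof -
    have "conjg r g \<in> M (?u ** g) \<longleftrightarrow> (conjg r g \<in> M g) \<noteq> (r \<in> M ?u)"
      using M_mult[of ?u g "conjg r g"] assms(1,2) r T_conjg by simp
    then show ?thesis unfolding eq assms(3) by blast
  qed
  then have "N (matrix_inv ?u) = {}" using N_sub unfolding M_def by blast
  then have "matrix_inv ?u = mat 1" using assms by (intro N_empty) simp_all
  then have "?u = mat 1" using assms W_cancel(5)[of ?u] by simp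
  then show ?thesis using eq by simp
qed

text \<open>A face of type \<open>K\<close> is encoded as the right coset of \<open>W\<^sub>K\<close> formed by the chambers containing it;
  its support is its stabiliser, a parabolic subgroup standing for the flat spanned by the face.\<close>
definition coset :: "'n rmat set \<Rightarrow> 'n rmat \<Rightarrow> 'n rmat set" where
  "coset K y = {h \<in> W. h ** matrix_inv y \<in> gen K}"

definition par :: "'n rmat set \<Rightarrow> 'n rmat \<Rightarrow> 'n rmat set" where
  "par K y = {w \<in> W. y ** (w ** matrix_inv y) \<in> gen K}"

definition faces :: "'n rmat set set" where
  "faces = {coset K y | K y. K \<subseteq> S \<and> y \<in> W}"

definition parabs :: "'n rmat set set" where
  "parabs = {par K y | K y. K \<subseteq> S \<and> y \<in> W}"

definition supp :: "'n rmat set \<Rightarrow> 'n rmat set" where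
  "supp Z = {w \<in> W. (\<lambda>z. z ** w) ` Z = Z}"

lemma faces_E:
  assumes "Z \<in> faces" obtains K y where "K \<subseteq> S" "y \<in> W" "Z = coset K y"
  using assms unfolding faces_def by blast

lemma parabs_E:
  assumes "P \<in> parabs" obtains K y where "K \<subseteq> S" "y \<in> W" "P = par K y"
  using assms unfolding parabs_def by blast

lemma facesI [simp]: "K \<subseteq> S \<Longrightarrow> y \<in> W \<Longrightarrow> coset K y \<in> faces"
  unfolding faces_def by blast

lemma parabsI [simp]: "K \<subseteq> S \<Longrightarrow> y \<in> W \<Longrightarrow> par K y \<in> parabs"
  unfolding parabs_def by blast

section \<open>Cosets as faces and their supports\<close>

lemma coset_sub: "coset K y \<subseteq> W"
  by (auto simp: coset_def)

lemma face_sub: "Z \<in> faces \<Longrightarrow> Z \<subseteq> W"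
  unfolding faces_def using coset_sub by blast

lemma faces_finite: "finite faces"
  using face_sub finite_W by (metis Pow_iff finite_Pow_iff finite_subset subsetI)

lemma parabs_sub: "P \<in> parabs \<Longrightarrow> P \<subseteq> W"
  unfolding parabs_def par_def by blast

lemma parabs_finite: "finite parabs"
  using parabs_sub finite_W by (metis Pow_iff finite_Pow_iff finite_subset subsetI)

lemma coset_self [simp]: "y \<in> W \<Longrightarrow> y \<in> coset K y"
  by (simp add: coset_def)

lemma gen_W: "K \<subseteq> S \<Longrightarrow> u \<in> gen K \<Longrightarrow> u \<in> W"
  using gen_sub by blast

lemma coset_I: "K \<subseteq> S \<Longrightarrow> y \<in> W \<Longrightarrow> u \<in> gen K \<Longrightarrow> u ** y \<in> coset K y"
  by (simp add: coset_def mm gen_W)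

lemma coset_eq:
  assumes K: "K \<subseteq> S" and y: "y \<in> W" and h: "h \<in> coset K y"
  shows "coset K h = coset K y"
proof -
  have hW: "h \<in> W" and u: "h ** matrix_inv y \<in> gen K" using h by (auto simp: coset_def)
  have u': "y ** matrix_inv h \<in> gen K" using gen_inv[OF u K] hW y by simp
  show ?thesis
  proof (intro set_eqI iffI)
    fix z assume "z \<in> coset K h"
    then have z: "z \<in> W" "z ** matrix_inv h \<in> gen K" by (auto simp: coset_def)
    from gen_mult[OF z(2) u] show "z \<in> coset K y" using z hW by (simp add: coset_def mm)
  next
    fix z assume "z \<in> coset K y"
    then have z: "z \<in> W" "z ** matrix_inv y \<in> gen K" by (auto simp: coset_def)
    from gen_mult[OF z(2) u'] show "z \<in> coset K h" using z y by (simp add: coset_def mm)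
  qed
qed

lemma coset_mult:
  assumes "y \<in> W" "w \<in> W"
  shows "(\<lambda>z. z ** w) ` coset K y = coset K (y ** w)"
proof (intro set_eqI iffI)
  fix z assume "z \<in> coset K (y ** w)"
  then have "z ** matrix_inv w \<in> coset K y" "z = (z ** matrix_inv w) ** w"
    using assms by (auto simp: coset_def mm)
  then show "z \<in> (\<lambda>z. z ** w) ` coset K y" by blast
qed (use assms in \<open>auto simp: coset_def mm\<close>)

lemma face_mult: "Z \<in> faces \<Longrightarrow> w \<in> W \<Longrightarrow> (\<lambda>z. z ** w) ` Z \<in> faces"
  by (elim faces_E) (simp add: coset_mult)

lemma supp_coset:
  assumes K: "K \<subseteq> S" and y: "y \<in> W"
  shows "supp (coset K y) = par K y"
proof -
  have "coset K (y ** w) = coset K y \<longleftrightarrow> y ** (w ** matrix_inv y) \<in> gen K" if w: "w \<in> W" for w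
  proof
    assume "coset K (y ** w) = coset K y"
    then have "y ** w \<in> coset K y" using coset_self y w by (metis W_mult)
    then show "y ** (w ** matrix_inv y) \<in> gen K" by (simp add: coset_def mm)
  next
    assume "y ** (w ** matrix_inv y) \<in> gen K"
    then have "y ** w \<in> coset K y" using y w by (simp add: coset_def mm)
    then show "coset K (y ** w) = coset K y" using coset_eq K y by blast
  qed
  then show ?thesis
    unfolding supp_def par_def using y by (intro Collect_cong conj_cong refl) (simp add: coset_mult)
qed

lemma supp_parabs: "Z \<in> faces \<Longrightarrow> supp Z \<in> parabs"
  by (elim faces_E) (simp add: supp_coset)

lemma parabs_supp:
  assumes "P \<in> parabs" obtains Z where "Z \<in> faces" "supp Z = P"
  using assms by (metis facesI parabs_E supp_coset)

lemma par_one: "K \<subseteq> S \<Longrightarrow> par K (mat 1) = gen K"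
  using gen_sub by (auto simp: par_def)

lemma gen_parabs: "K \<subseteq> S \<Longrightarrow> gen K \<in> parabs"
  using par_one parabsI W_one by metis

lemma par_conj:
  assumes "y \<in> W" "w \<in> W"
  shows "(\<lambda>u. conjg u w) ` par K y = par K (y ** w)"
proof (intro set_eqI iffI)
  fix z assume "z \<in> par K (y ** w)"
  then have "conjg z (matrix_inv w) \<in> par K y" "z = conjg (conjg z (matrix_inv w)) w"
    using assms by (auto simp: par_def conjg_def mm)
  then show "z \<in> (\<lambda>u. conjg u w) ` par K y" by blast
qed (use assms in \<open>auto simp: par_def conjg_def mm\<close>)

lemma parabs_conj: "P \<in> parabs \<Longrightarrow> w \<in> W \<Longrightarrow> (\<lambda>u. conjg u w) ` P \<in> parabs"
  by (elim parabs_E) (simp add: par_conj)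

lemma supp_mult: "Z \<in> faces \<Longrightarrow> w \<in> W \<Longrightarrow> supp ((\<lambda>z. z ** w) ` Z) = (\<lambda>u. conjg u w) ` supp Z"
  by (elim faces_E) (simp add: coset_mult supp_coset par_conj)

lemma par_closed:
  assumes "K \<subseteq> S" "y \<in> W"
  shows "mat 1 \<in> par K y" "u \<in> par K y \<Longrightarrow> v \<in> par K y \<Longrightarrow> u ** v \<in> par K y"
proof -
  show "mat 1 \<in> par K y" using assms by (simp add: par_def)
  show "u ** v \<in> par K y" if "u \<in> par K y" "v \<in> par K y"
    using that gen_mult[of "y ** (u ** matrix_inv y)" K "y ** (v ** matrix_inv y)"] assms
    by (simp add: par_def mm)
qed

lemma parabs_one [simp]: "P \<in> parabs \<Longrightarrow> mat 1 \<in> P"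
  and parabs_mult: "P \<in> parabs \<Longrightarrow> u \<in> P \<Longrightarrow> v \<in> P \<Longrightarrow> u ** v \<in> P"
  by (elim parabs_E, simp add: par_closed)+

text \<open>The chambers \<open>h\<close> and \<open>h'\<close> of one face differ by an element of
  W_K, whose inversions lie in W_K; conjugated by \<open>h\<close> they become walls through the
  face.\<close>

lemma face_sep:
  assumes Z: "Z \<in> faces" and h: "h \<in> Z" "h' \<in> Z" and t: "(t \<in> M h) \<noteq> (t \<in> M h')"
  shows "t \<in> supp Z"
proof -
  obtain K y where K: "K \<subseteq> S" "y \<in> W" "Z = coset K y" using Z by (rule faces_E)
  have hW: "h \<in> W" "h' \<in> W" using h face_sub Z by auto
  have Zh: "Z = coset K h" using coset_eq[OF K(1,2)] K(3) h(1) by blast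
  let ?u = "h' ** matrix_inv h"
  have u: "?u \<in> gen K" using h(2) unfolding Zh by (simp add: coset_def)
  have tT: "t \<in> T" using t M_sub by blast
  have "?u ** h = h'" using hW by (simp add: mm)
  then have "conjg t (matrix_inv h) \<in> M ?u"
    using M_mult[of ?u h t] hW tT t by auto
  moreover have "M ?u \<subseteq> gen K" unfolding M_def by (rule N_gen[OF gen_inv[OF u K(1)] K(1)])
  ultimately have "h ** (t ** matrix_inv h) \<in> gen K" using hW by (auto simp: conjg_def mm)
  then show ?thesis unfolding Zh using supp_coset[OF K(1) hW(1)] tT by (simp add: par_def)
qed

section \<open>Projection of chambers onto faces\<close>

lemma Xset_exists:
  assumes K: "K \<subseteq> S" and y: "y \<in> W"
  obtains u where "u \<in> gen K" "u ** y \<in> Xset W S K"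
proof -
  have "y \<in> coset K y" using y by simp
  from ex_has_least_nat[where P = "\<lambda>z. z \<in> coset K y" and m = "len S", OF this]
  obtain x where x: "x \<in> coset K y" "\<And>z. z \<in> coset K y \<Longrightarrow> len S x \<le> len S z"
    by blast
  have xW: "x \<in> W" and u: "x ** matrix_inv y \<in> gen K" using x by (auto simp: coset_def)
  have "t \<notin> N x" if t: "t \<in> gen K" for t
  proof
    assume n: "t \<in> N x"
    then have tT: "t \<in> T" using N_sub by blast
    have "t ** x \<in> coset K y" using gen_mult[OF t u] tT xW by (simp add: coset_def mm)
    then show False using x(2)[of "t ** x"] N_len[of t x] n tT xW by simp
  qed
  then have "x \<in> Xset W S K" using Xset_iff K xW by blast
  then show ?thesis using that[OF u] xW y by (simp add: mm)
qed

text \<open>Conjugation by the inverse of \<open>h\<close> carries the walls through the face to the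
  reflections of W_K, and walls separating \<open>h\<close> from \<open>g\<close> to inversions of
  \<open>h ** matrix_inv g\<close>. This is the link between projections and the sets X_K, hence
  between faces and the elements x_K.\<close>

lemma proj_agree:
  assumes K: "K \<subseteq> S" and h: "h \<in> W" "g \<in> W"
  shows "M h \<inter> par K h = M g \<inter> par K h \<longleftrightarrow> h ** matrix_inv g \<in> Xset W S K"
proof -
  let ?x = "h ** matrix_inv g"
  have "?x ** g = h" using h by (simp add: mm)
  then have 1: "(t \<in> M h \<longleftrightarrow> t \<in> M g) \<longleftrightarrow> conjg t (matrix_inv h) \<notin> N ?x" if t: "t \<in> T" for t
  proof -
    have "conjg (conjg t (matrix_inv h)) ?x = conjg t (matrix_inv g)"
      using h by (simp add: conjg_def mm)
    moreover have "conjg t (matrix_inv h) \<in> T" using T_conjg t h by simp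
    ultimately have "conjg t (matrix_inv g) \<in> M ?x \<longleftrightarrow> conjg t (matrix_inv h) \<in> N ?x"
      using N_inv[of ?x "conjg t (matrix_inv h)"] h by (simp add: M_def)
    then show ?thesis using M_mult[of ?x g t] \<open>?x ** g = h\<close> h t by auto
  qed
  have c: "conjg t (matrix_inv h) \<in> gen K \<longleftrightarrow> t \<in> par K h" if "t \<in> T" for t
    using that h by (simp add: par_def conjg_def mm)
  show ?thesis
  proof
    assume e: "M h \<inter> par K h = M g \<inter> par K h"
    have "t \<notin> N ?x" if t: "t \<in> gen K" for t
    proof
      assume n: "t \<in> N ?x"
      then have tT: "t \<in> T" using N_sub by blast
      have "conjg t h \<in> T" using tT h T_conjg by simp
      moreover have "conjg t h \<in> par K h" using c[OF calculation] t h by simp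
      ultimately show False using 1[of "conjg t h"] e n h by auto
    qed
    then show "?x \<in> Xset W S K" using Xset_iff[OF K, of ?x] h by auto
  next
    assume "?x \<in> Xset W S K"
    then have e: "N ?x \<inter> gen K = {}" using Xset_iff[OF K] by blast
    have "t \<in> M h \<longleftrightarrow> t \<in> M g" if "t \<in> par K h" for t
    proof (cases "t \<in> T")
      case True
      then have "conjg t (matrix_inv h) \<notin> N ?x" using c[OF True] that e by auto
      then show ?thesis using 1[OF True] by simp
    qed (use M_sub in blast)
    then show "M h \<inter> par K h = M g \<inter> par K h" by blast
  qed
qed

text \<open>The Tits projection, characterised by sides of walls instead of by minimal
  distance.\<close>

definition proj :: "'n rmat set \<Rightarrow> 'n rmat \<Rightarrow> 'n rmat" where
  "proj Z g = (THE h. h \<in> Z \<and> M h \<inter> supp Z = M g \<inter> supp Z)"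

lemma proj_ex1:
  assumes Z: "Z \<in> faces" and g: "g \<in> W"
  shows "\<exists>!h. h \<in> Z \<and> M h \<inter> supp Z = M g \<inter> supp Z"
proof -
  obtain K y where K: "K \<subseteq> S" "y \<in> W" "Z = coset K y" using Z by (rule faces_E)
  have yg: "y ** matrix_inv g \<in> W" using K g by simp
  obtain u where u: "u \<in> gen K" "u ** (y ** matrix_inv g) \<in> Xset W S K" by (rule Xset_exists[OF K(1) yg])
  let ?h = "u ** y"
  have hZ: "?h \<in> Z" unfolding K by (rule coset_I[OF K(1,2) u(1)])
  then have hW: "?h \<in> W" using face_sub Z by blast
  have "supp Z = par K ?h"
    using coset_eq[OF K(1,2)] K(3) hZ supp_coset[OF K(1) hW] by metis
  moreover have "M ?h \<inter> par K ?h = M g \<inter> par K ?h"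
    using proj_agree[OF K(1) hW g] u(2) by (simp add: mm)
  ultimately have "M ?h \<inter> supp Z = M g \<inter> supp Z" by simp
  moreover have "h = h'" if "h \<in> Z" "h' \<in> Z" "M h \<inter> supp Z = M h' \<inter> supp Z" for h h'
  proof -
    have "M h = M h'" using face_sep[OF Z that(1,2)] that(3) by blast
    then show ?thesis using M_inj face_sub[OF Z] that by blast
  qed
  ultimately show ?thesis using hZ by metis
qed

lemma proj_in: "Z \<in> faces \<Longrightarrow> g \<in> W \<Longrightarrow> proj Z g \<in> Z"
  and proj_M: "Z \<in> faces \<Longrightarrow> g \<in> W \<Longrightarrow> M (proj Z g) \<inter> supp Z = M g \<inter> supp Z"
  using theI'[OF proj_ex1] unfolding proj_def by blast+

lemma proj_eqI:
  "Z \<in> faces \<Longrightarrow> g \<in> W \<Longrightarrow> h \<in> Z \<Longrightarrow> M h \<inter> supp Z = M g \<inter> supp Z \<Longrightarrow> proj Z g = h"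
  unfolding proj_def by (rule the1_equality[OF proj_ex1]) auto

lemma proj_W: "Z \<in> faces \<Longrightarrow> g \<in> W \<Longrightarrow> proj Z g \<in> W"
  using proj_in face_sub by blast

lemma proj_id: "Z \<in> faces \<Longrightarrow> g \<in> Z \<Longrightarrow> proj Z g = g"
  using face_sub by (intro proj_eqI) auto

lemma proj_iff_Xset:
  assumes K: "K \<subseteq> S" "y \<in> W" and h: "h \<in> coset K y" and g: "g \<in> W"
  shows "proj (coset K y) g = h \<longleftrightarrow> h ** matrix_inv g \<in> Xset W S K"
proof -
  have hW: "h \<in> W" using h coset_sub by blast
  have s: "supp (coset K y) = par K h"
    using coset_eq[OF K h] supp_coset[OF K(1) hW] by simp
  show ?thesis
    using proj_agree[OF K(1) hW g] proj_eqI[of "coset K y" g h] proj_M[of "coset K y" g] K h g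
    unfolding s by auto
qed

text \<open>The sets \<open>M\<close> are measured from the chamber 1 and do not simply translate.
  The quotient \<open>h ** matrix_inv g\<close> is unchanged by a simultaneous right translation, so
  equivariance is read off from the description by X_K.\<close>

lemma proj_mult:
  assumes Z: "Z \<in> faces" and g: "g \<in> W" and w: "w \<in> W"
  shows "proj ((\<lambda>z. z ** w) ` Z) (g ** w) = proj Z g ** w"
proof -
  obtain K y where K: "K \<subseteq> S" "y \<in> W" "Z = coset K y" using Z by (rule faces_E)
  have in': "proj Z g \<in> coset K y" using proj_in Z g K(3) by blast
  have p: "proj Z g ** matrix_inv g \<in> Xset W S K"
    using proj_iff_Xset[OF K(1,2) in' g] K(3) by simp
  have "proj Z g ** w \<in> coset K (y ** w)"
    using in' coset_mult[OF K(2) w] by blast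
  then have "proj (coset K (y ** w)) (g ** w) = proj Z g ** w"
    using proj_iff_Xset[OF K(1), of "y ** w" "proj Z g ** w" "g ** w"] p K(2) g w
    by (simp add: mm)
  then show ?thesis unfolding K(3) coset_mult[OF K(2) w] .
qed

section \<open>Products of faces\<close>

lemma proj_supp_mult:
  assumes "Z \<in> faces" "g \<in> W" "w \<in> supp Z"
  shows "proj Z (g ** w) = proj Z g ** w"
proof -
  have "w \<in> W" "(\<lambda>z. z ** w) ` Z = Z" using assms(3) by (auto simp: supp_def)
  then show ?thesis using proj_mult[OF assms(1,2), of w] by simp
qed

text \<open>The product ZZ' of the face semigroup, given by the chambers that contain it. That this
  set is again a coset is the content of \<open>prodf_coset\<close>.\<close>

definition prodf :: "'n rmat set \<Rightarrow> 'n rmat set \<Rightarrow> 'n rmat set" where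
  "prodf Z Z' = proj Z ` Z'"

text \<open>The walls separating two elements of the product set lie in both supports, so a minimal
  gallery between them stays inside a single coset.\<close>
lemma prodf_coset:
  assumes Z: "Z \<in> faces" and Z': "Z' \<in> faces" and h: "h \<in> prodf Z Z'"
  defines "Q \<equiv> supp Z \<inter> supp Z'"
  defines "L \<equiv> \<lambda>h. {s\<in>S. conjg s h \<in> Q}"
  shows "prodf Z Z' = coset (L h) h" "Q = par (L h) h"
proof -
  let ?B = "prodf Z Z'"
  have BZ: "?B \<subseteq> Z" unfolding prodf_def using proj_in Z face_sub[OF Z'] by blast
  then have BW: "?B \<subseteq> W" using face_sub[OF Z] by blast
  have hW: "h \<in> W" using h BW by blast
  have Qp: "supp Z \<in> parabs" "supp Z' \<in> parabs" using supp_parabs Z Z' by auto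
  have QW: "Q \<subseteq> W" using Qp parabs_sub unfolding Q_def by blast
  have Qmult: "a ** b \<in> Q" if "a \<in> Q" "b \<in> Q" for a b
    using that Qp parabs_mult unfolding Q_def by blast
  have Qone: "mat 1 \<in> Q" using Qp unfolding Q_def by simp
  have a: "b ** q \<in> ?B" if b: "b \<in> ?B" and q: "q \<in> Q" for b q
  proof -
    obtain z where z: "z \<in> Z'" "b = proj Z z" using b unfolding prodf_def by blast
    have "z ** q \<in> Z'" using q z unfolding Q_def supp_def by blast
    moreover have "proj Z (z ** q) = b ** q"
      using proj_supp_mult[OF Z, of z q] z face_sub[OF Z'] q unfolding Q_def by blast
    ultimately show ?thesis unfolding prodf_def by force
  qed
  \<comment> \<open>Both chambers lie in Z, so \<open>t\<close> lies in the support of Z. Projection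
    onto Z does not change sides of such a wall, so \<open>t\<close> also separates the two
    preimages in Z' and lies in the support of Z' as well.\<close>
  have sep: "t \<in> Q" if b: "b \<in> ?B" "b' \<in> ?B" and t: "(t \<in> M b) \<noteq> (t \<in> M b')" for b b' t
  proof -
    obtain z z' where z: "z \<in> Z'" "b = proj Z z" "z' \<in> Z'" "b' = proj Z z'"
      using b unfolding prodf_def by blast
    have 1: "t \<in> supp Z" using face_sep[OF Z _ _ t] b BZ by blast
    have "M b \<inter> supp Z = M z \<inter> supp Z" "M b' \<inter> supp Z = M z' \<inter> supp Z"
      using proj_M[OF Z] z face_sub[OF Z'] by blast+
    then have "(t \<in> M z) \<noteq> (t \<in> M z')" using t 1 by blast
    then have "t \<in> supp Z'" using face_sep[OF Z'] z by blast
    with 1 show ?thesis unfolding Q_def by blast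
  qed
  have LS: "L b \<subseteq> S" for b unfolding L_def by blast
  have reach: "b' \<in> coset (L b) b" if "b \<in> ?B" "b' \<in> ?B" for b b'
    using that
  proof (induction "len S (b' ** matrix_inv b)" arbitrary: b rule: less_induct)
    case less
    let ?u = "b' ** matrix_inv b"
    have bW: "b \<in> W" "b' \<in> W" using less.prems BW by auto
    have ub: "?u ** b = b'" using bW by (simp add: mm)
    show ?case
    proof (cases "?u = mat 1")
      case True
      then have "b' = b" using ub by simp
      then show ?thesis using bW by simp
    next
      case False
      have iu: "matrix_inv ?u \<in> gen S" using bW unfolding W_gen[symmetric] by simp
      have "matrix_inv ?u \<noteq> mat 1"
      proof
        assume "matrix_inv ?u = mat 1"
        then have "matrix_inv (matrix_inv ?u) = mat 1" by simp
        then show False using False W_cancel(5)[of ?u] bW by simp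
      qed
      then obtain s where s: "s \<in> S" "s \<in> N (matrix_inv ?u)" using gen_descent[OF iu] by blast
      \<comment> \<open>The first wall on a shortest gallery from \<open>b\<close> to
        \<open>b'\<close>. It belongs to \<open>Q\<close>, so the neighbouring chamber
        \<open>s ** b\<close>, which equals \<open>b ** ?t\<close>, is again in the product set and
        closer to \<open>b'\<close>.\<close>
      let ?t = "conjg s b"
      have tT: "?t \<in> T" using s bW T_I by simp
      have "(?t \<in> M b) \<noteq> (?t \<in> M b')"
        using M_mult[of ?u b ?t] s bW tT unfolding ub by (simp add: M_def)
      then have tQ: "?t \<in> Q" using sep less.prems by blast
      have sb: "s ** b = b ** ?t" using s bW by (simp add: conjg_def mm)
      have b1: "s ** b \<in> ?B" unfolding sb using a[OF less.prems(1) tQ] .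
      have "len S (s ** matrix_inv ?u) < len S (matrix_inv ?u)" using N_S_iff s bW by auto
      moreover have "matrix_inv (b' ** matrix_inv (s ** b)) = s ** matrix_inv ?u"
        using s bW by (simp add: mm S_inv)
      ultimately have "len S (b' ** matrix_inv (s ** b)) < len S ?u"
        using len_inv[of "b' ** matrix_inv (s ** b)"] len_inv[of ?u] s bW by simp
      from less.hyps[OF this b1 less.prems(2)] have IH: "b' \<in> coset (L (s ** b)) (s ** b)" .
      have "conjg r (s ** b) = ?t ** (conjg r b ** ?t)" if "r \<in> S" for r
        using that s bW by (simp add: conjg_def mm S_inv)
      moreover have "?t ** (conjg r b ** ?t) \<in> Q \<longleftrightarrow> conjg r b \<in> Q" if "r \<in> S" for r
      proof
        assume "?t ** (conjg r b ** ?t) \<in> Q"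
        then have "?t ** ((?t ** (conjg r b ** ?t)) ** ?t) \<in> Q" using Qmult tQ by blast
        then show "conjg r b \<in> Q" by (simp add: mm T_sq[OF tT] T_cancel[OF tT])
      qed (use Qmult tQ in blast)
      \<comment> \<open>The set of simple directions does not change along the gallery, since
        \<open>?t\<close> is in the group \<open>Q\<close>; therefore all steps stay in one and the
        same coset.\<close>
      ultimately have Leq: "L (s ** b) = L b" unfolding L_def by auto
      have "s \<in> L b" unfolding L_def using s tQ by blast
      then have "s ** b \<in> coset (L b) b" by (intro coset_I LS bW gen_base)
      then have "coset (L b) (s ** b) = coset (L b) b" by (intro coset_eq LS bW)
      then show ?thesis using IH Leq by simp
    qed
  qed
  have conjQ: "conjg u h \<in> Q" if "u \<in> gen (L h)" for u
    using that
  proof (induction rule: gen_induct)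
    case (step s g)
    have "conjg s h \<in> Q" using step(1) unfolding L_def by blast
    then show ?case using Qmult step conjg_hom[OF hW] by metis
  qed (use Qone hW in \<open>simp add: conjg_def\<close>)
  have conj': "h ** conjg u h = u ** h" for u using hW by (simp add: conjg_def mm)
  show B: "?B = coset (L h) h"
  proof
    show "?B \<subseteq> coset (L h) h" using reach h by blast
    show "coset (L h) h \<subseteq> ?B"
    proof
      fix z assume "z \<in> coset (L h) h"
      then have z: "z \<in> W" "z ** matrix_inv h \<in> gen (L h)" by (auto simp: coset_def)
      have "h ** conjg (z ** matrix_inv h) h \<in> ?B" using a[OF h] conjQ z by blast
      then show "z \<in> ?B" unfolding conj' using z hW by (simp add: mm)
    qed
  qed
  show "Q = par (L h) h"
  proof (intro set_eqI iffI)
    fix w assume w: "w \<in> Q"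
    then have "h ** w \<in> coset (L h) h" using a[OF h] B by blast
    then show "w \<in> par (L h) h" using w QW by (auto simp: coset_def par_def mm)
  next
    fix w assume w: "w \<in> par (L h) h"
    then have "conjg (h ** (w ** matrix_inv h)) h \<in> Q" using conjQ by (simp add: par_def)
    then show "w \<in> Q" using w hW by (simp add: conjg_def mm par_def)
  qed
qed

lemma face_nonempty: "Z \<in> faces \<Longrightarrow> Z \<noteq> {}"
  using coset_self by (metis empty_iff faces_E)

lemma prodf_sub: "Z \<in> faces \<Longrightarrow> Z' \<in> faces \<Longrightarrow> prodf Z Z' \<subseteq> Z"
  unfolding prodf_def using proj_in face_sub by blast

lemma prodf_face:
  assumes Z: "Z \<in> faces" and Z': "Z' \<in> faces"
  shows "prodf Z Z' \<in> faces" "supp (prodf Z Z') = supp Z \<inter> supp Z'"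
proof -
  obtain h where h: "h \<in> prodf Z Z'" using face_nonempty[OF Z'] unfolding prodf_def by blast
  then have hW: "h \<in> W" using prodf_sub[OF Z Z'] face_sub[OF Z] by blast
  let ?L = "{s \<in> S. conjg s h \<in> supp Z \<inter> supp Z'}"
  have L: "?L \<subseteq> S" by blast
  show "prodf Z Z' \<in> faces"
    unfolding prodf_coset(1)[OF Z Z' h] by (rule facesI[OF L hW])
  show "supp (prodf Z Z') = supp Z \<inter> supp Z'"
    unfolding prodf_coset(1)[OF Z Z' h] supp_coset[OF L hW] prodf_coset(2)[OF Z Z' h, symmetric] ..
qed

lemma proj_prodf:
  assumes Z: "Z \<in> faces" and Z': "Z' \<in> faces" and g: "g \<in> W"
  shows "proj (prodf Z Z') g = proj Z (proj Z' g)"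
proof (rule proj_eqI)
  show "prodf Z Z' \<in> faces" using prodf_face Z Z' by blast
  show "proj Z (proj Z' g) \<in> prodf Z Z'" unfolding prodf_def using proj_in Z' g by blast
  show "M (proj Z (proj Z' g)) \<inter> supp (prodf Z Z') = M g \<inter> supp (prodf Z Z')"
    unfolding prodf_face(2)[OF Z Z']
    using proj_M[OF Z proj_W[OF Z' g]] proj_M[OF Z' g] by blast
qed (use g in simp)

text \<open>The product of two faces has the intersection of their supports as its support, so this
  closure property is available before any fixed space is considered.\<close>

lemma parabs_Int: "P \<in> parabs \<Longrightarrow> Q \<in> parabs \<Longrightarrow> P \<inter> Q \<in> parabs"
  using prodf_face supp_parabs parabs_supp by metis

lemma gen_conj:
  assumes "x \<in> W" "K \<subseteq> S"
  shows "gen ((\<lambda>s. conjg s x) ` K) = (\<lambda>u. conjg u x) ` gen K"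
proof
  have "\<exists>u\<in>gen K. g = conjg u x" if "g \<in> gen ((\<lambda>s. conjg s x) ` K)" for g
    using that
  proof (induction rule: gen_induct)
    case one
    then show ?case using assms by (intro bexI[of _ "mat 1"]) (simp_all add: conjg_def)
  next
    case (step s g)
    then obtain r u where "r \<in> K" "s = conjg r x" "u \<in> gen K" "g = conjg u x" by blast
    then show ?case using conjg_hom[OF assms(1)] gen_mult gen_base by metis
  qed
  then show "gen ((\<lambda>s. conjg s x) ` K) \<subseteq> (\<lambda>u. conjg u x) ` gen K" by blast
  have "conjg u x \<in> gen ((\<lambda>s. conjg s x) ` K)" if "u \<in> gen K" for u
    using that
  proof (induction rule: gen_induct)
    case (step s g)
    have "conjg s x \<in> gen ((\<lambda>s. conjg s x) ` K)" using step by (intro gen_base) blast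
    then show ?case using step conjg_hom[OF assms(1)] gen_mult by metis
  qed (use assms in \<open>simp add: conjg_def\<close>)
  then show "(\<lambda>u. conjg u x) ` gen K \<subseteq> gen ((\<lambda>s. conjg s x) ` K)" by blast
qed

text \<open>Walking from a face to its opposite inside the flat of the parabolic, one has to cross
  the wall of \<open>t\<close> at a face of codimension one.\<close>
lemma parab_extend:
  assumes P: "P \<in> parabs" and t: "t \<in> T" "t \<notin> P"
  obtains K s h where "K \<subseteq> S" "s \<in> S" "h \<in> W" "P = par K h" "t \<in> par (insert s K) h"
proof -
  define faces_of where "faces_of = {Z\<in>faces. supp Z = P}"
  define sg where "sg Z r \<longleftrightarrow> (\<exists>h\<in>Z. r \<in> M h)" for Z r
  \<comment> \<open>The walls separating two faces with support P. Outside P the side of a wall does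
    not depend on the chamber chosen in a face, by \<open>face_sep\<close>.\<close>
  define D where "D X = {r\<in>T - P. sg (fst X) r \<noteq> sg (snd X) r}" for X
  have sg: "sg Z r \<longleftrightarrow> r \<in> M h" if "Z \<in> faces_of" "h \<in> Z" "r \<notin> P" for Z r h
    unfolding sg_def using face_sep that unfolding faces_of_def by blast
  have finD: "finite (D X)" for X
    unfolding D_def using finite_W by (rule finite_subset[rotated]) (auto intro: T_W)
  have ex: "\<exists>X. X \<in> faces_of \<times> faces_of \<and> t \<in> D X"
  proof -
    obtain w0 where w0: "w0 \<in> W" "N w0 = T" "N (matrix_inv w0) = T" "\<And>s. s \<in> S \<Longrightarrow> conjg s (matrix_inv w0) \<in> S"
      using longest by blast
    obtain K h where K: "K \<subseteq> S" "h \<in> W" "P = par K h" using P by (rule parabs_E)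
    \<comment> \<open>The type of the opposite face. The chamber \<open>w0 ** h\<close> is opposite
      to \<open>h\<close>, and moving \<open>K\<close> by the longest element keeps the support
      equal to P.\<close>
    let ?K = "(\<lambda>s. conjg s (matrix_inv w0)) ` K"
    have K': "?K \<subseteq> S" using w0 K by blast
    have "par ?K (w0 ** h) = par K h"
    proof -
      have "(w0 ** (h ** (w ** (matrix_inv h ** matrix_inv w0)))) \<in> gen ?K \<longleftrightarrow> h ** (w ** matrix_inv h) \<in> gen K"
        if w: "w \<in> W" for w
      proof -
        have "w0 ** (h ** (w ** (matrix_inv h ** matrix_inv w0))) = conjg (h ** (w ** matrix_inv h)) (matrix_inv w0)"
          using w0(1) by (simp add: conjg_def mm)
        moreover have "conjg a (matrix_inv w0) \<in> (\<lambda>u. conjg u (matrix_inv w0)) ` gen K \<longleftrightarrow> a \<in> gen K" for a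
          using w0(1) by (simp add: image_iff conjg_inj)
        ultimately show ?thesis using gen_conj[of "matrix_inv w0" K] w0(1) K(1) by simp
      qed
      then show ?thesis using K(2) w0(1) by (auto simp: par_def mm)
    qed
    then have F: "coset K h \<in> faces_of" "coset ?K (w0 ** h) \<in> faces_of"
      unfolding faces_of_def using K K' w0(1) by (simp_all add: supp_coset)
    have "t \<in> M (w0 ** h) \<longleftrightarrow> t \<notin> M h"
      using M_mult[of w0 h t] w0(1,3) K t T_conjg by (simp add: M_def)
    moreover have "h \<in> coset K h" "w0 ** h \<in> coset ?K (w0 ** h)" using w0(1) K by simp_all
    ultimately have "sg (coset K h) t \<noteq> sg (coset ?K (w0 ** h)) t" using sg F t by blast
    then show ?thesis using F t unfolding D_def by (intro exI[of _ "(coset K h, coset ?K (w0 ** h))"]) simp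
  qed
  then obtain X0 where "X0 \<in> faces_of \<times> faces_of \<and> t \<in> D X0" by blast
  \<comment> \<open>A pair of faces separated by \<open>t\<close> with as few separating walls as
    possible. For such a pair the first wall crossed must lead to a face contained in the wall of
    \<open>t\<close>.\<close>
  from ex_has_least_nat[where P = "\<lambda>X. X \<in> faces_of \<times> faces_of \<and> t \<in> D X" and m = "\<lambda>X. card (D X)", OF this]
  obtain Z1 Z2 where Zs: "Z1 \<in> faces_of" "Z2 \<in> faces_of" "t \<in> D (Z1, Z2)"
    and min: "\<And>X. X \<in> faces_of \<times> faces_of \<Longrightarrow> t \<in> D X \<Longrightarrow> card (D (Z1, Z2)) \<le> card (D X)"
    by auto
  have f: "Z1 \<in> faces" "Z2 \<in> faces" "supp Z1 = P" "supp Z2 = P" using Zs unfolding faces_of_def by auto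
  obtain K y where K: "K \<subseteq> S" "y \<in> W" "Z1 = coset K y" using f(1) by (rule faces_E)
  define h1 where "h1 = y"
  \<comment> \<open>Since \<open>h2\<close> agrees with \<open>h1\<close> on P, every wall
    separating the two chambers lies outside P. In particular the first wall \<open>r\<close> of a
    shortest gallery really separates the faces.\<close>
  define h2 where "h2 = proj Z2 h1"
  have h1: "h1 \<in> W" "h1 \<in> Z1" "Z1 = coset K h1" using K unfolding h1_def by simp_all
  have h2: "h2 \<in> Z2" "h2 \<in> W" unfolding h2_def using proj_in proj_W f h1 by auto
  let ?u = "h2 ** matrix_inv h1"
  have uh: "?u ** h1 = h2" using h1 h2 by (simp add: mm)
  have "h1 \<noteq> h2" using Zs(3) sg[OF Zs(1) h1(2) t(2)] sg[OF Zs(2) h2(1) t(2)] unfolding D_def by auto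
  then have "?u \<noteq> mat 1" using uh by auto
  then have "matrix_inv ?u \<noteq> mat 1" using W_cancel(5)[of ?u] h1 h2 by (metis W_inv W_mult matrix_inv_one)
  moreover have "matrix_inv ?u \<in> gen S" unfolding W_gen[symmetric] using h1 h2 by simp
  ultimately obtain s where s: "s \<in> S" "s \<in> N (matrix_inv ?u)" using gen_descent by blast
  define r where "r = conjg s h1"
  have rT: "r \<in> T" using s h1 T_I r_def by simp
  have rsep: "(r \<in> M h1) \<noteq> (r \<in> M h2)"
    using M_mult[of ?u h1 r] s h1 h2 rT unfolding uh by (simp add: M_def r_def)
  have rP: "r \<notin> P" using proj_M[OF f(2) h1(1)] rsep unfolding h2_def f by blast
  define Y where "Y = coset (insert s K) h1"
  have sK: "insert s K \<subseteq> S" using s K by blast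
  have Y: "Y \<in> faces" "supp Y = par (insert s K) h1" "h1 \<in> Y"
    unfolding Y_def using sK h1 by (simp_all add: supp_coset)
  have PK: "P = par K h1" using f(3) h1(3) supp_coset[OF K(1) h1(1)] by simp
  have PY: "P \<subseteq> supp Y" unfolding Y PK par_def using gen_mono[of K "insert s K"] by blast
  have rY: "r \<in> supp Y" unfolding Y par_def r_def using h1(1) s gen_base[of s "insert s K"]
    by (simp add: conjg_def mm)
  \<comment> \<open>The face reached from Z1 by crossing at Y: it is on the side of Z2 for walls
    through Y, and on the side of Z1 for all others. If \<open>t\<close> does not contain Y, the
    pair (Z3, Z2) is still separated by \<open>t\<close> but no longer by \<open>r\<close>, against
    minimality.\<close>
  define Z3 where "Z3 = prodf Y Z2"
  have Z3: "Z3 \<in> faces_of" unfolding faces_of_def Z3_def using prodf_face[OF Y(1) f(2)] PY f by auto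
  obtain h3 where h3: "h3 \<in> Z3" using Z3 face_nonempty unfolding faces_of_def by blast
  have sg1: "sg Z3 q \<longleftrightarrow> sg Z2 q" if "q \<in> supp Y" "q \<notin> P" for q
  proof -
    obtain z where z: "z \<in> Z2" "h3 = proj Y z" using h3 unfolding Z3_def prodf_def by blast
    have "M h3 \<inter> supp Y = M z \<inter> supp Y" using z proj_M[OF Y(1)] face_sub[OF f(2)] by blast
    then show ?thesis using sg[OF Z3 h3 that(2)] sg[OF Zs(2) z(1) that(2)] that(1) by blast
  qed
  have sg2: "sg Z3 q \<longleftrightarrow> sg Z1 q" if "q \<notin> supp Y" "q \<notin> P" for q
  proof -
    have "h3 \<in> Y" using h3 prodf_sub[OF Y(1) f(2)] unfolding Z3_def by blast
    then have "q \<in> M h3 \<longleftrightarrow> q \<in> M h1" using face_sep[OF Y(1)] Y(3) that(1) by blast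
    then show ?thesis using sg[OF Z3 h3 that(2)] sg[OF Zs(1) h1(2) that(2)] by blast
  qed
  have "t \<in> supp Y"
  proof (rule ccontr)
    assume n: "t \<notin> supp Y"
    have sub: "D (Z3, Z2) \<subseteq> D (Z1, Z2)" unfolding D_def using sg1 sg2 by auto
    have "r \<in> D (Z1, Z2)"
      unfolding D_def using rT rP rsep sg[OF Zs(1) h1(2) rP] sg[OF Zs(2) h2(1) rP] by auto
    moreover have "r \<notin> D (Z3, Z2)" unfolding D_def using sg1[OF rY rP] by auto
    ultimately have "D (Z3, Z2) \<subset> D (Z1, Z2)" using sub by blast
    then have "card (D (Z3, Z2)) < card (D (Z1, Z2))" using finD psubset_card_mono by blast
    moreover have "t \<in> D (Z3, Z2)" using Zs(3) sg2[OF n t(2)] unfolding D_def by auto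
    ultimately show False using min[of "(Z3, Z2)"] Z3 Zs(2) by auto
  qed
  then show ?thesis using that[OF K(1) s(1) h1(1) PK] Y(2) by blast
qed

end


section \<open>Fixed spaces of parabolic subgroups\<close>

lemma neg_vmult: "(- v) v* A = - (v v* (A :: real^'n^'m))"
  using scaleR_vector_matrix_assoc[of "-1" v A] by simp

lemma vmult_faithful:
  fixes A B :: "('n::finite) rmat"
  assumes "\<And>v :: real^'n. v v* A = v v* B" shows "A = B"
proof -
  have "transpose A *v v = transpose B *v v" for v using assms by simp
  then have "transpose A = transpose B" by (simp add: matrix_eq)
  then show ?thesis by (metis transpose_transpose)
qed

lemma orth_vmult_move:
  fixes g :: "('n::finite) rmat"
  assumes "orthogonal_matrix g"
  shows "(u v* matrix_inv g) \<bullet> v = u \<bullet> (v v* g)"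
  using orth_inner[OF assms, of "u v* matrix_inv g" v] assms
  by (simp add: vector_matrix_mul_assoc orth_cancel)

lemma dim_less_subspace:
  fixes U V :: "'a::euclidean_space set"
  assumes "subspace U" "subspace V" "U \<subset> V" shows "dim U < dim V"
  using assms by (intro dim_psubset) (simp add: span_eq_iff[THEN iffD2])

lemma orthogonal_decomp:
  fixes A :: "'a::euclidean_space set"
  shows "\<exists>y z. y \<in> span A \<and> (\<forall>x\<in>span A. orthogonal z x) \<and> a = y + z"
  by (rule orthogonal_subspace_decomp_exists[of A a]) blast

lemma dim_le_card: "dim (U :: (real^('n::finite)) set) \<le> CARD('n)"
  using dim_subset_UNIV[of U] by simp

lemma dim_Int_hyperplane:
  fixes U :: "(real^('n::finite)) set"
  assumes "subspace U"
  shows "dim U \<le> dim (U \<inter> {v. v \<bullet> a = 0}) + 1"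
proof (cases "a = 0")
  case False
  have h: "dim {v. v \<bullet> a = 0} = CARD('n) - 1"
    using dim_hyperplane[OF False] by (simp add: inner_commute)
  have s: "subspace {v. v \<bullet> a = 0}"
    using subspace_hyperplane[of a] by (simp add: inner_commute)
  have "dim {x + y | x y. x \<in> U \<and> y \<in> {v. v \<bullet> a = 0}} + dim (U \<inter> {v. v \<bullet> a = 0})
      = dim U + (CARD('n) - 1)"
    using dim_sums_Int[OF assms s] h by simp
  moreover have "dim {x + y | x y. x \<in> U \<and> y \<in> {v. v \<bullet> a = 0}} \<le> CARD('n)"
    by (rule dim_le_card)
  moreover have "CARD('n) \<ge> 1" by (simp add: Suc_leI)
  ultimately show ?thesis by linarith
qed simp

context coxeter_group
begin

section \<open>Roots and generic vectors\<close>

lemma T_root_ex: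
  assumes "t \<in> T"
  shows "\<exists>a. norm a = 1 \<and> (\<forall>v. v v* t = v - (2 * (v \<bullet> a)) *\<^sub>R a)"
proof -
  obtain s x where s: "s \<in> S" "x \<in> W" "t = conjg s x" using assms by (rule T_E)
  obtain a where a: "norm a = 1" "\<And>v. v v* s = v - (2 * (v \<bullet> a)) *\<^sub>R a"
    using is_reflection_root[OF S_refl[OF s(1)]] by metis
  have o: "orthogonal_matrix x" using s W_orth by simp
  have "norm (a v* x) = 1" using a orth_inner[OF o, of a a] by (simp add: norm_eq_1)
  moreover have "v v* t = v - (2 * (v \<bullet> (a v* x))) *\<^sub>R (a v* x)" for v
  proof -
    have "v v* t = ((v v* matrix_inv x) v* s) v* x"
      unfolding s(3) conjg_def by (simp add: vector_matrix_mul_assoc)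
    also have "\<dots> = v - (2 * ((v v* matrix_inv x) \<bullet> a)) *\<^sub>R (a v* x)"
      unfolding a(2) using s(2)
      by (simp add: vector_matrix_mult_diff_distrib scaleR_vector_matrix_assoc vector_matrix_mul_assoc)
    finally show ?thesis unfolding orth_vmult_move[OF o] .
  qed
  ultimately show ?thesis by blast
qed

definition root :: "'n rmat \<Rightarrow> real^'n" where
  "root t = (SOME a. norm a = 1 \<and> (\<forall>v. v v* t = v - (2 * (v \<bullet> a)) *\<^sub>R a))"

lemma root_norm: "t \<in> T \<Longrightarrow> norm (root t) = 1"
  and root_refl: "t \<in> T \<Longrightarrow> v v* t = v - (2 * (v \<bullet> root t)) *\<^sub>R root t"
  using someI_ex[OF T_root_ex] unfolding root_def by blast+

lemma root_neq0: "t \<in> T \<Longrightarrow> root t \<noteq> 0"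
  using root_norm by fastforce

lemma root_self: "t \<in> T \<Longrightarrow> root t \<bullet> root t = 1"
  using root_norm by (simp add: norm_eq_1)

lemma Fix_refl: "t \<in> T \<Longrightarrow> Fix t = {v. v \<bullet> root t = 0}"
  using root_neq0 by (auto simp: Fix_def root_refl)

lemma root_determines:
  assumes "t \<in> T" "r \<in> T" "root r = a \<or> root r = - a" "root t = a \<or> root t = - a"
  shows "r = t"
  by (rule vmult_faithful) (use assms in \<open>auto simp: root_refl\<close>)

lemma root_conj:
  assumes t: "t \<in> T" and w: "w \<in> W"
  shows "root t v* w = root (conjg t w) \<or> root t v* w = - root (conjg t w)"
proof -
  let ?r = "conjg t w" let ?a = "root t v* w"
  have o: "orthogonal_matrix w" using w W_orth by simp
  have r: "?r \<in> T" using T_conjg t w by simp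
  have f: "v v* ?r = v - (2 * (v \<bullet> ?a)) *\<^sub>R ?a" for v
  proof -
    have "v v* ?r = ((v v* matrix_inv w) v* t) v* w"
      unfolding conjg_def by (simp add: vector_matrix_mul_assoc)
    also have "\<dots> = v - (2 * ((v v* matrix_inv w) \<bullet> root t)) *\<^sub>R ?a"
      unfolding root_refl[OF t] using w
      by (simp add: vector_matrix_mult_diff_distrib scaleR_vector_matrix_assoc vector_matrix_mul_assoc)
    finally show ?thesis unfolding orth_vmult_move[OF o] .
  qed
  define c where "c = root ?r \<bullet> ?a"
  have aa: "?a \<bullet> ?a = 1" using orth_inner[OF o] root_self[OF t] by simp
  have "- root ?r = root ?r v* ?r" using root_refl[OF r] root_self[OF r] by (simp add: scaleR_2)
  also have "\<dots> = root ?r - (2 * c) *\<^sub>R ?a" unfolding f c_def ..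
  finally have "2 *\<^sub>R root ?r = 2 *\<^sub>R (c *\<^sub>R ?a)" by (simp add: algebra_simps scaleR_2)
  then have e: "root ?r = c *\<^sub>R ?a" by (metis real_vector.scale_cancel_left zero_neq_numeral)
  have "c * c = 1" using root_self[OF r] aa unfolding e by simp
  then have "c = 1 \<or> c = -1" by (simp add: square_eq_1_iff)
  then show ?thesis using e by auto
qed

text \<open>A vector of U on as few hyperplanes as possible works: if one of its hyperplanes did not
  contain U, a small move inside U would leave that hyperplane without entering a new one.\<close>

lemma generic_vector:
  assumes U: "subspace U"
  obtains v where "v \<in> U" "\<And>t. t \<in> T \<Longrightarrow> v \<in> Fix t \<Longrightarrow> U \<subseteq> Fix t"
proof -
  have finT: "finite T" by (rule finite_T)
  let ?n = "\<lambda>v. card {t\<in>T. v \<in> Fix t}"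
  have "0 \<in> U" using U subspace_0 by blast
  from ex_has_least_nat[where P = "\<lambda>v. v \<in> U" and m = ?n, OF this]
  obtain v where v: "v \<in> U" "\<And>u. u \<in> U \<Longrightarrow> ?n v \<le> ?n u" by blast
  have "U \<subseteq> Fix t" if t: "t \<in> T" "v \<in> Fix t" for t
  proof (rule ccontr)
    assume "\<not> U \<subseteq> Fix t"
    then obtain u where u: "u \<in> U" "u \<notin> Fix t" by blast
    \<comment> \<open>The parameters for which \<open>v + e *\<^sub>R u\<close> may fall into a
      hyperplane that does not contain \<open>u\<close>. When \<open>u\<close> is orthogonal to the
      root, the quotient takes the value 0, which is excluded anyway to leave the hyperplane of
      \<open>v\<close>.\<close>
    let ?E = "(\<lambda>r. - (v \<bullet> root r) / (u \<bullet> root r)) ` T \<union> {0}"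
    have "finite ?E" using finT by simp
    then obtain e where e: "e \<notin> ?E" using ex_new_if_finite infinite_UNIV_char_0 by blast
    let ?x = "v + e *\<^sub>R u"
    have xU: "?x \<in> U" using U v u by (simp add: subspace_add subspace_scale)
    have sub: "r \<in> T \<and> v \<in> Fix r" if r: "r \<in> T" "?x \<in> Fix r" for r
    proof (rule conjI[OF r(1)])
      have z: "v \<bullet> root r + e * (u \<bullet> root r) = 0"
        using r by (simp add: Fix_refl inner_add_left)
      have "u \<bullet> root r = 0"
      proof (rule ccontr)
        assume n: "u \<bullet> root r \<noteq> 0"
        then have "e = - (v \<bullet> root r) / (u \<bullet> root r)" using z by (simp add: field_simps)
        then show False using e r(1) by blast
      qed
      then show "v \<in> Fix r" using z r(1) by (simp add: Fix_refl)
    qed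
    have "?x \<notin> Fix t" using t u e by (simp add: Fix_refl inner_add_left)
    then have "{r\<in>T. ?x \<in> Fix r} \<subset> {r\<in>T. v \<in> Fix r}" using sub t by blast
    then have "?n ?x < ?n v" using finT by (intro psubset_card_mono) auto
    then show False using v(2)[OF xU] by simp
  qed
  then show ?thesis using that v(1) by blast
qed

text \<open>Chamber geometry of the arrangement itself: the reflections in the walls of the chamber of \<open>p\<close>
  (those negating no positive root but their own) generate \<open>W\<close>, and the deletion argument applies to them.
  They need not be conjugate to \<open>S\<close> as a set, since \<open>S\<close> may be realised with non-adjacent walls.\<close>
lemma regular_fixed:
  assumes p: "\<And>t. t \<in> T \<Longrightarrow> p \<notin> Fix t" and w: "w \<in> W" "p v* w = p"
  shows "w = mat 1"
proof (rule ccontr)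
  assume w1: "w \<noteq> mat 1"
  define ar where "ar t = (if root t \<bullet> p > 0 then root t else - root t)" for t
  have finT: "finite T" by (rule finite_T)
  have pos: "ar t \<bullet> p > 0" if "t \<in> T" for t
    using p[OF that] Fix_refl[OF that] by (auto simp: ar_def inner_commute)
  have self: "ar t \<bullet> ar t = 1" if "t \<in> T" for t
    using root_self[OF that] by (simp add: ar_def)
  have refl: "v v* t = v - (2 * (v \<bullet> ar t)) *\<^sub>R ar t" if "t \<in> T" for t v
    using root_refl[OF that] by (simp add: ar_def)
  have conj: "ar t v* x = ar (conjg t x) \<or> ar t v* x = - ar (conjg t x)" if "t \<in> T" "x \<in> W" for t x
    using root_conj[OF that] by (auto simp: ar_def neg_vmult)
  have conj_pos: "ar t v* x = ar (conjg t x)" if "t \<in> T" "x \<in> W" "(ar t v* x) \<bullet> p \<ge> 0" for t x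
    using conj[OF that(1,2)] pos[of "conjg t x"] T_conjg that by fastforce
  have conj_neg: "ar t v* x = - ar (conjg t x)" if "t \<in> T" "x \<in> W" "(ar t v* x) \<bullet> p \<le> 0" for t x
    using conj[OF that(1,2)] pos[of "conjg t x"] T_conjg that by fastforce
  define S' where "S' = {t\<in>T. \<forall>r\<in>T. r \<noteq> t \<longrightarrow> (ar r v* t) \<bullet> p > 0}"
  have T_gen: "t \<in> gen S'" if "t \<in> T" for t
    using that
  \<comment> \<open>The induction is on the height of the root, its inner product with
    \<open>p\<close>, measured by the number of lower roots.\<close>
  proof (induction "card {r\<in>T. ar r \<bullet> p < ar t \<bullet> p}" arbitrary: t rule: less_induct)
    case less
    have IH: "q \<in> gen S'" if q: "q \<in> T" "ar q \<bullet> p < ar t \<bullet> p" for q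
    proof (rule less.hyps[OF _ q(1)])
      have "{r\<in>T. ar r \<bullet> p < ar q \<bullet> p} \<subset> {r\<in>T. ar r \<bullet> p < ar t \<bullet> p}" using q by force
      then show "card {r\<in>T. ar r \<bullet> p < ar q \<bullet> p} < card {r\<in>T. ar r \<bullet> p < ar t \<bullet> p}"
        using finT by (intro psubset_card_mono) auto
    qed
    show ?case
    proof (cases "t \<in> S'")
      case False
      then obtain r where r: "r \<in> T" "r \<noteq> t" "(ar r v* t) \<bullet> p \<le> 0"
        unfolding S'_def using less.prems by force
      let ?r = "conjg r t"
      have tW: "t \<in> W" using less.prems T_W by blast
      have r': "?r \<in> T" using r tW T_conjg by simp
      \<comment> \<open>The root of \<open>conjg r t\<close> is
        \<open>(2 * c) *\<^sub>R ar t - ar r\<close>, so the heights of these two roots add up to 2c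
        times the height of \<open>t\<close>. Positivity gives c > 0, and c < 1 because the unit
        roots are distinct; hence one of the two is lower than \<open>t\<close>.\<close>
      define c where "c = ar r \<bullet> ar t"
      have neg: "ar ?r = (2 * c) *\<^sub>R ar t - ar r"
        using conj_neg[OF r(1) tW r(3)] refl[OF less.prems, of "ar r"] unfolding c_def by (simp add: algebra_simps)
      have sum: "ar r \<bullet> p + ar ?r \<bullet> p = 2 * (c * (ar t \<bullet> p))"
        unfolding neg by (simp add: inner_diff_left)
      have c': "ar ?r \<bullet> ar t = c" unfolding neg using self[OF less.prems] by (simp add: inner_diff_left c_def)
      have pt: "ar t \<bullet> p > 0" "ar r \<bullet> p > 0" "ar ?r \<bullet> p > 0" using pos less.prems r r' by auto
      have c0: "c > 0"
      proof (rule ccontr)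
        assume "\<not> c > 0"
        then have "c * (ar t \<bullet> p) \<le> 0" using pt by (simp add: mult_nonpos_nonneg)
        then show False using sum pt by linarith
      qed
      have c1: "c < 1"
      proof -
        have "(ar r - ar t) \<bullet> (ar r - ar t) = 2 - 2 * c"
          using self[OF r(1)] self[OF less.prems]
          by (simp add: inner_diff_left inner_diff_right c_def inner_commute)
        moreover have "ar r \<noteq> ar t"
        proof
          assume e: "ar r = ar t"
          have "root r = ar r \<or> root r = - ar r" "root t = ar t \<or> root t = - ar t"
            by (simp_all add: ar_def)
          then show False using root_determines[OF less.prems r(1), of "ar t"] r(2) e by simp
        qed
        then have "(ar r - ar t) \<bullet> (ar r - ar t) > 0" by simp
        ultimately show ?thesis by linarith
      qed
      have "c * (ar t \<bullet> p) < ar t \<bullet> p" using c1 pt by simp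
      then have "ar r \<bullet> p < ar t \<bullet> p \<or> ar ?r \<bullet> p < ar t \<bullet> p" using sum by linarith
      then have "\<exists>q\<in>T. ar q \<bullet> p < ar t \<bullet> p \<and> ar q \<bullet> ar t = c"
      proof
        assume "ar r \<bullet> p < ar t \<bullet> p"
        then show ?thesis using r(1) c_def by (intro bexI[of _ r]) simp_all
      next
        assume "ar ?r \<bullet> p < ar t \<bullet> p"
        then show ?thesis using r' c' by (intro bexI[of _ ?r]) simp_all
      qed
      then obtain q where q: "q \<in> T" "ar q \<bullet> p < ar t \<bullet> p" "ar q \<bullet> ar t = c"
        by (elim bexE conjE)
      have qW: "q \<in> W" using q T_W by blast
      let ?t = "conjg t q"
      have t': "?t \<in> T" using less.prems qW T_conjg by simp
      \<comment> \<open>The lower root \<open>q\<close> has the same inner product c with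
        \<open>ar t\<close>. Thus \<open>conjg t q\<close> has height at most \<bar>h(t) - 2c
        h(q)\<bar> < h(t), and \<open>t\<close> is the product of \<open>q\<close>,
        \<open>conjg t q\<close> and \<open>q\<close>, all generated by induction.\<close>
      have tq: "(ar t v* q) \<bullet> p = ar t \<bullet> p - 2 * (c * (ar q \<bullet> p))"
        unfolding refl[OF q(1)] inner_commute[of "ar t" "ar q"] q(3) by (simp add: inner_diff_left)
      have "0 < c * (ar q \<bullet> p)" using c0 pos[OF q(1)] by simp
      moreover have "c * (ar q \<bullet> p) < ar q \<bullet> p" using c1 pos[OF q(1)] by simp
      ultimately have "\<bar>(ar t v* q) \<bullet> p\<bar> < ar t \<bullet> p" unfolding tq using q(2) by linarith
      then have "ar ?t \<bullet> p < ar t \<bullet> p"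
        using conj[OF less.prems qW] pos[OF t'] by auto
      then have "?t \<in> gen S'" using IH t' by blast
      then have "q ** (?t ** q) \<in> gen S'" using IH[OF q(1,2)] gen_mult by blast
      moreover have "q ** (?t ** q) = t"
        using qW T_inv[OF q(1)] T_sq[OF q(1)] T_cancel[OF q(1)] by (simp add: conjg_def mm)
      ultimately show ?thesis by simp
    qed (rule gen_base)
  qed
  have S'T: "S' \<subseteq> T" unfolding S'_def by blast
  have "x \<in> gen S'" if "x \<in> gen S" for x
    using that
  proof (induction rule: gen_induct)
    case (step s g)
    then show ?case using gen_mult[OF T_gen[OF S_T[OF step(1)]]] by blast
  qed simp
  then have wS: "w \<in> gen S'" using w W_gen by blast
  let ?P = "\<lambda>k. \<exists>ws. length ws = k \<and> set ws \<subseteq> S' \<and> mprod ws = w"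
  have "\<exists>k. ?P k" using wS unfolding gen_def by blast
  then have "?P (Least ?P)" by (rule LeastI_ex)
  then obtain ws where ws: "length ws = Least ?P" "set ws \<subseteq> S'" "mprod ws = w" by blast
  have min: "length ws \<le> length vs" if "set vs \<subseteq> S'" "mprod vs = w" for vs
    unfolding ws(1) using that by (intro Least_le) blast
  obtain s us where su: "ws = s # us" using ws(3) w1 by (cases ws) auto
  have s: "s \<in> S'" "s \<in> T" using su ws S'T by auto
  have wordW: "mprod vs \<in> W" if "set vs \<subseteq> S'" for vs
    using that by (induction vs) (use S'T T_W in auto)
  \<comment> \<open>The images of the root of the first letter under the successive prefixes of the
    word. They begin negative because \<open>s\<close> negates its own root, and end positive
    because \<open>w\<close> fixes \<open>p\<close>; somewhere the sign changes.\<close>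
  define b where "b j = ar s v* (s ** mprod (take j us))" for j
  have as: "ar s v* s = - ar s" using refl[OF s(2)] self[OF s(2)] by (simp add: scaleR_2)
  have b0: "b 0 \<bullet> p < 0" unfolding b_def using as pos[OF s(2)] by simp
  have bk: "b (length us) \<bullet> p > 0"
  proof -
    have "b (length us) = ar s v* w" unfolding b_def using ws(3) su by simp
    moreover have "(ar s v* w) \<bullet> p = ar s \<bullet> p"
      using orth_inner[OF W_orth[OF w(1)], of "ar s" p] w(2) by simp
    ultimately show ?thesis using pos[OF s(2)] by simp
  qed
  have "\<exists>j<length us. b j \<bullet> p < 0 \<and> \<not> b (Suc j) \<bullet> p < 0"
  proof (rule ccontr)
    assume n: "\<not> ?thesis"
    have "b j \<bullet> p < 0" if "j \<le> length us" for j
      using that by (induction j) (use b0 n in auto)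
    from this[of "length us"] bk show False by simp
  qed
  then obtain j where j: "j < length us" "b j \<bullet> p < 0" "\<not> b (Suc j) \<bullet> p < 0" by blast
  let ?u = "mprod (take j us)" let ?q = "us ! j"
  have "?q \<in> set us" using j by simp
  then have q: "?q \<in> S'" "?q \<in> T" using su ws S'T by auto
  have uW: "?u \<in> W" using su ws by (intro wordW) (auto dest: in_set_takeD)
  have suW: "s ** ?u \<in> W" using uW s T_W by simp
  let ?r = "conjg s (s ** ?u)"
  have rT: "?r \<in> T" using T_conjg s suW by simp
  have bj: "b j = - ar ?r" using conj_neg[OF s(2) suW] j unfolding b_def by simp
  have "b (Suc j) = b j v* ?q"
    unfolding b_def using j by (simp add: take_Suc_conv_app_nth vector_matrix_mul_assoc mm)
  then have "\<not> (ar ?r v* ?q) \<bullet> p > 0"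
    using j bj by (simp add: neg_vmult)
  \<comment> \<open>A wall reflection turns only its own positive root negative. At the sign change
    this identifies the letter, and it cancels against \<open>s\<close>, leaving a word shorter by
    two letters.\<close>
  then have "?r = ?q" using q(1) rT unfolding S'_def by blast
  moreover have "(s ** ?u) ** ?r = ?u"
    using s uW by (simp add: conjg_def mm T_cancel)
  ultimately have "?u = s ** (?u ** ?q)" by (simp add: mm)
  then have e: "s ** (?u ** ?q) = ?u" by simp
  have "us = take j us @ ?q # drop (Suc j) us" using j id_take_nth_drop by blast
  then have "mprod us = ?u ** (?q ** mprod (drop (Suc j) us))"
    by (metis mprod_append mprod_Cons)
  then have "w = mprod (take j us @ drop (Suc j) us)"
    using ws(3) su e by (simp add: mm) (metis matrix_mul_assoc)
  moreover have "set (take j us @ drop (Suc j) us) \<subseteq> S'"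
    using su ws by (auto dest: in_set_takeD in_set_dropD)
  ultimately have "length ws \<le> length (take j us @ drop (Suc j) us)" using min by blast
  then show False using j su by simp
qed

text \<open>A generic vector of Fix w lies on some hyperplane, because only 1 fixes a regular
  vector; by genericity that hyperplane contains all of Fix w.\<close>

lemma refl_containing_Fix:
  assumes w: "w \<in> W" "w \<noteq> mat 1"
  obtains t where "t \<in> T" "Fix w \<subseteq> Fix t"
proof -
  obtain v where v: "v \<in> Fix w" "\<And>t. t \<in> T \<Longrightarrow> v \<in> Fix t \<Longrightarrow> Fix w \<subseteq> Fix t"
    using generic_vector[OF subspace_Fix] by metis
  have "v v* w = v" using v(1) by (simp add: Fix_def)
  then have "\<exists>t\<in>T. v \<in> Fix t" using regular_fixed[of v w] w by blast
  then show ?thesis using v(2) that by blast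
qed

text \<open>The induction step of Carter's factorisation. The root of \<open>t\<close> is orthogonal
  to Fix w, hence of the form \<open>u v* w - u\<close>, and this \<open>u\<close> is a new fixed
  vector of \<open>w ** t\<close>.\<close>

lemma Fix_mult_refl:
  assumes w: "w \<in> W" and t: "t \<in> T" "Fix w \<subseteq> Fix t"
  shows "dim (Fix w) < dim (Fix (w ** t))"
proof -
  have o: "orthogonal_matrix w" using w W_orth by simp
  let ?a = "root t" let ?R = "range (\<lambda>u. u v* w - u)"
  have sR: "subspace ?R"
  proof -
    have "linear (\<lambda>u. u v* w - u)" by (intro linear_compose_sub linear_vmult linear_id[unfolded id_def])
    then show ?thesis using subspace_UNIV linear_subspace_image by blast
  qed
  obtain y z where yz: "y \<in> span ?R" "\<And>x. x \<in> span ?R \<Longrightarrow> orthogonal z x" "?a = y + z"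
    using orthogonal_decomp[of ?R ?a] by blast
  have "z \<in> Fix w"
  proof -
    have "(z v* matrix_inv w - z) \<bullet> u = 0" for u
    proof -
      have "u v* w - u \<in> span ?R" by (intro span_base) blast
      then have "z \<bullet> (u v* w - u) = 0" using yz(2) by (simp add: orthogonal_def)
      then show ?thesis using orth_vmult_move[OF o] by (simp add: inner_diff_left inner_diff_right)
    qed
    then have "z v* matrix_inv w = z" by (metis eq_iff_diff_eq_0 inner_eq_zero_iff)
    then have "z v* w = (z v* matrix_inv w) v* w" by simp
    then show ?thesis using w by (simp add: Fix_def vector_matrix_mul_assoc)
  qed
  then have "z \<bullet> ?a = 0" using t Fix_refl by auto
  moreover have "z \<bullet> y = 0" using yz(1,2) by (simp add: orthogonal_def)
  ultimately have "z \<bullet> z = 0" unfolding yz(3) by (simp add: inner_add_right)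
  then have "?a = y" using yz(3) by simp
  then have "?a \<in> ?R" using yz(1) sR by (metis span_eq_iff)
  then obtain u where u: "?a = u v* w - u" by blast
  then have uw: "u v* w = u + ?a" by simp
  have "(u + ?a) \<bullet> (u + ?a) = u \<bullet> u" using orth_inner[OF o, of u u] uw by simp
  \<comment> \<open>Since \<open>w\<close> preserves the norm of \<open>u\<close>, the inner product
    of \<open>u\<close> with the root is -1/2. The reflection \<open>t\<close> therefore takes
    \<open>u v* w\<close> back to \<open>u\<close>.\<close>
  then have ua: "2 * (u \<bullet> ?a) = -1" using root_self[OF t(1)]
    by (simp add: inner_add_left inner_add_right inner_commute)
  have "u v* (w ** t) = u"
    using root_refl[OF t(1), of "u + ?a"] uw ua root_self[OF t(1)]
    by (simp add: vector_matrix_mul_assoc[symmetric] inner_add_left distrib_left)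
  then have "u \<in> Fix (w ** t)" by (simp add: Fix_def)
  moreover have "u \<notin> Fix w" using uw root_neq0[OF t(1)] by (simp add: Fix_def)
  moreover have "Fix w \<subseteq> Fix (w ** t)"
    using t(2) by (auto simp: Fix_def vector_matrix_mul_assoc[symmetric])
  ultimately show ?thesis by (intro dim_less_subspace subspace_Fix) blast
qed

lemma carter:
  assumes "w \<in> W"
  shows "\<exists>ts. set ts \<subseteq> T \<and> mprod ts = w \<and> length ts \<le> codim (Fix w)"
  using assms
proof (induction "codim (Fix w)" arbitrary: w rule: less_induct)
  case less
  show ?case
  proof (cases "w = mat 1")
    case False
    obtain t where t: "t \<in> T" "Fix w \<subseteq> Fix t" using refl_containing_Fix[OF less.prems False] .
    have lt: "codim (Fix (w ** t)) < codim (Fix w)"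
      using Fix_mult_refl[OF less.prems t] dim_le_card[of "Fix (w ** t)"] by (simp add: codim_def)
    have "w ** t \<in> W" using less.prems t by simp
    from less.hyps[OF lt this] obtain ts
      where ts: "set ts \<subseteq> T" "mprod ts = w ** t" "length ts \<le> codim (Fix (w ** t))" by blast
    have "mprod (ts @ [t]) = w" using ts t by (simp add: mm T_sq)
    then show ?thesis using ts t lt by (intro exI[of _ "ts @ [t]"]) auto
  qed (intro exI[of _ "[]"], simp)
qed

section \<open>Dimensions of fixed spaces\<close>

lemma fixW_conj:
  assumes "w \<in> W" "P \<subseteq> W"
  shows "fixW ((\<lambda>u. conjg u w) ` P) = (\<lambda>v. v v* w) ` fixW P"
proof (intro set_eqI iffI)
  fix v assume v: "v \<in> fixW ((\<lambda>u. conjg u w) ` P)"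
  have "(v v* matrix_inv w) v* u = v v* matrix_inv w" if "u \<in> P" for u
  proof -
    have "v v* conjg u w = v" using v that by (simp add: fixW_def)
    then have "(v v* conjg u w) v* matrix_inv w = v v* matrix_inv w" by simp
    then show ?thesis using assms by (simp add: conjg_def vector_matrix_mul_assoc mm)
  qed
  then have "v v* matrix_inv w \<in> fixW P" by (simp add: fixW_def)
  moreover have "v = (v v* matrix_inv w) v* w" using assms by (simp add: vector_matrix_mul_assoc)
  ultimately show "v \<in> (\<lambda>v. v v* w) ` fixW P" by blast
next
  fix v assume "v \<in> (\<lambda>v. v v* w) ` fixW P"
  then obtain u where u: "u \<in> fixW P" "v = u v* w" by blast
  have "v v* conjg x w = v" if "x \<in> P" for x
  proof -
    have "u v* (x ** w) = u v* w" using u(1) that by (simp add: fixW_def vector_matrix_mul_assoc[symmetric])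
    then show ?thesis using assms(1) u(2) by (simp add: conjg_def vector_matrix_mul_assoc mm)
  qed
  then show "v \<in> fixW ((\<lambda>u. conjg u w) ` P)" by (simp add: fixW_def)
qed

lemma dim_image_W:
  assumes "w \<in> W" shows "dim ((\<lambda>v. v v* w) ` U) = dim U"
proof (rule dim_image_eq)
  show "linear (\<lambda>v. v v* w)" by (rule linear_vmult)
  have "(u v* w) v* matrix_inv w = u" for u using assms by (simp add: vector_matrix_mul_assoc)
  then show "inj_on (\<lambda>v. v v* w) (span U)" by (metis inj_onI)
qed

lemma fixW_par:
  assumes "K \<subseteq> S" "h \<in> W"
  shows "fixW (par K h) = (\<lambda>v. v v* h) ` fixW K"
proof -
  have "par K h = (\<lambda>u. conjg u h) ` gen K"
    using par_conj[of "mat 1" h K] par_one assms by simp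
  then show ?thesis using fixW_conj[OF assms(2) gen_sub[OF assms(1)]] by (simp add: fixW_gen)
qed

lemma dim_fixW_par: "K \<subseteq> S \<Longrightarrow> h \<in> W \<Longrightarrow> dim (fixW (par K h)) = dim (fixW K)"
  by (simp add: fixW_par dim_image_W)

lemma fixW_insert: "fixW (insert s K) = fixW K \<inter> Fix s"
  by (auto simp: fixW_Fix)

lemma dim_Int_Fix: "subspace U \<Longrightarrow> t \<in> T \<Longrightarrow> dim U \<le> dim (U \<inter> Fix t) + 1"
  using dim_Int_hyperplane[of U "root t"] by (simp add: Fix_refl)

lemma dim_fixW_Un:
  assumes "finite A" "A \<subseteq> S"
  shows "dim (fixW K) \<le> dim (fixW (K \<union> A)) + card A"
  using assms
proof (induction A)
  case (insert s A)
  then have "s \<in> T" using S_T by blast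
  then have "dim (fixW (K \<union> A)) \<le> dim (fixW (K \<union> insert s A)) + 1"
    using dim_Int_Fix[OF subspace_fixW, of s "K \<union> A"] by (simp add: fixW_insert)
  then show ?case using insert by simp
qed simp

text \<open>Each simple reflection lowers the dimension by at most one, and all of S together bring
  it from the rank down to 0. As S has exactly as many elements as the rank, every step must lower
  it by one; this replaces linear independence of the simple roots.\<close>

lemma dim_fixW:
  assumes "K \<subseteq> S" shows "dim (fixW K) + card K = CARD('n)"
proof -
  have fin: "finite K" using assms finite_S finite_subset by blast
  have "fixW S = {0}" using essential fixW_gen W_gen by metis
  then have "dim (fixW K) \<le> card (S - K)"
    using dim_fixW_Un[of "S - K" K] finite_S assms by (simp add: Un_absorb1)
  moreover have "card (S - K) + card K = CARD('n)"
    using card_S card_Diff_subset[OF fin assms] card_mono[OF finite_S assms] by simp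
  moreover have "fixW {} = (UNIV :: (real^'n) set)" by (simp add: fixW_def)
  then have "CARD('n) \<le> dim (fixW K) + card K"
    using dim_fixW_Un[OF fin assms, of "{}"] by simp
  ultimately show ?thesis by linarith
qed

lemma S_gen:
  assumes "K \<subseteq> S" "s \<in> S" "s \<in> gen K" shows "s \<in> K"
proof -
  have "s \<noteq> mat 1" using N_S[OF assms(2)] by auto
  then obtain r where "r \<in> K" "r \<in> N s" using gen_descent[OF assms(3,1)] by blast
  then show ?thesis using N_S[OF assms(2)] by simp
qed

text \<open>Multiplying a face of Q by a face of P yields a chamber \<open>b\<close> from which both
  subgroups are seen in standard form, with the type of P inside the type of Q. Equal dimensions
  then force equal types.\<close>

lemma parab_strict:
  assumes P: "P \<in> parabs" and Q: "Q \<in> parabs" and sub: "P \<subseteq> Q" and d: "dim (fixW P) = dim (fixW Q)"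
  shows "P = Q"
proof -
  obtain Z where Z: "Z \<in> faces" "supp Z = Q" using Q by (rule parabs_supp)
  obtain Z' where Z': "Z' \<in> faces" "supp Z' = P" using P by (rule parabs_supp)
  obtain K y where K: "K \<subseteq> S" "y \<in> W" "Z = coset K y" using Z(1) by (rule faces_E)
  obtain b where b: "b \<in> prodf Z Z'" using face_nonempty[OF Z'(1)] unfolding prodf_def by blast
  have bZ: "b \<in> coset K y" using b prodf_sub[OF Z(1) Z'(1)] K by blast
  then have bW: "b \<in> W" using coset_sub by blast
  let ?L = "{s\<in>S. conjg s b \<in> Q \<inter> P}"
  have PL: "P = par ?L b" using prodf_coset(2)[OF Z(1) Z'(1) b] Z Z' sub by (simp add: Int_absorb1)
  have QK: "Q = par K b" using supp_coset[OF K(1) bW] coset_eq[OF K(1,2) bZ] K(3) Z(2) by simp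
  have LK: "?L \<subseteq> K"
  proof
    fix s assume s: "s \<in> ?L"
    then have "conjg s b \<in> par K b" using QK by blast
    then have "s \<in> gen K" using bW by (simp add: par_def conjg_def mm)
    then show "s \<in> K" using S_gen K(1) s by blast
  qed
  have "dim (fixW ?L) = dim (fixW K)" using d PL QK dim_fixW_par bW K(1) by (metis (no_types, lifting) LK subset_trans)
  then have "card ?L = card K" using dim_fixW[of ?L] dim_fixW[OF K(1)] by auto
  then have "?L = K" by (rule card_subset_eq[OF finite_subset[OF K(1) finite_S] LK])
  then have "par ?L b = par K b" by (rule arg_cong)
  with PL have "P = par K b" by (rule trans)
  then show ?thesis using QK by (rule trans[OF _ sym])
qed

lemma parab_add:
  assumes P: "P \<in> parabs" and t: "t \<in> T"
  shows "\<exists>P'\<in>parabs. P \<subseteq> P' \<and> t \<in> P' \<and> dim (fixW P) \<le> dim (fixW P') + 1"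
proof (cases "t \<in> P")
  case False
  obtain K s h where K: "K \<subseteq> S" "s \<in> S" "h \<in> W" "P = par K h" "t \<in> par (insert s K) h"
    using parab_extend[OF P t False] .
  have K': "insert s K \<subseteq> S" using K by blast
  have "P \<subseteq> par (insert s K) h" unfolding K(4) par_def using gen_mono[of K "insert s K"] by blast
  moreover have "dim (fixW P) \<le> dim (fixW (par (insert s K) h)) + 1"
    unfolding K(4) dim_fixW_par[OF K(1,3)] dim_fixW_par[OF K' K(3)] fixW_insert
    using dim_Int_Fix[OF subspace_fixW S_T[OF K(2)]] .
  ultimately show ?thesis using K(5) parabsI[OF K' K(3)] by blast
qed (use P in auto)

section \<open>Parabolic subgroups as pointwise stabilisers\<close>

lemma fixW_anti: "P \<subseteq> Q \<Longrightarrow> fixW Q \<subseteq> fixW P"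
  unfolding fixW_def by blast

lemma refl_list_parab:
  assumes "set ts \<subseteq> T"
  shows "\<exists>P\<in>parabs. set ts \<subseteq> P \<and> CARD('n) \<le> dim (fixW P) + length ts"
  using assms
proof (induction ts)
  case Nil
  have "par {} (mat 1) \<in> parabs" by simp
  moreover have "dim (fixW (par {} (mat 1))) = CARD('n)"
    using dim_fixW[of "{}"] dim_fixW_par[of "{}" "mat 1"] by simp
  ultimately show ?case by (intro bexI[of _ "par {} (mat 1)"]) simp_all
next
  case (Cons t ts)
  then obtain P where P: "P \<in> parabs" "set ts \<subseteq> P" "CARD('n) \<le> dim (fixW P) + length ts" by auto
  have "t \<in> T" using Cons.prems by simp
  then obtain P' where "P' \<in> parabs" "P \<subseteq> P'" "t \<in> P'" "dim (fixW P) \<le> dim (fixW P') + 1"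
    using parab_add[OF P(1)] by blast
  then show ?case using P by (intro bexI[of _ P']) auto
qed

lemma Fix_conj: "u \<in> W \<Longrightarrow> w \<in> W \<Longrightarrow> Fix (conjg u w) = (\<lambda>v. v v* w) ` Fix u"
  using fixW_conj[of w "{u}"] by (simp add: fixW_Fix)

text \<open>A vector fixed by \<open>s ** c\<close> but not by \<open>s\<close> would put the root
  of \<open>s\<close> into the orthogonal complement of Fix c, which is the fixed space of W_K. Then
  adding \<open>s\<close> to \<open>K\<close> would not lower the dimension, contrary to
  \<open>dim_fixW\<close>.\<close>

lemma coxeter_element:
  assumes "finite K" "K \<subseteq> S"
  shows "\<exists>c\<in>gen K. Fix c = fixW K"
  using assms
proof (induction K)
  case empty
  show ?case by (intro bexI[of _ "mat 1"]) (simp_all add: fixW_def Fix_def)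
next
  case (insert s K)
  then obtain c where c: "c \<in> gen K" "Fix c = fixW K" by auto
  have s: "s \<in> S" "s \<in> T" and K: "K \<subseteq> S" using insert S_T by auto
  have cW: "c \<in> W" using c gen_sub K by blast
  have sc: "s ** c \<in> gen (insert s K)"
    using c(1) gen_mono[of K "insert s K"] gen_base[of s "insert s K"] gen_mult by blast
  have "Fix (s ** c) \<subseteq> fixW (insert s K)"
  proof
    fix v assume v: "v \<in> Fix (s ** c)"
    then have vs: "v v* s = v v* matrix_inv c"
    proof -
      have "(v v* (s ** c)) v* matrix_inv c = v v* matrix_inv c" using v by (simp add: Fix_def)
      then show ?thesis using cW by (simp add: vector_matrix_mul_assoc mm)
    qed
    have "v \<bullet> root s = 0"
    proof (rule ccontr)
      assume n: "v \<bullet> root s \<noteq> 0"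
      have "fixW K \<subseteq> Fix s"
      proof
        fix x assume x: "x \<in> fixW K"
        then have "x v* c = x" using c(2) by (auto simp: Fix_def)
        then have "(v v* matrix_inv c) \<bullet> x = v \<bullet> x" using orth_vmult_move[OF W_orth[OF cW], of v x] by simp
        then have "(v v* s - v) \<bullet> x = 0" unfolding vs by (simp add: inner_diff_left)
        then have "(v \<bullet> root s) * (root s \<bullet> x) = 0" using root_refl[OF s(2), of v] by simp
        then show "x \<in> Fix s" using n s(2) by (simp add: Fix_refl inner_commute)
      qed
      then have "fixW (insert s K) = fixW K" by (auto simp: fixW_insert)
      moreover have "card (insert s K) = Suc (card K)" using insert by simp
      ultimately show False using dim_fixW[OF K] dim_fixW[OF insert.prems] by simp
    qed
    then have s0: "v \<in> Fix s" using s(2) by (simp add: Fix_refl)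
    then have "v v* c = v" using v by (simp add: Fix_def vector_matrix_mul_assoc[symmetric])
    then have "v \<in> fixW K" using c(2) by (auto simp: Fix_def)
    then show "v \<in> fixW (insert s K)" using s0 by (simp add: fixW_insert)
  qed
  moreover have "fixW (insert s K) \<subseteq> Fix (s ** c)"
    using sc fixW_gen[of "insert s K"] unfolding fixW_Fix by blast
  ultimately show ?case using sc by blast
qed

lemma parab_element:
  assumes "P \<in> parabs" obtains c where "c \<in> P" "Fix c = fixW P"
proof -
  obtain K h where K: "K \<subseteq> S" "h \<in> W" "P = par K h" using assms by (rule parabs_E)
  obtain c where c: "c \<in> gen K" "Fix c = fixW K"
    using coxeter_element[OF finite_subset[OF K(1) finite_S] K(1)] by blast
  have cW: "c \<in> W" using c gen_sub K by blast
  have "conjg c h \<in> P" using c K cW by (simp add: par_def conjg_def mm)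
  moreover have "Fix (conjg c h) = fixW P"
    unfolding K(3) fixW_par[OF K(1,2)] Fix_conj[OF cW K(2)] c(2) ..
  ultimately show ?thesis using that by blast
qed

lemma fixW_sub_Fix: "u \<in> P \<Longrightarrow> fixW P \<subseteq> Fix u"
  unfolding fixW_def Fix_def by blast

text \<open>Take \<open>c\<close> in P with Fix c equal to the flat of P. Factoring
  \<open>c ** t\<close> by Carter places \<open>c\<close> and \<open>t\<close> together in a
  parabolic P' of rank at most that of P. It contains \<open>c\<close>, so comparing P, P' and their
  intersection by dimension gives P = P'.\<close>

lemma refl_in_parab:
  assumes P: "P \<in> parabs" and t: "t \<in> T" "fixW P \<subseteq> Fix t"
  shows "t \<in> P"
proof -
  obtain c where c: "c \<in> P" "Fix c = fixW P" using P by (rule parab_element)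
  have cW: "c \<in> W" using c P parabs_sub by blast
  obtain ts where ts: "set ts \<subseteq> T" "mprod ts = c ** t" "length ts \<le> codim (Fix (c ** t))"
    using carter[of "c ** t"] cW t by auto
  have "dim (Fix c) < dim (Fix (c ** t))" using Fix_mult_refl[OF cW t(1)] t c by simp
  \<comment> \<open>Right multiplication by \<open>t\<close> enlarges the fixed space, which pays
    for the extra letter \<open>t\<close> in the list.\<close>
  then have l: "length (ts @ [t]) \<le> codim (Fix c)"
    using ts(3) dim_le_card[of "Fix (c ** t)"] by (simp add: codim_def)
  have "set (ts @ [t]) \<subseteq> T" using ts t by simp
  from refl_list_parab[OF this] obtain P' where P': "P' \<in> parabs" "set (ts @ [t]) \<subseteq> P'"
    "CARD('n) \<le> dim (fixW P') + length (ts @ [t])" by blast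
  have dP': "dim (fixW P) \<le> dim (fixW P')" using P'(3) l c(2) dim_le_card[of "fixW P"] by (simp add: codim_def)
  have "mprod ts \<in> P'"
  proof -
    have "set us \<subseteq> P' \<Longrightarrow> mprod us \<in> P'" for us
      by (induction us) (use P'(1) parabs_mult in auto)
    then show ?thesis using P'(2) by simp
  qed
  then have "mprod ts ** t \<in> P'" using parabs_mult[OF P'(1)] P'(2) by simp
  then have cP': "c \<in> P'" using ts(2) t T_sq by (simp add: mm)
  have I: "P \<inter> P' \<in> parabs" using P P'(1) parabs_Int by blast
  have "fixW (P \<inter> P') = fixW P"
  proof
    show "fixW (P \<inter> P') \<subseteq> fixW P" using fixW_sub_Fix[of c "P \<inter> P'"] c cP' by blast
  qed (rule fixW_anti, blast)
  then have "P \<inter> P' = P" using parab_strict[OF I P] by simp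
  then have PP': "P \<subseteq> P'" by blast
  have "fixW P' \<subseteq> fixW P" using fixW_sub_Fix[OF cP'] c(2) by simp
  then have "fixW P' = fixW P" using dP' subspace_fixW by (metis subspace_dim_equal)
  then have "P = P'" using parab_strict[OF P P'(1) PP'] by simp
  then show ?thesis using P'(2) by simp
qed

text \<open>Every element is cuspidal in some parabolic subgroup. The reflections of a Carter
  factorisation lie in a parabolic of rank at most their number, so the inclusion of its flat in Fix
  w is an equality by dimension.\<close>

lemma Fix_parab:
  assumes w: "w \<in> W"
  obtains P ts where "P \<in> parabs" "fixW P = Fix w" "set ts \<subseteq> P \<inter> T" "w = mprod ts"
proof -
  obtain ts where ts: "set ts \<subseteq> T" "mprod ts = w" "length ts \<le> codim (Fix w)"
    using carter[OF w] by blast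
  obtain P where P: "P \<in> parabs" "set ts \<subseteq> P" "CARD('n) \<le> dim (fixW P) + length ts"
    using refl_list_parab[OF ts(1)] by blast
  have "mprod ts \<in> P"
  proof -
    have "set us \<subseteq> P \<Longrightarrow> mprod us \<in> P" for us
      by (induction us) (use P(1) parabs_mult in auto)
    then show ?thesis using P(2) by simp
  qed
  then have "fixW P \<subseteq> Fix w" using fixW_sub_Fix ts(2) by blast
  moreover have "dim (Fix w) \<le> dim (fixW P)" using P(3) ts(3) dim_le_card[of "Fix w"] by (simp add: codim_def)
  ultimately have "fixW P = Fix w" using subspace_fixW subspace_Fix by (metis subspace_dim_equal)
  then show ?thesis using that P ts by blast
qed

text \<open>Steinberg's theorem for these subgroups: the factors of \<open>w\<close> are reflections
  that fix the flat, so \<open>refl_in_parab\<close> applies to each of them.\<close>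

lemma parab_iff:
  assumes P: "P \<in> parabs" and w: "w \<in> W"
  shows "w \<in> P \<longleftrightarrow> fixW P \<subseteq> Fix w"
proof
  assume "fixW P \<subseteq> Fix w"
  obtain Q ts where Q: "Q \<in> parabs" "fixW Q = Fix w" "set ts \<subseteq> Q \<inter> T" "w = mprod ts"
    using w by (rule Fix_parab)
  have "set ts \<subseteq> P"
  proof
    fix t assume t: "t \<in> set ts"
    then have "Fix w \<subseteq> Fix t" using Q(2,3) fixW_sub_Fix by blast
    then show "t \<in> P" using refl_in_parab[OF P] t Q(3) \<open>fixW P \<subseteq> Fix w\<close> by blast
  qed
  moreover have "set us \<subseteq> P \<Longrightarrow> mprod us \<in> P" for us
    by (induction us) (use P parabs_mult in auto)
  ultimately show "w \<in> P" using Q(4) by blast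
qed (rule fixW_sub_Fix)

lemma fixW_inj:
  assumes "P \<in> parabs" "Q \<in> parabs" "fixW P = fixW Q" shows "P = Q"
proof -
  have "w \<in> P \<longleftrightarrow> w \<in> Q" if "w \<in> W" for w using parab_iff assms that by simp
  then show ?thesis using parabs_sub assms by blast
qed

text \<open>Every flat comes from a parabolic subgroup. Cutting by a new hyperplane lowers the
  dimension by at least one, while the subgroup enlarged by \<open>parab_add\<close> loses at most
  one; the two spaces therefore coincide.\<close>

lemma inter_hyps_parab:
  assumes "set ts \<subseteq> T"
  shows "\<exists>P\<in>parabs. fixW P = inter_hyps ts"
  using assms
proof (induction ts)
  case Nil
  have "fixW (par {} (mat 1)) = inter_hyps []" 
    by (subst fixW_par) (simp_all add: inter_hyps_def fixW_def)
  then show ?case using parabsI[of "{}" "mat 1"] by auto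
next
  case (Cons t ts)
  then obtain P where P: "P \<in> parabs" "fixW P = inter_hyps ts" by auto
  have t: "t \<in> T" using Cons.prems by simp
  have i: "inter_hyps (t # ts) = fixW P \<inter> Fix t" unfolding P(2) by (auto simp: inter_hyps_def Fix_def)
  show ?case
  proof (cases "fixW P \<subseteq> Fix t")
    case False
    obtain P' where P': "P' \<in> parabs" "P \<subseteq> P'" "t \<in> P'" "dim (fixW P) \<le> dim (fixW P') + 1"
      using parab_add[OF P(1) t] by blast
    have sI: "subspace (fixW P \<inter> Fix t)" by (intro subspace_inter subspace_fixW subspace_Fix)
    have sub: "fixW P' \<subseteq> fixW P \<inter> Fix t" using fixW_anti[OF P'(2)] fixW_sub_Fix[OF P'(3)] by blast
    have "dim (fixW P \<inter> Fix t) < dim (fixW P)"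
      using False by (intro dim_less_subspace sI subspace_fixW) blast
    then have "fixW P' = fixW P \<inter> Fix t"
      using P'(4) by (intro subspace_dim_equal[OF subspace_fixW sI sub]) linarith
    then show ?thesis using P'(1) i by auto
  qed (use P i in auto)
qed

section \<open>Normalizers and cuspidal elements\<close>

lemma normalizer_iff:
  assumes "P \<in> parabs" "g \<in> W"
  shows "g \<in> normalizer W P \<longleftrightarrow> (\<lambda>v. v v* g) ` fixW P = fixW P"
proof -
  have "fixW ((\<lambda>u. conjg u g) ` P) = (\<lambda>v. v v* g) ` fixW P"
    using fixW_conj assms parabs_sub by simp
  then show ?thesis using fixW_inj[OF parabs_conj[OF assms] assms(1)] assms(2)
    by (auto simp: normalizer_def)
qed

text \<open>Subtracting the orthogonal projection onto the fixed space of W_L turns a fixed vector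
  of \<open>w\<close> into a fixed vector in the complement. Cuspidality thus becomes an equality of
  fixed spaces, the form needed to compare \<open>alphaL\<close> with \<open>alpha\<close>.\<close>

lemma cuspidal_iff:
  assumes L: "L \<subseteq> S"
  shows "cuspidal L w \<longleftrightarrow> w \<in> gen L \<and> Fix w = fixW (gen L)"
proof
  assume c: "cuspidal L w"
  then have w: "w \<in> gen L" by (simp add: cuspidal_def)
  have sub: "fixW (gen L) \<subseteq> Fix w" using fixW_sub_Fix w by blast
  have "v \<in> fixW (gen L)" if v: "v \<in> Fix w" for v
  proof -
    obtain y z where yz: "y \<in> span (fixW (gen L))" "\<And>x. x \<in> span (fixW (gen L)) \<Longrightarrow> orthogonal z x" "v = y + z"
      using orthogonal_decomp[of "fixW (gen L)" v] by blast
    have y: "y \<in> fixW (gen L)" using yz(1) subspace_fixW by (metis span_eq_iff)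
    then have "z \<in> Fix w" using v sub subspace_diff[OF subspace_Fix, of v w y] yz(3) by auto
    moreover have "\<forall>u\<in>fixW (gen L). z \<bullet> u = 0" using yz(2) span_base unfolding orthogonal_def by blast
    ultimately have "z = 0" using c by (simp add: cuspidal_def Fix_def)
    then show ?thesis using yz(3) y by simp
  qed
  then show "w \<in> gen L \<and> Fix w = fixW (gen L)" using w sub by blast
next
  assume "w \<in> gen L \<and> Fix w = fixW (gen L)"
  moreover have "v = 0" if "\<forall>u\<in>Fix w. v \<bullet> u = 0" "v v* w = v" for v
    using that by (auto simp: Fix_def)
  ultimately show "cuspidal L w" by (auto simp: cuspidal_def)
qed

lemma cent_normalizer:
  assumes L: "L \<subseteq> S" and w: "cuspidal L w"
  shows "cent W w \<subseteq> normalizer W (gen L)"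
proof
  fix g assume "g \<in> cent W w"
  then have g: "g \<in> W" "g ** w = w ** g" by (auto simp: cent_def)
  have F: "Fix w = fixW (gen L)" and wW: "w \<in> W" using w cuspidal_iff[OF L] gen_sub[OF L] by auto
  have "conjg w g = w" using g(1) by (simp add: conjg_def mm g(2)[symmetric])
  then have "(\<lambda>v. v v* g) ` Fix w = Fix w" using Fix_conj[OF wW g(1)] by simp
  then show "g \<in> normalizer W (gen L)"
    using normalizer_iff[OF gen_parabs[OF L] g(1)] F by simp
qed

lemma conj_cuspidal:
  assumes w: "w \<in> W"
  obtains L x where "L \<subseteq> S" "x \<in> W" "cuspidal L (conjg w x)"
proof -
  obtain P where P: "P \<in> parabs" "fixW P = Fix w" using Fix_parab[OF w] by metis
  obtain L h where L: "L \<subseteq> S" "h \<in> W" "P = par L h" using P(1) by (rule parabs_E)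
  have "w \<in> P" using parab_iff[OF P(1) w] P(2) by simp
  then have g: "conjg w (matrix_inv h) \<in> gen L" using L by (simp add: par_def conjg_def mm)
  have "Fix (conjg w (matrix_inv h)) = fixW (gen L)"
  proof -
    have "Fix (conjg w (matrix_inv h)) = (\<lambda>v. v v* matrix_inv h) ` (\<lambda>v. v v* h) ` fixW L"
      using Fix_conj[OF w, of "matrix_inv h"] L P(2) fixW_par[OF L(1,2)] by simp
    also have "\<dots> = fixW L" using L(2) by (simp add: image_image vector_matrix_mul_assoc)
    finally show ?thesis by (simp add: fixW_gen)
  qed
  then show ?thesis using that[OF L(1), of "matrix_inv h"] g L(2) cuspidal_iff[OF L(1)] by simp
qed

end


section \<open>Traces on quotient spaces\<close>

definition csubspace :: "('x \<Rightarrow> complex) set \<Rightarrow> bool" where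
  "csubspace U \<longleftrightarrow> (\<lambda>_. 0) \<in> U \<and> (\<forall>u\<in>U. \<forall>v\<in>U. (\<lambda>x. u x + v x) \<in> U)
     \<and> (\<forall>c. \<forall>u\<in>U. (\<lambda>x. c * u x) \<in> U)"

definition clin :: "(('x \<Rightarrow> complex) \<Rightarrow> ('y \<Rightarrow> complex)) \<Rightarrow> bool" where
  "clin f \<longleftrightarrow> (\<forall>u v. f (\<lambda>x. u x + v x) = (\<lambda>x. f u x + f v x))
     \<and> (\<forall>c u. f (\<lambda>x. c * u x) = (\<lambda>x. c * f u x))"

section \<open>Subspaces and linear maps of function spaces\<close>

lemma csubspace_add: "csubspace U \<Longrightarrow> u \<in> U \<Longrightarrow> v \<in> U \<Longrightarrow> (\<lambda>x. u x + v x) \<in> U"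
  by (simp add: csubspace_def)

lemma csubspace_scale: "csubspace U \<Longrightarrow> u \<in> U \<Longrightarrow> (\<lambda>x. c * u x) \<in> U"
  by (simp add: csubspace_def)

lemma csubspace_0: "csubspace U \<Longrightarrow> (\<lambda>_. 0) \<in> U"
  by (simp add: csubspace_def)

lemma csubspace_sum:
  assumes "csubspace U" "\<And>i. i \<in> I \<Longrightarrow> v i \<in> U"
  shows "(\<lambda>x. \<Sum>i\<in>I. c i * v i x) \<in> U"
  using assms(2)
proof (induction I rule: infinite_finite_induct)
  case (insert i I)
  then have "(\<lambda>x. c i * v i x) \<in> U" "(\<lambda>x. \<Sum>i\<in>I. c i * v i x) \<in> U"
    by (auto intro: csubspace_scale[OF assms(1)])
  from csubspace_add[OF assms(1) this]
  have "(\<lambda>x. c i * v i x + (\<Sum>i\<in>I. c i * v i x)) \<in> U" .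
  then show ?case using insert by simp
qed (use assms in \<open>auto simp: csubspace_def\<close>)

lemma csubspace_diff: 
  assumes "csubspace U" "u \<in> U" "v \<in> U" shows "(\<lambda>x. u x - v x) \<in> U"
  using csubspace_add[OF assms(1,2) csubspace_scale[OF assms(1,3), of "-1"]] by simp

lemma csubspace_sum1:
  assumes "csubspace U" "\<And>i. i \<in> I \<Longrightarrow> v i \<in> U"
  shows "(\<lambda>x. \<Sum>i\<in>I. v i x) \<in> U"
  using csubspace_sum[OF assms, where c = "\<lambda>_. 1"] by simp

lemma csubspace_zero: "csubspace {\<lambda>_. 0}"
  by (simp add: csubspace_def)

lemma clin_zero: "clin f \<Longrightarrow> f (\<lambda>_. 0) = (\<lambda>_. 0)"
  using spec[OF spec[OF conjunct2[OF iffD1[OF clin_def]]], of f 0 "\<lambda>_. 0"] by simp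

lemma clin_add: "clin f \<Longrightarrow> f (\<lambda>x. u x + v x) = (\<lambda>x. f u x + f v x)"
  by (simp add: clin_def)

lemma clin_scale: "clin f \<Longrightarrow> f (\<lambda>x. c * u x) = (\<lambda>x. c * f u x)"
  by (simp add: clin_def)

lemma clin_diff: 
  assumes "clin f" shows "f (\<lambda>x. u x - v x) = (\<lambda>x. f u x - f v x)"
  using clin_add[OF assms, of u "\<lambda>x. -1 * v x"] clin_scale[OF assms, of "-1" v] by simp

lemma clin_sum:
  assumes "clin f"
  shows "f (\<lambda>x. \<Sum>i\<in>I. c i * v i x) = (\<lambda>x. \<Sum>i\<in>I. c i * f (v i) x)"
proof (induction I rule: infinite_finite_induct)
  case (insert i I)
  then show ?case
    using clin_add[OF assms, of "\<lambda>x. c i * v i x" "\<lambda>x. \<Sum>i\<in>I. c i * v i x"] clin_scale[OF assms]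
    by simp
qed (simp_all add: clin_zero assms)

lemma clin_sum1:
  assumes "clin f"
  shows "f (\<lambda>x. \<Sum>i\<in>I. v i x) = (\<lambda>x. \<Sum>i\<in>I. f (v i) x)"
  using clin_sum[OF assms, where c = "\<lambda>_. 1"] by simp

lemma csubspace_image:
  assumes "clin f" "csubspace U" shows "csubspace (f ` U)"
  unfolding csubspace_def
proof (intro conjI ballI allI)
  show "(\<lambda>_. 0) \<in> f ` U" using clin_zero[OF assms(1)] csubspace_0[OF assms(2)] by (metis imageI)
next
  fix u v assume "u \<in> f ` U" "v \<in> f ` U"
  then obtain a b where "a \<in> U" "b \<in> U" "u = f a" "v = f b" by blast
  then show "(\<lambda>x. u x + v x) \<in> f ` U"
    using clin_add[OF assms(1), of a b] csubspace_add[OF assms(2), of a b] by (metis imageI)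
next
  fix c u assume "u \<in> f ` U"
  then obtain a where "a \<in> U" "u = f a" by blast
  then show "(\<lambda>x. c * u x) \<in> f ` U"
    using clin_scale[OF assms(1), of c a] csubspace_scale[OF assms(2), of a c] by (metis imageI)
qed

text \<open>A basis of U modulo U' indexed by an arbitrary finite set instead of positions in a
  list, so that bases of summands can be combined over a \<open>Sigma\<close> type.\<close>

definition quot_basis :: "'i set \<Rightarrow> ('i \<Rightarrow> 'x \<Rightarrow> complex) \<Rightarrow> ('x \<Rightarrow> complex) set \<Rightarrow> ('x \<Rightarrow> complex) set \<Rightarrow> bool" where
  "quot_basis I b U U' \<longleftrightarrow> finite I \<and> b ` I \<subseteq> U
     \<and> (\<forall>c. (\<lambda>x. \<Sum>i\<in>I. c i * b i x) \<in> U' \<longrightarrow> (\<forall>i\<in>I. c i = 0))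
     \<and> (\<forall>u\<in>U. \<exists>c. (\<lambda>x. u x - (\<Sum>i\<in>I. c i * b i x)) \<in> U')"

definition quot_matrix :: "'i set \<Rightarrow> ('i \<Rightarrow> 'x \<Rightarrow> complex) \<Rightarrow> (('x \<Rightarrow> complex) \<Rightarrow> ('x \<Rightarrow> complex)) \<Rightarrow> ('i \<Rightarrow> 'i \<Rightarrow> complex)
    \<Rightarrow> ('x \<Rightarrow> complex) set \<Rightarrow> bool" where
  "quot_matrix I b f m U' \<longleftrightarrow> (\<forall>j\<in>I. (\<lambda>x. f (b j) x - (\<Sum>i\<in>I. m i j * b i x)) \<in> U')"

section \<open>Bases of quotients and uniqueness of the trace\<close>

lemma quot_basis_indep: "quot_basis I b U U' \<Longrightarrow> (\<lambda>x. \<Sum>i\<in>I. c i * b i x) \<in> U' \<Longrightarrow> i \<in> I \<Longrightarrow> c i = 0"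
  unfolding quot_basis_def by blast

lemma quot_basis_span: "quot_basis I b U U' \<Longrightarrow> u \<in> U \<Longrightarrow> \<exists>c. (\<lambda>x. u x - (\<Sum>i\<in>I. c i * b i x)) \<in> U'"
  unfolding quot_basis_def by blast

lemma quot_basis_change:
  assumes I: "quot_basis I b U U'" and s: "csubspace U'"
    and d: "\<And>j. j \<in> J \<Longrightarrow> (\<lambda>x. d j x - (\<Sum>i\<in>I. A i j * b i x)) \<in> U'"
    and e: "(\<lambda>x. e x - (\<Sum>j\<in>J. c j * d j x)) \<in> U'"
    and e': "(\<lambda>x. e x - (\<Sum>i\<in>I. c' i * b i x)) \<in> U'" and k: "k \<in> I"
  shows "c' k = (\<Sum>j\<in>J. A k j * c j)"
proof -
  have 1: "(\<lambda>x. \<Sum>j\<in>J. c j * (d j x - (\<Sum>i\<in>I. A i j * b i x))) \<in> U'"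
    by (rule csubspace_sum[OF s]) (rule d)
  have "(\<lambda>x. (e x - (\<Sum>j\<in>J. c j * d j x)) + (\<Sum>j\<in>J. c j * (d j x - (\<Sum>i\<in>I. A i j * b i x)))
        - (e x - (\<Sum>i\<in>I. c' i * b i x))) \<in> U'"
    by (rule csubspace_diff[OF s csubspace_add[OF s e 1] e'])
  also have "(\<lambda>x. (e x - (\<Sum>j\<in>J. c j * d j x)) + (\<Sum>j\<in>J. c j * (d j x - (\<Sum>i\<in>I. A i j * b i x)))
        - (e x - (\<Sum>i\<in>I. c' i * b i x))) = (\<lambda>x. \<Sum>i\<in>I. (c' i - (\<Sum>j\<in>J. A i j * c j)) * b i x)"
  proof
    fix x
    have "(\<Sum>j\<in>J. c j * (\<Sum>i\<in>I. A i j * b i x)) = (\<Sum>i\<in>I. (\<Sum>j\<in>J. A i j * c j) * b i x)"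
      by (simp add: sum_distrib_left sum_distrib_right) (subst sum.swap, simp add: algebra_simps)
    then show "(e x - (\<Sum>j\<in>J. c j * d j x)) + (\<Sum>j\<in>J. c j * (d j x - (\<Sum>i\<in>I. A i j * b i x)))
        - (e x - (\<Sum>i\<in>I. c' i * b i x)) = (\<Sum>i\<in>I. (c' i - (\<Sum>j\<in>J. A i j * c j)) * b i x)"
      by (simp add: right_diff_distrib left_diff_distrib sum_subtractf)
  qed
  finally show ?thesis using quot_basis_indep[OF I _ k] by fastforce
qed

text \<open>The two families expand in each other modulo U' with mutually inverse coefficient
  matrices, which conjugate the matrix of f in one into that in the other.\<close>

lemma qtrace_unique:
  assumes I: "quot_basis I b U U'" "quot_matrix I b f m U'" and J: "quot_basis J d U U'" "quot_matrix J d f n U'"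
    and s: "csubspace U'" and f: "clin f" "f ` U' \<subseteq> U'"
  shows "(\<Sum>i\<in>I. m i i) = (\<Sum>j\<in>J. n j j)"
proof -
  have finI: "finite I" and finJ: "finite J" using I J by (auto simp: quot_basis_def)
  have "\<forall>j\<in>J. \<exists>c. (\<lambda>x. d j x - (\<Sum>i\<in>I. c i * b i x)) \<in> U'"
    using I(1) J(1) unfolding quot_basis_def by blast
  then obtain A where A: "\<And>j. j \<in> J \<Longrightarrow> (\<lambda>x. d j x - (\<Sum>i\<in>I. A j i * b i x)) \<in> U'" by metis
  have "\<forall>i\<in>I. \<exists>c. (\<lambda>x. b i x - (\<Sum>j\<in>J. c j * d j x)) \<in> U'"
    using I(1) J(1) unfolding quot_basis_def by blast
  then obtain B where B: "\<And>i. i \<in> I \<Longrightarrow> (\<lambda>x. b i x - (\<Sum>j\<in>J. B i j * d j x)) \<in> U'" by metis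
  have z: "(\<lambda>x. h x - (\<Sum>i\<in>K. (if i = k then 1 else 0) * g i x)) \<in> U'"
    if "finite K" "k \<in> K" "h = g k" for h g k and K :: "'k set"
  proof -
    have "(\<Sum>i\<in>K. (if i = k then 1 else 0) * g i x) = g k x" for x
      using that sum.delta[OF that(1), of k "\<lambda>i. g i x"] by (simp add: if_distrib[of "\<lambda>c. c * _"] cong: if_cong)
    then show ?thesis using csubspace_0[OF s] that by simp
  qed
  have AB: "(\<Sum>j\<in>J. A j k * B i j) = (if k = i then 1 else 0)" if "i \<in> I" "k \<in> I" for i k
    using quot_basis_change[OF I(1) s A B[OF that(1)] z[OF finI that(1) refl] that(2)] by simp
  have BA: "(\<Sum>i\<in>I. B i k * A j i) = (if k = j then 1 else 0)" if "j \<in> J" "k \<in> J" for j k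
    using quot_basis_change[OF J(1) s B A[OF that(1)] z[OF finJ that(1) refl] that(2)] by simp
  \<comment> \<open>Both sides are coordinates of \<open>f (d j)\<close> in the basis
    \<open>b\<close>. Since f preserves U', the expansion of \<open>d j\<close> modulo U' may be
    passed through f.\<close>
  have mA: "(\<Sum>i\<in>I. m k i * A j i) = (\<Sum>l\<in>J. A l k * n l j)" if j: "j \<in> J" and k: "k \<in> I" for j k
  proof -
    have fd: "(\<lambda>x. f (d j) x - (\<Sum>l\<in>J. n l j * d l x)) \<in> U'" using J(2) j by (simp add: quot_matrix_def)
    have "f (\<lambda>x. d j x - (\<Sum>i\<in>I. A j i * b i x)) \<in> U'" using f(2) A[OF j] by blast
    then have 1: "(\<lambda>x. f (d j) x - (\<Sum>i\<in>I. A j i * f (b i) x)) \<in> U'"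
      unfolding clin_diff[OF f(1)] clin_sum[OF f(1)] .
    have 2: "(\<lambda>x. f (b i) x - (\<Sum>k\<in>I. m k i * b k x)) \<in> U'" if "i \<in> I" for i
      using I(2) that by (simp add: quot_matrix_def)
    have "(\<lambda>x. \<Sum>i\<in>I. A j i * (f (b i) x - (\<Sum>k\<in>I. m k i * b k x))) \<in> U'"
      by (rule csubspace_sum[OF s 2])
    from csubspace_add[OF s 1 this]
    have "(\<lambda>x. f (d j) x - (\<Sum>i\<in>I. A j i * (\<Sum>k\<in>I. m k i * b k x))) \<in> U'"
      by (simp add: right_diff_distrib sum_subtractf)
    moreover have "(\<Sum>i\<in>I. A j i * (\<Sum>k\<in>I. m k i * b k x)) = (\<Sum>k\<in>I. (\<Sum>i\<in>I. m k i * A j i) * b k x)" for x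
      by (simp add: sum_distrib_left sum_distrib_right) (subst sum.swap, simp add: algebra_simps)
    ultimately have "(\<lambda>x. f (d j) x - (\<Sum>k\<in>I. (\<Sum>i\<in>I. m k i * A j i) * b k x)) \<in> U'" by simp
    from quot_basis_change[OF I(1) s A fd this k] show ?thesis by simp
  qed
  have "(\<Sum>j\<in>J. n j j) = (\<Sum>j\<in>J. \<Sum>l\<in>J. (if j = l then 1 else 0) * n l j)"
    using finJ by (intro sum.cong) (simp_all add: if_distrib[of "\<lambda>c. c * _"] cong: if_cong)
  also have "\<dots> = (\<Sum>j\<in>J. \<Sum>l\<in>J. (\<Sum>i\<in>I. B i j * A l i) * n l j)"
    by (intro sum.cong refl) (simp add: BA)
  also have "\<dots> = (\<Sum>j\<in>J. \<Sum>i\<in>I. B i j * (\<Sum>l\<in>J. A l i * n l j))"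
    by (intro sum.cong refl) (simp add: sum_distrib_left sum_distrib_right, subst sum.swap, simp add: algebra_simps)
  also have "\<dots> = (\<Sum>j\<in>J. \<Sum>i\<in>I. B i j * (\<Sum>k\<in>I. m i k * A j k))"
    by (intro sum.cong refl) (simp add: mA)
  also have "\<dots> = (\<Sum>i\<in>I. \<Sum>k\<in>I. m i k * (\<Sum>j\<in>J. A j k * B i j))"
    by (subst sum.swap) (intro sum.cong refl, simp add: sum_distrib_left sum_distrib_right, subst sum.swap, simp add: algebra_simps)
  also have "\<dots> = (\<Sum>i\<in>I. \<Sum>k\<in>I. m i k * (if k = i then 1 else 0))"
    by (intro sum.cong refl) (simp add: AB)
  also have "\<dots> = (\<Sum>i\<in>I. m i i)"
    using finI by (intro sum.cong) (simp_all add: if_distrib cong: if_cong)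
  finally show ?thesis by simp
qed

lemma quot_basis_reindex:
  assumes "quot_basis I b U U'" "bij_betw p J I"
  shows "quot_basis J (b \<circ> p) U U'"
proof -
  have s: "(\<Sum>j\<in>J. c j * b (p j) x) = (\<Sum>i\<in>I. c (inv_into J p i) * b i x)" for c x
  proof -
    have "(\<Sum>i\<in>I. c (inv_into J p i) * b i x) = (\<Sum>j\<in>J. c (inv_into J p (p j)) * b (p j) x)"
      using sum.reindex_bij_betw[OF assms(2), of "\<lambda>i. c (inv_into J p i) * b i x"] by simp
    also have "\<dots> = (\<Sum>j\<in>J. c j * b (p j) x)"
      using assms(2) by (intro sum.cong) (auto simp: bij_betw_def)
    finally show ?thesis ..
  qed
  have s': "(\<Sum>i\<in>I. c i * b i x) = (\<Sum>j\<in>J. c (p j) * b (p j) x)" for c x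
    using sum.reindex_bij_betw[OF assms(2), of "\<lambda>i. c i * b i x"] by simp
  show ?thesis
    unfolding quot_basis_def o_def
  proof (intro conjI allI impI ballI)
    show "finite J" using assms by (simp add: quot_basis_def bij_betw_finite)
    show "(\<lambda>j. b (p j)) ` J \<subseteq> U" using assms by (auto simp: quot_basis_def bij_betw_def)
    fix c i assume "(\<lambda>x. \<Sum>j\<in>J. c j * b (p j) x) \<in> U'" "i \<in> J"
    moreover have "p i \<in> I" using bij_betwE[OF assms(2)] \<open>i \<in> J\<close> by blast
    ultimately have "c (inv_into J p (p i)) = 0"
      unfolding s by (intro quot_basis_indep[OF assms(1)])
    then show "c i = 0" using bij_betw_inv_into_left[OF assms(2) \<open>i \<in> J\<close>] by simp
  next
    fix u assume "u \<in> U"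
    then obtain c where "(\<lambda>x. u x - (\<Sum>i\<in>I. c i * b i x)) \<in> U'" using quot_basis_span[OF assms(1)] by blast
    then show "\<exists>c. (\<lambda>x. u x - (\<Sum>j\<in>J. c j * b (p j) x)) \<in> U'" unfolding s' by (intro exI[of _ "\<lambda>j. c (p j)"])
  qed
qed

text \<open>Resolves the choice in \<open>qtrace\<close>: the value is attained by enumerating the
  index set as a list, and all admissible values agree.\<close>

lemma qtrace_eqI:
  assumes I: "quot_basis I b U U'" "quot_matrix I b f m U'" and s: "csubspace U'" and f: "clin f" "f ` U' \<subseteq> U'"
  shows "qtrace f U U' = (\<Sum>i\<in>I. m i i)"
proof -
  define Q where "Q t \<longleftrightarrow> (\<exists>bs M. set bs \<subseteq> U
      \<and> (\<forall>c. lincomb c bs \<in> U' \<longrightarrow> (\<forall>i<length bs. c i = 0))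
      \<and> (\<forall>u\<in>U. \<exists>c. (\<lambda>x. u x - lincomb c bs x) \<in> U')
      \<and> (\<forall>j<length bs. (\<lambda>x. f (bs!j) x - lincomb (\<lambda>i. M i j) bs x) \<in> U')
      \<and> t = (\<Sum>j<length bs. M j j))" for t
  have finI: "finite I" using I by (simp add: quot_basis_def)
  have uniq: "t = (\<Sum>i\<in>I. m i i)" if t: "Q t" for t
  proof -
    obtain bs M where bs: "set bs \<subseteq> U"
      "\<forall>c. lincomb c bs \<in> U' \<longrightarrow> (\<forall>i<length bs. c i = 0)"
      "\<forall>u\<in>U. \<exists>c. (\<lambda>x. u x - lincomb c bs x) \<in> U'"
      "\<forall>j<length bs. (\<lambda>x. f (bs!j) x - lincomb (\<lambda>i. M i j) bs x) \<in> U'"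
      "t = (\<Sum>j<length bs. M j j)"
      using t unfolding Q_def by blast
    have "quot_basis {..<length bs} (\<lambda>i. bs ! i) U U'"
      using bs(1-3) unfolding quot_basis_def lincomb_def by (auto simp: subset_iff)
    moreover have "quot_matrix {..<length bs} (\<lambda>i. bs ! i) f M U'"
      using bs(4) unfolding quot_matrix_def lincomb_def by auto
    ultimately show ?thesis using qtrace_unique[OF I _ _ s f] bs(5) by metis
  qed
  have ex: "Q (\<Sum>i\<in>I. m i i)"
  proof -
    obtain p where p: "bij_betw p {..<card I} I"
      using ex_bij_betw_nat_finite[OF finI] by (metis lessThan_atLeast0)
    define bs where "bs = map (b \<circ> p) [0..<card I]"
    have q: "quot_basis {..<card I} (b \<circ> p) U U'" by (rule quot_basis_reindex[OF I(1) p])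
    have l: "length bs = card I" by (simp add: bs_def)
    have n: "bs ! i = b (p i)" if "i < card I" for i using that by (simp add: bs_def)
    have lc: "lincomb c bs = (\<lambda>x. \<Sum>i\<in>{..<card I}. c i * (b \<circ> p) i x)" for c
      unfolding lincomb_def l by (intro ext sum.cong) (auto simp: n)
    have 4: "(\<lambda>x. f (bs!j) x - lincomb (\<lambda>i. m (p i) (p j)) bs x) \<in> U'" if j: "j < length bs" for j
    proof -
      have pj: "p j \<in> I" using j p l by (auto simp: bij_betw_def)
      have "(\<Sum>i\<in>{..<card I}. m (p i) (p j) * (b \<circ> p) i x) = (\<Sum>i\<in>I. m i (p j) * b i x)" for x
        using sum.reindex_bij_betw[OF p, of "\<lambda>i. m i (p j) * b i x"] by simp
      then show ?thesis unfolding lc using I(2) pj n[of j] j l by (simp add: quot_matrix_def)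
    qed
    have 5: "(\<Sum>i\<in>I. m i i) = (\<Sum>j<length bs. m (p j) (p j))"
      unfolding l using sum.reindex_bij_betw[OF p, of "\<lambda>i. m i i"] by simp
    have 1: "set bs \<subseteq> U" using q unfolding quot_basis_def bs_def by auto
    have 2: "\<forall>c. lincomb c bs \<in> U' \<longrightarrow> (\<forall>i<length bs. c i = 0)"
      unfolding lc l using quot_basis_indep[OF q] by blast
    have 3: "\<forall>u\<in>U. \<exists>c. (\<lambda>x. u x - lincomb c bs x) \<in> U'"
      unfolding lc using quot_basis_span[OF q] by blast
    have four: "\<forall>j<length bs. (\<lambda>x. f (bs!j) x - lincomb (\<lambda>i. m (p i) (p j)) bs x) \<in> U'"
      using 4 by simp
    show ?thesis
      unfolding Q_def
      by (rule exI[of _ bs], rule exI[of _ "\<lambda>i j. m (p i) (p j)"]) (intro conjI 1 2 3 four 5)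
  qed
  have "qtrace f U U' = (SOME t. Q t)" unfolding qtrace_def Q_def ..
  also have "\<dots> = (\<Sum>i\<in>I. m i i)" by (rule some_equality[where P = Q, OF ex uniq])
  finally show ?thesis .
qed

lemma quot_matrix_exists:
  assumes "quot_basis I b U U'" "f ` U \<subseteq> U"
  shows "\<exists>m. quot_matrix I b f m U'"
proof -
  have "\<forall>j\<in>I. \<exists>c. (\<lambda>x. f (b j) x - (\<Sum>i\<in>I. c i * b i x)) \<in> U'"
    using assms unfolding quot_basis_def by blast
  then obtain c where "\<forall>j\<in>I. (\<lambda>x. f (b j) x - (\<Sum>i\<in>I. c j i * b i x)) \<in> U'" by metis
  then have "quot_matrix I b f (\<lambda>i j. c j i) U'" by (simp add: quot_matrix_def)
  then show ?thesis by blast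
qed

text \<open>A subset of the finite spanning set \<open>A\<close> that is independent modulo U' and
  of maximal size; the vectors serve as their own indices.\<close>

lemma quot_basis_exists:
  assumes A: "finite A" "A \<subseteq> V" and s: "csubspace U'"
    and span: "\<And>v. v \<in> V \<Longrightarrow> \<exists>c. (\<lambda>x. v x - (\<Sum>a\<in>A. c a * a x)) \<in> U'"
  shows "\<exists>B. quot_basis B (\<lambda>a. a) V U'"
proof -
  define ind where "ind B \<longleftrightarrow> B \<subseteq> A \<and> (\<forall>c. (\<lambda>x. \<Sum>a\<in>B. c a * a x) \<in> U' \<longrightarrow> (\<forall>a\<in>B. c a = 0))" for B
  have "ind {}" by (simp add: ind_def)
  moreover have "\<forall>B. ind B \<longrightarrow> card B < Suc (card A)"
    using A(1) by (auto simp: ind_def less_Suc_eq_le card_mono)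
  ultimately obtain B where B: "ind B" "\<And>C. ind C \<Longrightarrow> card C \<le> card B"
    using ex_has_greatest_nat[of ind "{}" card "Suc (card A)"] by blast
  have BA: "B \<subseteq> A" and finB: "finite B" using B(1) A finite_subset by (auto simp: ind_def)
  have indB: "c a = 0" if "(\<lambda>x. \<Sum>a\<in>B. c a * a x) \<in> U'" "a \<in> B" for c a
    using B(1) that unfolding ind_def by blast
  have "\<exists>c. (\<lambda>x. a x - (\<Sum>b\<in>B. c b * b x)) \<in> U'" if a: "a \<in> A" for a
  proof (cases "a \<in> B")
    case True
    have "(\<Sum>b\<in>B. (if b = a then 1 else 0) * b x) = a x" for x
      using finB True by (simp add: if_distrib[of "\<lambda>c. c * _"] cong: if_cong)
    then show ?thesis using csubspace_0[OF s] by (intro exI[of _ "\<lambda>b. if b = a then 1 else 0"]) simp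
  next
    case False
    then have "card (insert a B) > card B" using finB by simp
    then have "\<not> ind (insert a B)" using B(2) by (meson leD)
    then obtain c where c: "(\<lambda>x. \<Sum>b\<in>insert a B. c b * b x) \<in> U'" "\<exists>b\<in>insert a B. c b \<noteq> 0"
      using a BA unfolding ind_def by blast
    have sum: "(\<lambda>x. c a * a x + (\<Sum>b\<in>B. c b * b x)) \<in> U'" using c(1) False finB by simp
    have ca: "c a \<noteq> 0"
    proof
      assume "c a = 0"
      then have "(\<lambda>x. \<Sum>b\<in>B. c b * b x) \<in> U'" using sum by simp
      then show False using indB c(2) \<open>c a = 0\<close> by blast
    qed
    have "(\<lambda>x. (1 / c a) * (c a * a x + (\<Sum>b\<in>B. c b * b x))) \<in> U'" by (rule csubspace_scale[OF s sum])
    also have "(\<lambda>x. (1 / c a) * (c a * a x + (\<Sum>b\<in>B. c b * b x))) = (\<lambda>x. a x - (\<Sum>b\<in>B. (- c b / c a) * b x))"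
      using ca by (intro ext) (simp add: distrib_left sum_distrib_left sum_negf algebra_simps)
    finally show ?thesis by (intro exI[of _ "\<lambda>b. - c b / c a"])
  qed
  then have "\<forall>a\<in>A. \<exists>c. (\<lambda>x. a x - (\<Sum>b\<in>B. c b * b x)) \<in> U'" by (rule ballI)
  from bchoice[OF this] obtain d
    where d': "\<forall>a\<in>A. (\<lambda>x. a x - (\<Sum>b\<in>B. d a b * b x)) \<in> U'" ..
  note d = bspec[OF d']
  have "\<exists>c. (\<lambda>x. v x - (\<Sum>b\<in>B. c b * b x)) \<in> U'" if vV: "v \<in> V" for v
  proof -
    obtain c where c: "(\<lambda>x. v x - (\<Sum>a\<in>A. c a * a x)) \<in> U'" using span[OF vV] by blast
    have "(\<lambda>x. \<Sum>a\<in>A. c a * (a x - (\<Sum>b\<in>B. d a b * b x))) \<in> U'" by (rule csubspace_sum[OF s d])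
    from csubspace_add[OF s c this]
    have "(\<lambda>x. v x - (\<Sum>a\<in>A. c a * (\<Sum>b\<in>B. d a b * b x))) \<in> U'"
      by (simp add: right_diff_distrib sum_subtractf)
    moreover have "(\<Sum>a\<in>A. c a * (\<Sum>b\<in>B. d a b * b x)) = (\<Sum>b\<in>B. (\<Sum>a\<in>A. c a * d a b) * b x)" for x
      by (simp add: sum_distrib_left sum_distrib_right) (subst sum.swap, simp add: algebra_simps)
    ultimately show ?thesis by auto
  qed
  then have "quot_basis B (\<lambda>a. a) V U'"
    unfolding quot_basis_def using finB BA A(2) indB by auto
  then show ?thesis by blast
qed

text \<open>The conditions on \<open>T\<close> say that it induces an isomorphism of U/U' onto V/V'
  intertwining f and g. It carries a basis to a basis with the same matrix.\<close>

lemma qtrace_transport: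
  assumes quot_basis: "quot_basis I b U U'" and f: "clin f" "f ` U \<subseteq> U" "f ` U' \<subseteq> U'"
    and s: "csubspace U" "csubspace U'" "csubspace V'"
    and g: "clin g" "g ` V' \<subseteq> V'" and T: "clin T" "T ` U = V" "T ` U' \<subseteq> V'"
      "\<And>u. u \<in> U \<Longrightarrow> T u \<in> V' \<Longrightarrow> u \<in> U'"
    and TT: "\<And>u. T (f u) = g (T u)"
  shows "qtrace f U U' = qtrace g V V'"
proof -
  obtain m where m: "quot_matrix I b f m U'" using quot_matrix_exists[OF quot_basis f(2)] by blast
  have Ts: "T (\<lambda>x. u x - (\<Sum>i\<in>I. c i * b i x)) = (\<lambda>x. T u x - (\<Sum>i\<in>I. c i * T (b i) x))" for u c
    by (simp add: clin_diff[OF T(1)] clin_sum[OF T(1)])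
  have bU: "b i \<in> U" if "i \<in> I" for i using quot_basis that by (auto simp: quot_basis_def)
  have "quot_basis I (\<lambda>i. T (b i)) V V'"
    unfolding quot_basis_def
  proof (intro conjI allI impI ballI)
    show "finite I" "(\<lambda>i. T (b i)) ` I \<subseteq> V" using quot_basis T(2) by (auto simp: quot_basis_def)
  next
    fix c i assume c: "(\<lambda>x. \<Sum>i\<in>I. c i * T (b i) x) \<in> V'" "i \<in> I"
    then have "T (\<lambda>x. \<Sum>i\<in>I. c i * b i x) \<in> V'" by (simp add: clin_sum[OF T(1)])
    moreover have "(\<lambda>x. \<Sum>i\<in>I. c i * b i x) \<in> U" by (rule csubspace_sum[OF s(1) bU])
    ultimately have "(\<lambda>x. \<Sum>i\<in>I. c i * b i x) \<in> U'" by (intro T(4))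
    then show "c i = 0" by (rule quot_basis_indep[OF quot_basis _ c(2)])
  next
    fix v assume "v \<in> V"
    then obtain u where u: "u \<in> U" "v = T u" using T(2) by blast
    then obtain c where "(\<lambda>x. u x - (\<Sum>i\<in>I. c i * b i x)) \<in> U'" using quot_basis_span[OF quot_basis] by blast
    then have "T (\<lambda>x. u x - (\<Sum>i\<in>I. c i * b i x)) \<in> V'" using T(3) by blast
    then show "\<exists>c. (\<lambda>x. v x - (\<Sum>i\<in>I. c i * T (b i) x)) \<in> V'" unfolding Ts u(2) by (intro exI[of _ c])
  qed
  moreover have "quot_matrix I (\<lambda>i. T (b i)) g m V'"
    unfolding quot_matrix_def
  proof
    fix j assume "j \<in> I"
    then have "(\<lambda>x. f (b j) x - (\<Sum>i\<in>I. m i j * b i x)) \<in> U'" using m by (simp add: quot_matrix_def)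
    then have "T (\<lambda>x. f (b j) x - (\<Sum>i\<in>I. m i j * b i x)) \<in> V'" using T(3) by blast
    then show "(\<lambda>x. g (T (b j)) x - (\<Sum>i\<in>I. m i j * T (b i) x)) \<in> V'" unfolding Ts TT .
  qed
  ultimately show ?thesis using qtrace_eqI[OF quot_basis m s(2) f(1,3)] qtrace_eqI[OF _ _ s(3) g] by metis
qed

lemma quot_basis_exists_family:
  assumes A: "finite I" "d ` I \<subseteq> V" and s: "csubspace U'"
    and span: "\<And>v. v \<in> V \<Longrightarrow> \<exists>c. (\<lambda>x. v x - (\<Sum>i\<in>I. c i * d i x)) \<in> U'"
  shows "\<exists>B. quot_basis B (\<lambda>a. a) V U'"
proof (rule quot_basis_exists[OF finite_imageI[OF A(1)] A(2) s])
  fix v assume "v \<in> V"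
  then obtain c where c: "(\<lambda>x. v x - (\<Sum>i\<in>I. c i * d i x)) \<in> U'" using span by blast
  have "(\<Sum>i\<in>I. c i * d i x) = (\<Sum>a\<in>d ` I. (\<Sum>i | i \<in> I \<and> d i = a. c i) * a x)" for x
    unfolding sum.image_gen[OF A(1), of _ d] sum_distrib_right by (intro sum.cong) auto
  then have "(\<lambda>x. v x - (\<Sum>a\<in>d ` I. (\<Sum>i | i \<in> I \<and> d i = a. c i) * a x)) \<in> U'" using c by simp
  then show "\<exists>c. (\<lambda>x. v x - (\<Sum>a\<in>d ` I. c a * a x)) \<in> U'"
    by (intro exI[of _ "\<lambda>a. \<Sum>i | i \<in> I \<and> d i = a. c i"])
qed

text \<open>In a basis adapted to the summands f is a block matrix whose blocks move P to
  \<open>p P\<close>; only the summands mapped to themselves meet the diagonal.\<close>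

lemma qtrace_direct_sum:
  fixes V :: "'p \<Rightarrow> ('x \<Rightarrow> complex) set"
  assumes fin: "finite D" and s: "csubspace U'" and f: "clin f" "f ` U' \<subseteq> U'"
    and sV: "\<And>P. P \<in> D \<Longrightarrow> csubspace (V P)" and VU: "\<And>P. P \<in> D \<Longrightarrow> V P \<subseteq> U"
    and basis: "\<And>P. P \<in> D \<Longrightarrow> \<exists>B. quot_basis B (\<lambda>a. a) (V P) U'"
    and span: "\<And>u. u \<in> U \<Longrightarrow> \<exists>v. (\<forall>P\<in>D. v P \<in> V P) \<and> (\<lambda>x. u x - (\<Sum>P\<in>D. v P x)) \<in> U'"
    and dir: "\<And>v. (\<forall>P\<in>D. v P \<in> V P) \<Longrightarrow> (\<lambda>x. \<Sum>P\<in>D. v P x) \<in> U' \<Longrightarrow> \<forall>P\<in>D. v P \<in> U'"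
    and p: "\<And>P. P \<in> D \<Longrightarrow> p P \<in> D" "\<And>P. P \<in> D \<Longrightarrow> f ` V P \<subseteq> V (p P)"
  shows "qtrace f U U' = (\<Sum>P | P \<in> D \<and> p P = P. qtrace f (V P) U')"
proof -
  obtain B where B: "\<And>P. P \<in> D \<Longrightarrow> quot_basis (B P) (\<lambda>a. a) (V P) U'" using basis by metis
  have finB: "finite (B P)" if "P \<in> D" for P using B[OF that] by (simp add: quot_basis_def)
  have BV: "a \<in> V P" if "P \<in> D" "a \<in> B P" for P a using B[OF that(1)] that(2) by (auto simp: quot_basis_def)
  have "\<exists>c. (\<lambda>x. f a x - (\<Sum>b\<in>B (p P). c b * b x)) \<in> U'" if "P \<in> D" "a \<in> B P" for P a
    using quot_basis_span[OF B[OF p(1)[OF that(1)]]] BV[OF that] p(2)[OF that(1)] by blast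
  then have "\<forall>i\<in>Sigma D B. \<exists>c. (\<lambda>x. f (snd i) x - (\<Sum>b\<in>B (p (fst i)). c b * b x)) \<in> U'"
    by auto
  from bchoice[OF this] obtain m' where m':
    "\<forall>i\<in>Sigma D B. (\<lambda>x. f (snd i) x - (\<Sum>b\<in>B (p (fst i)). m' i b * b x)) \<in> U'" ..
  define m where "m P b a = m' (P, a) b" for P b a
  have m: "(\<lambda>x. f a x - (\<Sum>b\<in>B (p P). m P b a * b x)) \<in> U'" if "P \<in> D" "a \<in> B P" for P a
    using bspec[OF m', of "(P, a)"] that by (simp add: m_def)
  let ?I = "Sigma D B"
  let ?m = "\<lambda>(Q, b) (P, a). if Q = p P then m P b a else 0"
  have sI: "(\<Sum>i\<in>?I. g i) = (\<Sum>P\<in>D. \<Sum>a\<in>B P. g (P, a))" for g :: "_ \<Rightarrow> complex"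
    using sum.Sigma[OF fin, of B "\<lambda>P a. g (P, a)"] finB by simp
  have qbI: "quot_basis ?I snd U U'"
    unfolding quot_basis_def
  proof (intro conjI allI impI ballI)
    show "finite ?I" using fin finB by blast
    show "snd ` ?I \<subseteq> U" using BV VU by fastforce
  next
    fix c i assume c: "(\<lambda>x. \<Sum>i\<in>?I. c i * snd i x) \<in> U'" and i: "i \<in> ?I"
    obtain P a where Pa: "i = (P, a)" "P \<in> D" "a \<in> B P" using i by blast
    let ?v = "\<lambda>P x. \<Sum>a\<in>B P. c (P, a) * a x"
    have "\<forall>P\<in>D. ?v P \<in> V P"
    proof
      fix P assume P: "P \<in> D"
      show "?v P \<in> V P" using csubspace_sum[OF sV[OF P], of "B P" "\<lambda>a. a" "\<lambda>a. c (P, a)"] BV[OF P] by simp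
    qed
    moreover have "(\<lambda>x. \<Sum>P\<in>D. ?v P x) \<in> U'" using c by (simp add: sI)
    ultimately have "?v P \<in> U'" by (rule bspec[OF dir[of ?v] Pa(2)])
    then have "c (P, a) = 0" by (rule quot_basis_indep[OF B[OF Pa(2)] _ Pa(3)])
    then show "c i = 0" using Pa(1) by simp
  next
    fix u assume "u \<in> U"
    then obtain v where v: "\<forall>P\<in>D. v P \<in> V P" "(\<lambda>x. u x - (\<Sum>P\<in>D. v P x)) \<in> U'" using span by blast
    have "\<forall>P\<in>D. \<exists>c. (\<lambda>x. v P x - (\<Sum>a\<in>B P. c a * a x)) \<in> U'" using quot_basis_span[OF B] v(1) by blast
    from bchoice[OF this] obtain c
      where c: "\<forall>P\<in>D. (\<lambda>x. v P x - (\<Sum>a\<in>B P. c P a * a x)) \<in> U'" ..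
    have "(\<lambda>x. \<Sum>P\<in>D. v P x - (\<Sum>a\<in>B P. c P a * a x)) \<in> U'"
      by (rule csubspace_sum1[OF s bspec[OF c]])
    from csubspace_add[OF s v(2) this]
    have "(\<lambda>x. u x - (\<Sum>P\<in>D. \<Sum>a\<in>B P. c P a * a x)) \<in> U'" by (simp add: sum_subtractf)
    then have "(\<lambda>x. u x - (\<Sum>i\<in>?I. c (fst i) (snd i) * snd i x)) \<in> U'" by (simp add: sI)
    then show "\<exists>c. (\<lambda>x. u x - (\<Sum>i\<in>?I. c i * snd i x)) \<in> U'"
      by (intro exI[of _ "\<lambda>i. c (fst i) (snd i)"])
  qed
  have qmI: "quot_matrix ?I snd f ?m U'"
    unfolding quot_matrix_def
  proof
    fix j assume "j \<in> ?I"
    then obtain P a where Pa: "j = (P, a)" "P \<in> D" "a \<in> B P" by blast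
    have "(\<Sum>i\<in>?I. ?m i j * snd i x) = (\<Sum>Q\<in>D. if Q = p P then (\<Sum>b\<in>B Q. m P b a * b x) else 0)" for x
      unfolding sI Pa(1) by (intro sum.cong) auto
    also have "\<dots> x = (\<Sum>b\<in>B (p P). m P b a * b x)" for x using fin p(1)[OF Pa(2)] by simp
    finally show "(\<lambda>x. f (snd j) x - (\<Sum>i\<in>?I. ?m i j * snd i x)) \<in> U'"
      using m[OF Pa(2,3)] Pa(1) by simp
  qed
  have tr: "qtrace f (V P) U' = (\<Sum>a\<in>B P. m P a a)" if P: "P \<in> D" "p P = P" for P
  proof -
    have "quot_matrix (B P) (\<lambda>a. a) f (m P) U'" unfolding quot_matrix_def using m[OF P(1)] P(2) by simp
    then show ?thesis by (rule qtrace_eqI[OF B[OF P(1)] _ s f])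
  qed
  have "qtrace f U U' = (\<Sum>i\<in>?I. ?m i i)" by (rule qtrace_eqI[OF qbI qmI s f])
  also have "\<dots> = (\<Sum>P\<in>D. if p P = P then (\<Sum>a\<in>B P. m P a a) else 0)"
    unfolding sI by (intro sum.cong) auto
  also have "\<dots> = (\<Sum>P | P \<in> D \<and> p P = P. \<Sum>a\<in>B P. m P a a)"
    using fin by (simp add: sum.inter_filter)
  also have "\<dots> = (\<Sum>P | P \<in> D \<and> p P = P. qtrace f (V P) U')"
    by (intro sum.cong) (auto simp: tr)
  finally show ?thesis .
qed


section \<open>Idempotents of the face algebra\<close>

context coxeter_group
begin

definition CW :: "('n rmat \<Rightarrow> complex) set" where
  "CW = {a. \<forall>g. g \<notin> W \<longrightarrow> a g = 0}"

text \<open>Right multiplication by \<open>n\<close> in the group algebra. Values outside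
  \<open>W\<close> are set to zero, because elements of the group algebra are functions on all
  matrices.\<close>

definition act :: "'n rmat \<Rightarrow> ('n rmat \<Rightarrow> complex) \<Rightarrow> 'n rmat \<Rightarrow> complex" where
  "act n a = (\<lambda>g. if g \<in> W then a (g ** matrix_inv n) else 0)"

text \<open>Left multiplication by \<open>x\<^sub>K\<close> is the sum of these operators over all faces of type \<open>K\<close>.\<close>
definition face_op :: "'n rmat set \<Rightarrow> ('n rmat \<Rightarrow> complex) \<Rightarrow> 'n rmat \<Rightarrow> complex" where
  "face_op Z a = (\<lambda>g. if g \<in> W then a (proj Z g) else 0)"

definition conj_set :: "'n rmat set \<Rightarrow> 'n rmat \<Rightarrow> 'n rmat set" where
  "conj_set P w = (\<lambda>u. conjg u w) ` P"

definition faces_of :: "'n rmat set \<Rightarrow> 'n rmat set set" where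
  "faces_of P = {Z\<in>faces. supp Z = P}"

definition faces_typed :: "'n rmat set \<Rightarrow> 'n rmat set set" where
  "faces_typed K = {coset K y | y. y \<in> W}"

text \<open>Uniform weights make these operators compatible with conjugation by W, see
  \<open>avg_act\<close>; the weights reappear in \<open>opL\<close>.\<close>

definition avg :: "'n rmat set \<Rightarrow> ('n rmat \<Rightarrow> complex) \<Rightarrow> 'n rmat \<Rightarrow> complex" where
  "avg P a = (\<lambda>g. \<Sum>Z\<in>faces_of P. (1 / of_nat (card (faces_of P))) * face_op Z a g)"

text \<open>Idempotents of the face semigroup algebra, one for each flat (Saliola's construction).\<close>
function E :: "'n rmat set \<Rightarrow> ('n rmat \<Rightarrow> complex) \<Rightarrow> 'n rmat \<Rightarrow> complex" where
  "E P a = (\<lambda>g. avg P a g - (\<Sum>Q | Q \<in> parabs \<and> Q \<subset> P \<and> finite P. E Q (avg P a) g))"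
  by auto
termination by (relation "Wellfounded.measure (\<lambda>(P, a). card P)") (auto intro: psubset_card_mono)

declare E.simps [simp del]

section \<open>Completeness and triangularity of the idempotents\<close>

lemma parabs_fin: "P \<in> parabs \<Longrightarrow> finite P"
  using parabs_sub finite_W finite_subset by blast

text \<open>Discharges the guard \<open>finite P\<close>, which makes the cardinality of the
  subgroup a termination measure of the recursion.\<close>

lemma E_eq:
  "P \<in> parabs \<Longrightarrow> E P a = (\<lambda>g. avg P a g - (\<Sum>Q | Q \<in> parabs \<and> Q \<subset> P. E Q (avg P a) g))"
  using E.simps[of P a] parabs_fin by simp

lemma parabs_induct [consumes 1, case_names step]:
  assumes "P \<in> parabs" "\<And>P. P \<in> parabs \<Longrightarrow> (\<And>Q. Q \<in> parabs \<Longrightarrow> Q \<subset> P \<Longrightarrow> R Q) \<Longrightarrow> R P"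
  shows "R P"
  using assms(1)
proof (induction "card P" arbitrary: P rule: less_induct)
  case less
  show ?case
    by (rule assms(2)[OF less.prems]) (use less parabs_fin psubset_card_mono in blast)
qed

lemma faces_of_fin: "finite (faces_of P)" and faces_of_faces: "Z \<in> faces_of P \<Longrightarrow> Z \<in> faces" and faces_of_supp: "Z \<in> faces_of P \<Longrightarrow> supp Z = P"
  using faces_finite by (auto simp: faces_of_def)

lemma faces_of_card: "P \<in> parabs \<Longrightarrow> card (faces_of P) \<noteq> 0"
proof -
  assume "P \<in> parabs"
  then obtain Z where "Z \<in> faces_of P" by (rule parabs_supp) (simp add: faces_of_def)
  then show ?thesis using faces_of_fin by auto
qed

lemma clin_face_op: "clin (face_op Z)"
  by (auto simp: clin_def face_op_def)

lemma clin_act: "clin (act n)"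
  by (auto simp: clin_def act_def)

lemma clin_avg: "clin (avg P)"
  unfolding clin_def avg_def
  by (simp add: clin_add[OF clin_face_op] clin_scale[OF clin_face_op] distrib_left sum.distrib sum_distrib_left mult.left_commute)

lemma clin_E: "P \<in> parabs \<Longrightarrow> clin (E P)"
proof (induction rule: parabs_induct)
  case (step P)
  have 1: "E Q (\<lambda>x. u x + v x) = (\<lambda>x. E Q u x + E Q v x)"
    and 2: "E Q (\<lambda>x. c * u x) = (\<lambda>x. c * E Q u x)" if "Q \<in> parabs" "Q \<subset> P" for Q u v c
    using clin_add[OF step(2)[OF that]] clin_scale[OF step(2)[OF that]] by auto
  show ?case
    unfolding clin_def E_eq[OF step(1)]
    by (simp add: clin_add[OF clin_avg] clin_scale[OF clin_avg] 1 2 sum.distrib sum_distrib_left algebra_simps)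
qed

lemma face_op_CW: "face_op Z a \<in> CW"
  by (simp add: CW_def face_op_def)

lemma csubspace_CW: "csubspace CW"
  by (simp add: csubspace_def CW_def)

lemma avg_CW: "avg P a \<in> CW"
  unfolding avg_def by (rule csubspace_sum[OF csubspace_CW face_op_CW])

lemma E_CW: "P \<in> parabs \<Longrightarrow> E P a \<in> CW"
proof (induction arbitrary: a rule: parabs_induct)
  case (step P)
  have "E Q b g = 0" if "Q \<in> parabs" "Q \<subset> P" "g \<notin> W" for Q b g
    using step(2)[OF that(1,2), of b] that(3) unfolding CW_def by blast
  then show ?case using avg_CW[of P a] unfolding CW_def E_eq[OF step(1)] by simp
qed

text \<open>The operators act by precomposition, so the order of composition is opposite to that of
  the product of faces.\<close>

lemma TT: "Z \<in> faces \<Longrightarrow> Z' \<in> faces \<Longrightarrow> face_op Z' (face_op Z a) = face_op (prodf Z Z') a"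
  by (auto simp: face_op_def proj_W proj_prodf)

text \<open>The relation ZZ' = Z for faces with equal support: sides of the walls through Z are not
  changed by projecting to Z' beforehand.\<close>

lemma TT_same:
  assumes "Z \<in> faces" "Z' \<in> faces" "supp Z' = supp Z"
  shows "face_op Z' (face_op Z a) = face_op Z a"
proof -
  have "proj Z (proj Z' g) = proj Z g" if g: "g \<in> W" for g
  proof (rule sym, rule proj_eqI[OF assms(1) g])
    show "proj Z (proj Z' g) \<in> Z" by (rule proj_in[OF assms(1) proj_W[OF assms(2) g]])
    show "M (proj Z (proj Z' g)) \<inter> supp Z = M g \<inter> supp Z"
      using proj_M[OF assms(1) proj_W[OF assms(2) g]] proj_M[OF assms(2) g] assms(3) by simp
  qed
  then show ?thesis using assms by (auto simp: face_op_def proj_W)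
qed

lemma avg_face_op:
  assumes "Z \<in> faces" shows "avg (supp Z) (face_op Z a) = face_op Z a"
proof -
  have "face_op Z' (face_op Z a) = face_op Z a" if "Z' \<in> faces_of (supp Z)" for Z'
    using TT_same[OF assms faces_of_faces[OF that] faces_of_supp[OF that]] .
  then show ?thesis
    using faces_of_card[OF supp_parabs[OF assms]] by (simp add: avg_def)
qed

lemma avg_idem:
  assumes "P \<in> parabs" shows "avg P (avg P a) = avg P a"
proof -
  have "avg P (face_op Z a) = face_op Z a" if "Z \<in> faces_of P" for Z
    using avg_face_op[OF faces_of_faces[OF that]] faces_of_supp[OF that] by simp
  moreover have "avg P (avg P a) = (\<lambda>g. \<Sum>Z\<in>faces_of P. (1 / of_nat (card (faces_of P))) * avg P (face_op Z a) g)"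
    using clin_sum[OF clin_avg, of P "\<lambda>_. 1 / of_nat (card (faces_of P))" "\<lambda>Z. face_op Z a" "faces_of P"]
    unfolding avg_def[of P a] .
  ultimately show ?thesis unfolding avg_def[of P a] by simp
qed

lemma E_avg: "P \<in> parabs \<Longrightarrow> E P (avg P a) = E P a"
  by (simp add: E_eq avg_idem)

text \<open>The recursion for \<open>E\<close> at the support of Z, solved for its first term, which
  \<open>avg\<close> leaves unchanged. For the face W, which is the identity of the semigroup, this
  becomes completeness.\<close>

lemma E_face_op_sum:
  assumes Z: "Z \<in> faces"
  shows "(\<Sum>R | R \<in> parabs \<and> R \<subseteq> supp Z. E R (face_op Z a) g) = face_op Z a g"
proof -
  have P: "supp Z \<in> parabs" by (rule supp_parabs[OF Z])
  have "{R. R \<in> parabs \<and> R \<subseteq> supp Z} = insert (supp Z) {R. R \<in> parabs \<and> R \<subset> supp Z}"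
    using P by auto
  then have "(\<Sum>R | R \<in> parabs \<and> R \<subseteq> supp Z. E R (face_op Z a) g)
    = E (supp Z) (face_op Z a) g + (\<Sum>R | R \<in> parabs \<and> R \<subset> supp Z. E R (face_op Z a) g)"
    using parabs_finite by simp
  also have "\<dots> = face_op Z a g" by (simp add: E_eq[OF P] avg_face_op[OF Z])
  finally show ?thesis .
qed

lemma E_avg_sum:
  assumes "R \<in> parabs"
  shows "E R (avg Q b) = (\<lambda>g. \<Sum>Z\<in>faces_of Q. (1 / of_nat (card (faces_of Q))) * E R (face_op Z b) g)"
  using clin_sum[OF clin_E[OF assms], of "\<lambda>_. 1 / of_nat (card (faces_of Q))" "\<lambda>Z. face_op Z b" "faces_of Q"]
  unfolding avg_def[of Q b] .

text \<open>Averaging over the faces of Q turns the projection onto Z into projections onto products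
  with support properly inside Q. On these the idempotents below Q already add up to the identity,
  by induction and \<open>E_face_op_sum\<close>, so the two terms of the recursion for
  \<open>E Q\<close> cancel.\<close>

lemma E_face_op_zero:
  assumes "Q \<in> parabs" "Z \<in> faces" "\<not> Q \<subseteq> supp Z"
  shows "E Q (face_op Z a) = (\<lambda>_. 0)"
  using assms
proof (induction arbitrary: Z rule: parabs_induct)
  case (step Q)
  let ?k = "1 / of_nat (card (faces_of Q)) :: complex"
  have T: "face_op Z' (face_op Z a) = face_op (prodf Z Z') a" if "Z' \<in> faces_of Q" for Z'
    by (rule TT[OF step(3) faces_of_faces[OF that]])
  have H: "(\<Sum>R | R \<in> parabs \<and> R \<subset> Q. E R (face_op H a) g) = face_op H a g"
    if "Z' \<in> faces_of Q" "H = prodf Z Z'" for H Z' g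
  proof -
    have H: "H \<in> faces" "supp H = supp Z \<inter> Q"
      using prodf_face[OF step(3) faces_of_faces[OF that(1)]] faces_of_supp[OF that(1)] that(2) by auto
    have sub: "supp H \<subset> Q" using H(2) step(4) by blast
    have "(\<Sum>R | R \<in> parabs \<and> R \<subset> Q. E R (face_op H a) g) = (\<Sum>R | R \<in> parabs \<and> R \<subseteq> supp H. E R (face_op H a) g)"
    proof (rule sum.mono_neutral_right)
      show "finite {R \<in> parabs. R \<subset> Q}" using parabs_finite by simp
      show "{R \<in> parabs. R \<subseteq> supp H} \<subseteq> {R \<in> parabs. R \<subset> Q}" using sub by blast
      show "\<forall>R\<in>{R \<in> parabs. R \<subset> Q} - {R \<in> parabs. R \<subseteq> supp H}. E R (face_op H a) g = 0"
        using step(2)[OF _ _ H(1)] by simp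
    qed
    then show ?thesis using E_face_op_sum[OF H(1)] by simp
  qed
  have "E Q (face_op Z a) g = 0" for g
  proof -
    have "(\<Sum>R | R \<in> parabs \<and> R \<subset> Q. E R (avg Q (face_op Z a)) g)
      = (\<Sum>R | R \<in> parabs \<and> R \<subset> Q. \<Sum>Z'\<in>faces_of Q. ?k * E R (face_op (prodf Z Z') a) g)"
      by (intro sum.cong refl) (simp add: E_avg_sum T)
    also have "\<dots> = (\<Sum>Z'\<in>faces_of Q. ?k * (\<Sum>R | R \<in> parabs \<and> R \<subset> Q. E R (face_op (prodf Z Z') a) g))"
      by (subst sum.swap) (simp add: sum_distrib_left)
    also have "\<dots> = (\<Sum>Z'\<in>faces_of Q. ?k * face_op (prodf Z Z') a g)"
      by (intro sum.cong refl) (simp add: H)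
    also have "\<dots> = avg Q (face_op Z a) g" unfolding avg_def by (simp add: T)
    finally show ?thesis by (simp add: E_eq[OF step(1)])
  qed
  then show ?case by blast
qed

lemma E_E_zero:
  assumes "P \<in> parabs" "Q \<in> parabs" "\<not> Q \<subseteq> P"
  shows "E Q (E P a) = (\<lambda>_. 0)"
  using assms
proof (induction arbitrary: a rule: parabs_induct)
  case (step P)
  have 0: "E Q (E R b) = (\<lambda>_. 0)" if "R \<in> parabs" "R \<subset> P" for R b
    using step(2)[OF that step(3)] step(4) that by blast
  have "E Q (E P a) = (\<lambda>g. E Q (avg P a) g - (\<Sum>R | R \<in> parabs \<and> R \<subset> P. E Q (E R (avg P a)) g))"
    unfolding E_eq[OF step(1)] clin_diff[OF clin_E[OF step(3)]] clin_sum1[OF clin_E[OF step(3)]] ..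
  moreover have "E Q (face_op Z a) = (\<lambda>_. 0)" if "Z \<in> faces_of P" for Z
    using E_face_op_zero[OF step(3) faces_of_faces[OF that]] faces_of_supp[OF that] step(4) by simp
  ultimately show ?case by (simp add: 0 E_avg_sum[OF step(3)])
qed

lemma E_idem:
  assumes P: "P \<in> parabs" shows "E P (E P a) = E P a"
proof -
  have "E P (E P a) = (\<lambda>g. E P (avg P a) g - (\<Sum>R | R \<in> parabs \<and> R \<subset> P. E P (E R (avg P a)) g))"
    unfolding E_eq[OF P, of a] clin_diff[OF clin_E[OF P]] clin_sum1[OF clin_E[OF P]] ..
  moreover have "E P (E R b) = (\<lambda>_. 0)" if "R \<in> parabs" "R \<subset> P" for R b
    using E_E_zero[OF that(1) P] that(2) by blast
  ultimately show ?thesis by (simp add: E_avg[OF P])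
qed

lemma W_face: "W \<in> faces" "supp W = W"
proof -
  have "coset S (mat 1) = W" by (simp add: coset_def W_gen[symmetric])
  then show "W \<in> faces" using facesI[of S "mat 1"] by simp
  show "supp W = W" using supp_coset[of S "mat 1"] \<open>coset S (mat 1) = W\<close> par_one[of S] by (simp add: W_gen[symmetric])
qed

lemma E_sum:
  assumes "a \<in> CW" shows "(\<Sum>P\<in>parabs. E P a g) = a g"
proof -
  have "face_op W a = a" using assms proj_id[OF W_face(1)] by (auto simp: face_op_def CW_def)
  moreover have "{R. R \<in> parabs \<and> R \<subseteq> W} = parabs" using parabs_sub by blast
  ultimately show ?thesis using E_face_op_sum[OF W_face(1), of a g] W_face(2) by simp
qed

text \<open>Apply \<open>E P\<close> for a P of largest order whose summand does not vanish. Every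
  other nonzero summand belongs to a subgroup not containing P and is killed by
  \<open>E_E_zero\<close>.\<close>

lemma E_direct:
  assumes v: "\<forall>P\<in>parabs. v P \<in> range (E P)" and s: "(\<lambda>g. \<Sum>P\<in>parabs. v P g) = (\<lambda>_. 0)"
  shows "\<forall>P\<in>parabs. v P = (\<lambda>_. 0)"
proof (rule ccontr)
  assume "\<not> ?thesis"
  then obtain P0 where P0: "P0 \<in> parabs \<and> v P0 \<noteq> (\<lambda>_. 0)" by blast
  have "\<forall>P. P \<in> parabs \<and> v P \<noteq> (\<lambda>_. 0) \<longrightarrow> card P < Suc (card W)"
    using parabs_sub finite_W by (simp add: less_Suc_eq_le card_mono)
  then obtain P where P: "P \<in> parabs" "v P \<noteq> (\<lambda>_. 0)"
    and max: "\<And>Q. Q \<in> parabs \<Longrightarrow> v Q \<noteq> (\<lambda>_. 0) \<Longrightarrow> card Q \<le> card P"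
    using ex_has_greatest_nat[where P = "\<lambda>P. P \<in> parabs \<and> v P \<noteq> (\<lambda>_. 0)" and f = card, OF P0] by blast
  have z: "E P (v Q) = (\<lambda>_. 0)" if Q: "Q \<in> parabs" "Q \<noteq> P" for Q
  proof (cases "v Q = (\<lambda>_. 0)")
    case True
    then show ?thesis by (simp add: clin_zero[OF clin_E[OF P(1)]])
  next
    case False
    then have "\<not> P \<subset> Q" using max[OF Q(1)] parabs_fin[OF Q(1)] psubset_card_mono by (metis leD)
    then have "\<not> P \<subseteq> Q" using Q(2) by blast
    moreover obtain a where "v Q = E Q a" using v Q(1) by blast
    ultimately show ?thesis using E_E_zero[OF Q(1) P(1)] by simp
  qed
  have "E P (\<lambda>g. \<Sum>Q\<in>parabs. v Q g) = (\<lambda>g. \<Sum>Q\<in>parabs. E P (v Q) g)"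
    by (rule clin_sum1[OF clin_E[OF P(1)]])
  also have "\<dots> = (\<lambda>g. E P (v P) g)"
  proof
    fix g
    have "(\<Sum>Q\<in>parabs. E P (v Q) g) = (\<Sum>Q\<in>{P}. E P (v Q) g)"
      using P(1) z by (intro sum.mono_neutral_right parabs_finite) auto
    then show "(\<Sum>Q\<in>parabs. E P (v Q) g) = E P (v P) g" by simp
  qed
  finally have "E P (v P) = (\<lambda>_. 0)" unfolding s clin_zero[OF clin_E[OF P(1)]] by simp
  moreover obtain a where "v P = E P a" using v P(1) by blast
  ultimately show False using P(2) E_idem[OF P(1)] by simp
qed

section \<open>Equivariance of the idempotents\<close>

lemma conj_set_parabs: "P \<in> parabs \<Longrightarrow> w \<in> W \<Longrightarrow> conj_set P w \<in> parabs"
  unfolding conj_set_def by (rule parabs_conj)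

lemma conj_set_inv_l [simp]: "w \<in> W \<Longrightarrow> conj_set (conj_set P (matrix_inv w)) w = P"
  and conj_set_inv_r [simp]: "w \<in> W \<Longrightarrow> conj_set (conj_set P w) (matrix_inv w) = P"
  by (auto simp: conj_set_def image_image)

lemma conj_set_mono: "w \<in> W \<Longrightarrow> conj_set P w \<subset> conj_set Q w \<longleftrightarrow> P \<subset> Q"
proof -
  assume w: "w \<in> W"
  have "inj (\<lambda>u. conjg u w)" using conjg_inj[OF w] by (simp add: inj_def)
  then show ?thesis unfolding conj_set_def less_le_not_le by (simp add: inj_image_subset_iff)
qed

lemma conj_set_bij:
  assumes w: "w \<in> W" and P: "P \<in> parabs"
  shows "bij_betw (\<lambda>Q. conj_set Q w) {Q. Q \<in> parabs \<and> Q \<subset> P} {Q. Q \<in> parabs \<and> Q \<subset> conj_set P w}"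
proof (rule bij_betw_byWitness[where f' = "\<lambda>Q. conj_set Q (matrix_inv w)"])
  have "conj_set Q (matrix_inv w) \<subset> P" if "Q \<subset> conj_set P w" for Q
    using conj_set_mono[OF w, of "conj_set Q (matrix_inv w)" P] that w by simp
  then show "(\<lambda>Q. conj_set Q (matrix_inv w)) ` {Q. Q \<in> parabs \<and> Q \<subset> conj_set P w} \<subseteq> {Q. Q \<in> parabs \<and> Q \<subset> P}"
    using w conj_set_parabs by auto
  show "(\<lambda>Q. conj_set Q w) ` {Q. Q \<in> parabs \<and> Q \<subset> P} \<subseteq> {Q. Q \<in> parabs \<and> Q \<subset> conj_set P w}"
    using w conj_set_parabs by (simp add: image_subset_iff conj_set_mono[OF w])
qed (use w in simp_all)

definition rt :: "'n rmat set \<Rightarrow> 'n rmat \<Rightarrow> 'n rmat set" where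
  "rt Z w = (\<lambda>z. z ** w) ` Z"

lemma rt_inv: "w \<in> W \<Longrightarrow> rt (rt Z w) (matrix_inv w) = Z" "w \<in> W \<Longrightarrow> rt (rt Z (matrix_inv w)) w = Z"
  by (auto simp: rt_def image_image mm)

lemma rt_face: "Z \<in> faces \<Longrightarrow> w \<in> W \<Longrightarrow> rt Z w \<in> faces"
  and rt_supp: "Z \<in> faces \<Longrightarrow> w \<in> W \<Longrightarrow> supp (rt Z w) = conj_set (supp Z) w"
  unfolding rt_def conj_set_def by (simp_all add: face_mult supp_mult)

lemma faces_of_bij: 
  assumes "w \<in> W" shows "bij_betw (\<lambda>Z. rt Z w) (faces_of P) (faces_of (conj_set P w))"
proof (rule bij_betw_byWitness[where f' = "\<lambda>Z. rt Z (matrix_inv w)"])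
  show "(\<lambda>Z. rt Z w) ` faces_of P \<subseteq> faces_of (conj_set P w)" using assms by (auto simp: faces_of_def rt_face rt_supp)
  show "(\<lambda>Z. rt Z (matrix_inv w)) ` faces_of (conj_set P w) \<subseteq> faces_of P"
    using assms by (auto simp: faces_of_def rt_face rt_supp)
qed (use assms in \<open>auto simp: rt_inv\<close>)

lemma face_op_act:
  assumes "Z \<in> faces" "w \<in> W"
  shows "face_op (rt Z w) (act w a) = act w (face_op Z a)"
proof
  fix g
  have "proj (rt Z w) g = proj Z (g ** matrix_inv w) ** w" if "g \<in> W"
    using proj_mult[OF assms(1), of "g ** matrix_inv w" w] assms(2) that unfolding rt_def by (simp add: mm)
  then show "face_op (rt Z w) (act w a) g = act w (face_op Z a) g"
    using assms by (simp add: face_op_def act_def proj_W mm)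
qed

lemma avg_act:
  assumes w: "w \<in> W" shows "avg (conj_set P w) (act w a) = act w (avg P a)"
proof -
  let ?k = "1 / of_nat (card (faces_of P)) :: complex"
  have c: "card (faces_of (conj_set P w)) = card (faces_of P)" using bij_betw_same_card[OF faces_of_bij[OF w]] by simp
  have "avg (conj_set P w) (act w a) = (\<lambda>g. \<Sum>Z\<in>faces_of P. ?k * face_op (rt Z w) (act w a) g)"
    unfolding avg_def c by (subst sum.reindex_bij_betw[OF faces_of_bij[OF w, of P], symmetric]) simp
  also have "\<dots> = (\<lambda>g. \<Sum>Z\<in>faces_of P. ?k * act w (face_op Z a) g)"
    by (intro ext sum.cong refl) (simp add: face_op_act w faces_of_faces)
  also have "\<dots> = act w (avg P a)"
    unfolding avg_def clin_sum[OF clin_act] ..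
  finally show ?thesis .
qed

lemma E_act:
  assumes "P \<in> parabs" "w \<in> W"
  shows "E (conj_set P w) (act w a) = act w (E P a)"
  using assms(1)
proof (induction arbitrary: a rule: parabs_induct)
  case (step P)
  have "E (conj_set P w) (act w a)
    = (\<lambda>g. avg (conj_set P w) (act w a) g - (\<Sum>Q | Q \<in> parabs \<and> Q \<subset> conj_set P w. E Q (avg (conj_set P w) (act w a)) g))"
    by (rule E_eq[OF conj_set_parabs[OF step(1) assms(2)]])
  also have "\<dots> = (\<lambda>g. act w (avg P a) g - (\<Sum>Q | Q \<in> parabs \<and> Q \<subset> P. E (conj_set Q w) (act w (avg P a)) g))"
    unfolding avg_act[OF assms(2)]
    by (subst sum.reindex_bij_betw[OF conj_set_bij[OF assms(2) step(1)], symmetric]) simp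
  also have "\<dots> = (\<lambda>g. act w (avg P a) g - (\<Sum>Q | Q \<in> parabs \<and> Q \<subset> P. act w (E Q (avg P a)) g))"
    using step(2) by (intro ext arg_cong2[where f = minus] sum.cong refl) simp
  also have "\<dots> = act w (E P a)"
    unfolding E_eq[OF step(1)] clin_diff[OF clin_act] clin_sum1[OF clin_act] ..
  finally show ?case .
qed


section \<open>Faces of a fixed type and the coefficients m_KL\<close>

lemma faces_typed_faces: "K \<subseteq> S \<Longrightarrow> Z \<in> faces_typed K \<Longrightarrow> Z \<in> faces"
  by (auto simp: faces_typed_def)

lemma faces_typed_fin: "finite (faces_typed K)"
  unfolding faces_typed_def using finite_W by (simp add: setcompr_eq_image)

lemma gen_coset: "gen L = coset L (mat 1)" if "L \<subseteq> S"
  using gen_sub[OF that] by (auto simp: coset_def)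

lemma gen_face: "L \<subseteq> S \<Longrightarrow> gen L \<in> faces" "L \<subseteq> S \<Longrightarrow> supp (gen L) = gen L" "L \<subseteq> S \<Longrightarrow> gen L \<in> faces_typed L"
  using facesI[of L "mat 1"] supp_coset[of L "mat 1"] par_one[of L] gen_coset[of L]
  by (auto simp: faces_typed_def)

text \<open>For a fixed chamber \<open>g\<close>, a face Z of type K corresponds to the minimal
  representative \<open>proj Z g ** matrix_inv g\<close>. The right side is the value at
  \<open>g\<close> of left multiplication by x_K.\<close>

lemma sum_faces_typed:
  assumes K: "K \<subseteq> S" and g: "g \<in> W"
  shows "(\<Sum>Z\<in>faces_typed K. face_op Z a g) = (\<Sum>x\<in>Xset W S K. a (x ** g))"
proof (rule sum.reindex_bij_witness[where i = "\<lambda>x. coset K (x ** g)" and j = "\<lambda>Z. proj Z g ** matrix_inv g"])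
  fix Z assume Z: "Z \<in> faces_typed K"
  then obtain y where y: "y \<in> W" "Z = coset K y" by (auto simp: faces_typed_def)
  have Zf: "Z \<in> faces" by (rule faces_typed_faces[OF K Z])
  have h: "proj Z g \<in> W" "proj Z g \<in> Z" using proj_W proj_in Zf g by auto
  show "proj Z g ** matrix_inv g \<in> Xset W S K"
    using proj_iff_Xset[OF K y(1), of "proj Z g" g] h(2) g unfolding y(2) by simp
  show "coset K (proj Z g ** matrix_inv g ** g) = Z"
    using coset_eq[OF K y(1), of "proj Z g"] h g unfolding y(2) by (simp add: mm)
  show "a (proj Z g ** matrix_inv g ** g) = face_op Z a g" using g by (simp add: face_op_def mm)
next
  fix x assume x: "x \<in> Xset W S K"
  then have xW: "x \<in> W" by (simp add: Xset_def)
  then show "coset K (x ** g) \<in> faces_typed K" using g by (auto simp: faces_typed_def)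
  have "proj (coset K (x ** g)) g = x ** g"
    using proj_iff_Xset[OF K, of "x ** g" "x ** g" g] x xW g by (simp add: mm)
  then show "proj (coset K (x ** g)) g ** matrix_inv g = x" using xW g by (simp add: mm)
qed

lemma xel_face_op:
  assumes K: "K \<subseteq> S"
  shows "xel W S K g = (\<Sum>Z\<in>faces_typed K. face_op Z (delta (mat 1)) g)"
proof (cases "g \<in> W")
  case True
  have X: "x \<in> W" if "x \<in> Xset W S K" for x using that by (simp add: Xset_def)
  have "Xset W S K \<subseteq> W" by (rule subsetI) (rule X)
  then have fin: "finite (Xset W S K)" using finite_W by (rule finite_subset)
  have "x ** g = mat 1 \<longleftrightarrow> x = matrix_inv g" if "x \<in> Xset W S K" for x
    using W_right_cancel[of "matrix_inv g" "x ** g" "mat 1"] True by (simp add: mm)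
  then have "(\<Sum>x\<in>Xset W S K. delta (mat 1) (x ** g)) = (\<Sum>x\<in>Xset W S K. if x = matrix_inv g then 1 else 0)"
    by (intro sum.cong) (auto simp: delta_def)
  also have "\<dots> = (if matrix_inv g \<in> Xset W S K then 1 else 0)" using fin by simp
  also have "matrix_inv g \<in> Xset W S K \<longleftrightarrow> g \<in> matrix_inv ` Xset W S K"
  proof
    assume "matrix_inv g \<in> Xset W S K"
    then have "matrix_inv (matrix_inv g) \<in> matrix_inv ` Xset W S K" by (rule imageI)
    then show "g \<in> matrix_inv ` Xset W S K" using True by simp
  next
    assume "g \<in> matrix_inv ` Xset W S K"
    then obtain x where "x \<in> Xset W S K" "g = matrix_inv x" by (rule imageE)
    then show "matrix_inv g \<in> Xset W S K" using X by simp
  qed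
  finally show ?thesis by (simp add: sum_faces_typed[OF K True] xel_def)
next
  case False
  have "g \<notin> matrix_inv ` Xset W S K" using False by (auto simp: Xset_def)
  then show ?thesis using False by (simp add: xel_def face_op_def)
qed

definition ftype :: "'n rmat set \<Rightarrow> 'n rmat set" where
  "ftype H = {s\<in>S. \<forall>h\<in>H. s ** h \<in> H}"

lemma ftype_coset:
  assumes L: "L \<subseteq> S" and h: "h \<in> W"
  shows "ftype (coset L h) = L"
proof
  show "ftype (coset L h) \<subseteq> L"
  proof
    fix s assume s: "s \<in> ftype (coset L h)"
    then have "s ** h \<in> coset L h" using h by (simp add: ftype_def)
    then have "s \<in> gen L" using h by (simp add: coset_def mm)
    then show "s \<in> L" using S_gen[OF L] s by (simp add: ftype_def)
  qed
  show "L \<subseteq> ftype (coset L h)"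
    using L gen_mult[OF gen_base] by (auto simp: ftype_def coset_def mm subset_iff)
qed

lemma ftype_sub: "ftype H \<subseteq> S"
  by (auto simp: ftype_def)

lemma face_ftype: "H \<in> faces \<Longrightarrow> h \<in> H \<Longrightarrow> H = coset (ftype H) h"
  by (elim faces_E) (metis coset_eq ftype_coset)

lemma coset_sub_iff:
  assumes "K \<subseteq> S" "L \<subseteq> S" "h \<in> W"
  shows "coset L h \<subseteq> coset K h \<longleftrightarrow> L \<subseteq> K"
proof
  assume s: "coset L h \<subseteq> coset K h"
  show "L \<subseteq> K"
  proof
    fix x assume x: "x \<in> L"
    then have "x ** h \<in> coset L h" using assms by (intro coset_I gen_base)
    then have "x ** h \<in> coset K h" using s by blast
    then have "x \<in> gen K" using assms(3) by (simp add: coset_def mm)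
    then show "x \<in> K" using S_gen[OF assms(1)] x assms(2) by blast
  qed
next
  assume "L \<subseteq> K"
  then show "coset L h \<subseteq> coset K h" using gen_mono by (auto simp: coset_def)
qed

lemma prodf_one:
  assumes K: "K \<subseteq> S" and L: "L \<subseteq> K" and G: "G \<in> faces" "supp G = gen L" and z: "z \<in> G" "matrix_inv z \<in> Xset W S K"
  shows "prodf (gen K) G = gen L"
proof -
  have zW: "z \<in> W" using z G face_sub by blast
  have LS: "L \<subseteq> S" using K L by blast
  have "proj (gen K) z = mat 1"
    using proj_iff_Xset[OF K, of "mat 1" "mat 1" z] z(2) zW gen_coset[OF K] by simp
  then have 1: "mat 1 \<in> prodf (gen K) G" unfolding prodf_def using z(1) by force
  let ?B = "prodf (gen K) G"
  have B: "?B \<in> faces" "supp ?B = gen L"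
    using prodf_face[OF gen_face(1)[OF K] G(1)] gen_face(2)[OF K] G(2) gen_mono[OF L] by auto
  have "?B = coset (ftype ?B) (mat 1)" by (rule face_ftype[OF B(1) 1])
  then have e: "?B = gen (ftype ?B)" using gen_coset[OF ftype_sub] by metis
  then have "gen (ftype ?B) = gen L" using B(2) gen_face(2)[OF ftype_sub] by metis
  then show ?thesis using e by simp
qed

lemma Xset_mono: "L \<subseteq> K \<Longrightarrow> Xset W S K \<subseteq> Xset W S L"
  by (auto simp: Xset_def)

text \<open>The counted faces are the left cosets x^(-1) W_L with x in X_K and X_L^sharp. The
  condition on X_L^sharp says that such a coset is a face, of type L^x; it then has support W_L. The
  condition on X_K says that its chamber x^(-1) projects to 1 on the face W_K.\<close>

lemma card_prodf_gen:
  assumes K: "K \<subseteq> S" and L: "L \<subseteq> K"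
  shows "card {G\<in>faces. supp G \<subseteq> gen K \<and> prodf (gen K) G = gen L} = mcoef W S K L"
proof -
  have LS: "L \<subseteq> S" using K L by blast
  let ?A = "{G\<in>faces. supp G \<subseteq> gen K \<and> prodf (gen K) G = gen L}"
  let ?X = "Xset W S K \<inter> Xsharp W S L"
  define G where "G x = (\<lambda>u. matrix_inv x ** u) ` gen L" for x :: "'n rmat"
  have XW: "x \<in> W" if "x \<in> Xset W S K" for x K using that by (simp add: Xset_def)
  have Gx: "G x = coset ((\<lambda>s. conjg s x) ` L) (matrix_inv x)" "(\<lambda>s. conjg s x) ` L \<subseteq> S" "supp (G x) = gen L"
    if x: "x \<in> Xsharp W S L" for x
  proof -
    have xW: "x \<in> W" using x XW by (auto simp: Xsharp_def)
    show sub: "(\<lambda>s. conjg s x) ` L \<subseteq> S" using x by (simp add: Xsharp_def)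
    have gc: "gen ((\<lambda>s. conjg s x) ` L) = (\<lambda>u. conjg u x) ` gen L" by (rule gen_conj[OF xW LS])
    have mem: "v \<in> (\<lambda>u. conjg u x) ` gen L \<longleftrightarrow> x ** (v ** matrix_inv x) \<in> gen L" if "v \<in> W" for v
    proof -
      have "conjg (x ** (v ** matrix_inv x)) x = v" using xW that by (simp add: conjg_def mm)
      then show ?thesis using conjg_inj[OF xW] by (metis image_iff)
    qed
    show "G x = coset ((\<lambda>s. conjg s x) ` L) (matrix_inv x)"
    proof (intro set_eqI iffI)
      fix z assume "z \<in> G x"
      then obtain u where u: "u \<in> gen L" "z = matrix_inv x ** u" unfolding G_def by blast
      have "u \<in> W" by (rule subsetD[OF gen_sub[OF LS] u(1)])
      then show "z \<in> coset ((\<lambda>s. conjg s x) ` L) (matrix_inv x)"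
        using u xW by (simp add: coset_def gc mem mm)
    next
      fix z assume "z \<in> coset ((\<lambda>s. conjg s x) ` L) (matrix_inv x)"
      then have "z \<in> W" "z ** x \<in> (\<lambda>u. conjg u x) ` gen L" using xW by (simp_all add: coset_def gc)
      then have "z \<in> W" "x ** z \<in> gen L" using mem[of "z ** x"] xW by (simp_all add: mm)
      moreover have "z = matrix_inv x ** (x ** z)" using xW by simp
      ultimately show "z \<in> G x" unfolding G_def by blast
    qed
    then have "supp (G x) = par ((\<lambda>s. conjg s x) ` L) (matrix_inv x)"
      using supp_coset[OF sub, of "matrix_inv x"] xW by simp
    also have "\<dots> = gen L"
    proof -
      have "matrix_inv x ** (w ** x) \<in> (\<lambda>u. conjg u x) ` gen L \<longleftrightarrow> w \<in> gen L" if "w \<in> W" for w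
        using mem[of "matrix_inv x ** (w ** x)"] that xW by (simp add: mm)
      then have "w \<in> par ((\<lambda>s. conjg s x) ` L) (matrix_inv x) \<longleftrightarrow> w \<in> W \<and> w \<in> gen L" for w
        unfolding par_def gc W_cancel(5)[OF xW] mem_Collect_eq by (rule conj_cong[OF refl])
      then show ?thesis using gen_sub[OF LS] by blast
    qed
    finally show "supp (G x) = gen L" .
  qed
  have "bij_betw G ?X ?A"
    unfolding bij_betw_def
  proof
    show "inj_on G ?X"
    proof (rule inj_onI)
      fix x y assume xy: "x \<in> ?X" "y \<in> ?X" "G x = G y"
      have X: "x \<in> W" "y \<in> W" "x \<in> Xset W S L" "y \<in> Xset W S L" using xy XW by (auto simp: Xsharp_def)
      have "matrix_inv x \<in> G x" unfolding G_def by (rule image_eqI[of _ _ "mat 1"]) simp_all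
      then have "matrix_inv x \<in> G y" unfolding xy(3) .
      then obtain u where u: "u \<in> gen L" "matrix_inv x = matrix_inv y ** u" unfolding G_def by blast
      have uW: "u \<in> W" by (rule subsetD[OF gen_sub[OF LS] u(1)])
      have "matrix_inv (matrix_inv x) = matrix_inv (matrix_inv y ** u)" by (rule arg_cong[OF u(2)])
      then have "x = matrix_inv u ** y" using X uW by simp
      then have "x \<in> coset L y" using gen_inv[OF u(1) LS] X uW by (simp add: coset_def mm)
      then have "proj (coset L y) (mat 1) = x" "proj (coset L y) (mat 1) = y"
        using proj_iff_Xset[OF LS X(2), of _ "mat 1"] X by simp_all
      then show "x = y" by simp
    qed
    show "G ` ?X = ?A"
    proof
      show "G ` ?X \<subseteq> ?A"
      proof
        fix H assume "H \<in> G ` ?X"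
        then obtain x where x: "x \<in> Xset W S K" "x \<in> Xsharp W S L" "H = G x" by blast
        have xW: "x \<in> W" using x XW by blast
        have f: "G x \<in> faces" using Gx(1,2)[OF x(2)] xW by simp
        have "matrix_inv x \<in> G x" unfolding G_def by (rule image_eqI[of _ _ "mat 1"]) simp_all
        then have "prodf (gen K) (G x) = gen L" using prodf_one[OF K L f Gx(3)[OF x(2)]] x xW by simp
        then show "H \<in> ?A" using f Gx(3)[OF x(2)] x(3) gen_mono[OF L] by simp
      qed
      show "?A \<subseteq> G ` ?X"
      proof
        fix H assume "H \<in> ?A"
        then have H: "H \<in> faces" "supp H \<subseteq> gen K" "prodf (gen K) H = gen L" by auto
        have sH: "supp H = gen L"
          using prodf_face(2)[OF gen_face(1)[OF K] H(1)] H(2,3) gen_face(2)[OF K] gen_face(2)[OF LS] by auto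
        have "mat 1 \<in> prodf (gen K) H" using H(3) by simp
        then obtain z where z: "z \<in> H" "proj (gen K) z = mat 1" unfolding prodf_def by force
        have zW: "z \<in> W" using z H face_sub by blast
        let ?x = "matrix_inv z"
        have xK: "?x \<in> Xset W S K"
          using proj_iff_Xset[OF K, of "mat 1" "mat 1" z] z(2) zW gen_coset[OF K] by simp
        then have xL: "?x \<in> Xset W S L" using Xset_mono[OF L] by blast
        then have Mz: "M z \<inter> gen L = {}" using Xset_iff[OF LS] by (simp add: M_def)
        let ?L = "ftype H"
        have Hc: "H = coset ?L z" by (rule face_ftype[OF H(1) z(1)])
        have sp: "par ?L z = gen L" using supp_coset[OF ftype_sub zW, of H] Hc sH by simp
        \<comment> \<open>This recovers the condition on X_L^sharp from the face H. The reflection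
          \<open>conjg r z\<close> lies in W_L, and comparing it with the chamber
          \<open>r ** z\<close> of H adjacent to \<open>z\<close> shows that its own wall is its
          only inversion; hence it is simple.\<close>
        have toL: "conjg r z \<in> L" if r: "r \<in> ?L" for r
        proof -
          have rS: "r \<in> S" using r ftype_sub by blast
          let ?t = "conjg r z"
          have tL: "?t \<in> gen L"
            unfolding sp[symmetric] par_def using zW rS gen_base[OF r] by (simp add: conjg_def mm)
          have tT: "?t \<in> T" using rS zW T_I by simp
          have tW: "?t \<in> W" using tT T_W by blast
          have p1: "proj H (mat 1) = z"
            by (rule proj_eqI[OF H(1) W_one z(1)]) (simp add: sH Mz)
          have "proj H (mat 1 ** ?t) = z ** ?t"
            using proj_supp_mult[OF H(1) W_one, of ?t] tL sH p1 by simp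
          moreover have "z ** ?t = r ** z" using zW by (simp add: conjg_def mm)
          ultimately have "proj H ?t = r ** z" by simp
          then have e: "M (r ** z) \<inter> gen L = M ?t \<inter> gen L"
            using proj_M[OF H(1) tW] sH by simp
          have Mt: "M ?t \<subseteq> gen L" unfolding M_def T_inv[OF tT] by (rule N_gen[OF tL LS])
          have "q \<in> M (r ** z) \<longleftrightarrow> (q \<in> M z) \<noteq> (q = ?t)" if "q \<in> T" for q
          proof -
            have "conjg q (matrix_inv z) \<in> M r \<longleftrightarrow> conjg q (matrix_inv z) = r"
              using N_S[OF rS] by (simp add: M_def S_inv[OF rS])
            also have "\<dots> \<longleftrightarrow> q = ?t" using zW by (metis conjg_inv_l conjg_inv_r)
            finally show ?thesis using M_mult[of r z q] rS zW that by simp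
          qed
          then have "M ?t = {?t}" using e Mz Mt tL M_sub tT by blast
          then have "N ?t = {?t}" unfolding M_def T_inv[OF tT] .
          then have "?t \<in> S" by (rule N_eq_one(2)[OF tW])
          then show ?thesis using S_gen[OF LS] tL by blast
        qed
        have toH: "conjg s ?x \<in> S" if s: "s \<in> L" for s
        proof -
          let ?C = "(\<lambda>r. conjg r z) ` ?L"
          have C: "?C \<subseteq> S" using toL LS by blast
          have "s \<in> gen L" using gen_base[OF s] .
          then have "z ** (s ** matrix_inv z) \<in> gen ?L" unfolding sp[symmetric] par_def by simp
          then have "conjg s ?x \<in> gen ?L" using zW by (simp add: conjg_def mm)
          then have "s \<in> (\<lambda>u. conjg u z) ` gen ?L" using zW by (metis conjg_inv_l image_eqI)
          then have "s \<in> gen ?C" using gen_conj[OF zW ftype_sub] by simp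
          then have "s \<in> ?C" using S_gen[OF C] s LS by blast
          then obtain r where r: "r \<in> ?L" "s = conjg r z" by (rule imageE)
          then have "conjg s ?x = r" using zW by simp
          then show ?thesis using subsetD[OF ftype_sub r(1)] by simp
        qed
        have "?x \<in> ?X" using xK xL toH by (auto simp: Xsharp_def)
        moreover have "H = G ?x"
        proof (intro set_eqI iffI)
          fix h assume h: "h \<in> H"
          then have hW: "h \<in> W" using H face_sub by blast
          have "h ** matrix_inv z \<in> gen ?L" using h Hc by (auto simp: coset_def)
          then have "matrix_inv z ** h \<in> par ?L z" using zW hW by (simp add: par_def mm)
          then have "matrix_inv z ** h \<in> gen L" using sp by simp
          then have "z ** (matrix_inv z ** h) \<in> G ?x" unfolding G_def W_cancel(5)[OF zW] by (rule imageI)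
          then show "h \<in> G ?x" using zW by simp
        next
          fix h assume "h \<in> G ?x"
          then obtain u where u: "u \<in> gen L" "h = z ** u" unfolding G_def using zW by auto
          then have "(\<lambda>z. z ** u) ` H = H" using sH unfolding supp_def by blast
          moreover have "z ** u \<in> (\<lambda>z. z ** u) ` H" by (rule imageI[OF z(1)])
          ultimately show "h \<in> H" using u(2) by simp
        qed
        ultimately show "H \<in> G ` ?X" by blast
      qed
    qed
  qed
  then have "card ?X = card ?A" by (rule bij_betw_same_card)
  then show ?thesis using L by (simp add: mcoef_def)
qed

lemma prodf_rt:
  assumes "Z \<in> faces" "G \<in> faces" "w \<in> W"
  shows "prodf (rt Z w) (rt G w) = rt (prodf Z G) w"
proof -
  have "proj (rt Z w) (g ** w) = proj Z g ** w" if "g \<in> G" for g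
    using proj_mult[OF assms(1) _ assms(3)] that face_sub[OF assms(2)] unfolding rt_def by blast
  then show ?thesis unfolding prodf_def rt_def image_image by (intro image_cong) auto
qed

lemma coset_rt: "K \<subseteq> S \<Longrightarrow> h \<in> W \<Longrightarrow> coset K h = rt (gen K) h"
  using coset_mult[of "mat 1" h K] gen_coset[of K] by (simp add: rt_def)

lemma conj_set_sub: "w \<in> W \<Longrightarrow> conj_set P w \<subseteq> conj_set Q w \<longleftrightarrow> P \<subseteq> Q"
proof -
  assume w: "w \<in> W"
  have "inj (\<lambda>u. conjg u w)" using conjg_inj[OF w] by (simp add: inj_def)
  then show ?thesis unfolding conj_set_def by (simp add: inj_image_subset_iff)
qed

lemma rt_eq: "w \<in> W \<Longrightarrow> rt Z w = rt Z' w \<longleftrightarrow> Z = Z'"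
  using rt_inv(1) by metis

lemma card_prodf:
  assumes K: "K \<subseteq> S" and L: "L \<subseteq> K" and h: "h \<in> W"
  shows "card {G\<in>faces. supp G \<subseteq> supp (coset K h) \<and> prodf (coset K h) G = coset L h} = mcoef W S K L"
proof -
  have LS: "L \<subseteq> S" using K L by blast
  let ?A = "{G\<in>faces. supp G \<subseteq> gen K \<and> prodf (gen K) G = gen L}"
  let ?B = "{G\<in>faces. supp G \<subseteq> supp (coset K h) \<and> prodf (coset K h) G = coset L h}"
  have iff: "rt G h \<in> ?B \<longleftrightarrow> G \<in> ?A" if G: "G \<in> faces" for G
  proof -
    have "supp (rt G h) \<subseteq> supp (coset K h) \<longleftrightarrow> supp G \<subseteq> gen K"
      unfolding coset_rt[OF K h] rt_supp[OF G h] rt_supp[OF gen_face(1)[OF K] h] conj_set_sub[OF h] gen_face(2)[OF K] ..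
    moreover have "prodf (coset K h) (rt G h) = coset L h \<longleftrightarrow> prodf (gen K) G = gen L"
      unfolding coset_rt[OF K h] coset_rt[OF LS h] prodf_rt[OF gen_face(1)[OF K] G h] rt_eq[OF h] ..
    ultimately show ?thesis using G rt_face[OF G h] by simp
  qed
  have "bij_betw (\<lambda>G. rt G h) ?A ?B"
  proof (rule bij_betw_byWitness[where f' = "\<lambda>G. rt G (matrix_inv h)"])
    show "(\<lambda>G. rt G h) ` ?A \<subseteq> ?B" using iff by blast
    show "(\<lambda>G. rt G (matrix_inv h)) ` ?B \<subseteq> ?A"
    proof
      fix G assume "G \<in> (\<lambda>G. rt G (matrix_inv h)) ` ?B"
      then obtain H where H: "H \<in> ?B" "G = rt H (matrix_inv h)" by blast
      then have "G \<in> faces" "rt G h = H" using h by (auto simp: rt_face rt_inv)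
      then show "G \<in> ?A" using iff[of G] H(1) by simp
    qed
  qed (use h in \<open>auto simp: rt_inv\<close>)
  then have "card ?A = card ?B" by (rule bij_betw_same_card)
  then show ?thesis using card_prodf_gen[OF K L] by simp
qed

text \<open>Left multiplication by e_L, as \<open>eel_eq\<close> and \<open>opL_gmult\<close> show.
  By \<open>E_avg\<close> each \<open>E P\<close> splits into contributions of the faces with
  support P; this operator collects, over all P, those of the faces of type L.\<close>

definition opL :: "'n rmat set \<Rightarrow> ('n rmat \<Rightarrow> complex) \<Rightarrow> 'n rmat \<Rightarrow> complex" where
  "opL L a = (\<lambda>g. \<Sum>Z\<in>faces_typed L. (1 / of_nat (card (faces_of (supp Z)))) * E (supp Z) (face_op Z a) g)"

text \<open>The defining relation of the e_L as an identity of operators. Each projection onto a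
  face Z of type K is expanded by idempotents, these by faces G, and the composite depends on G only
  through ZG. The number of G with a given product is supplied by \<open>card_prodf\<close>.\<close>

lemma sum_faces_typed_opL:
  assumes K: "K \<subseteq> S"
  shows "(\<Sum>Z\<in>faces_typed K. face_op Z a g) = (\<Sum>L\<in>Pow S. of_nat (mcoef W S K L) * opL L a g)"
proof -
  define \<phi> where "\<phi> H = (1 / of_nat (card (faces_of (supp H)))) * E (supp H) (face_op H a) g" for H
  have step: "face_op Z a g = (\<Sum>H | H \<in> faces \<and> H \<subseteq> Z. of_nat (mcoef W S K (ftype H)) * \<phi> H)"
    if ZK: "Z \<in> faces_typed K" for Z
  proof -
    have Z: "Z \<in> faces" by (rule faces_typed_faces[OF K ZK])
    obtain y where y: "y \<in> W" "Z = coset K y" using ZK by (auto simp: faces_typed_def)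
    let ?G = "{G. G \<in> faces \<and> supp G \<subseteq> supp Z}"
    have finG: "finite ?G" using faces_finite by simp
    have ER: "E R (face_op Z a) g = (\<Sum>G\<in>faces_of R. \<phi> (prodf Z G))" if R: "R \<in> parabs" "R \<subseteq> supp Z" for R
    proof -
      have "E R (face_op Z a) g = E R (avg R (face_op Z a)) g" by (simp add: E_avg[OF R(1)])
      also have "\<dots> = (\<Sum>G\<in>faces_of R. (1 / of_nat (card (faces_of R))) * E R (face_op G (face_op Z a)) g)"
        by (simp add: E_avg_sum[OF R(1)])
      also have "\<dots> = (\<Sum>G\<in>faces_of R. \<phi> (prodf Z G))"
      proof (rule sum.cong[OF refl])
        fix G assume G: "G \<in> faces_of R"
        have "supp (prodf Z G) = R" using prodf_face(2)[OF Z faces_of_faces[OF G]] faces_of_supp[OF G] R(2) by blast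
        then show "(1 / of_nat (card (faces_of R))) * E R (face_op G (face_op Z a)) g = \<phi> (prodf Z G)"
          using TT[OF Z faces_of_faces[OF G]] by (simp add: \<phi>_def)
      qed
      finally show ?thesis .
    qed
    have "face_op Z a g = (\<Sum>R | R \<in> parabs \<and> R \<subseteq> supp Z. E R (face_op Z a) g)"
      by (rule E_face_op_sum[OF Z, symmetric])
    also have "\<dots> = (\<Sum>R | R \<in> parabs \<and> R \<subseteq> supp Z. \<Sum>G | G \<in> ?G \<and> supp G = R. \<phi> (prodf Z G))"
    proof (rule sum.cong[OF refl])
      fix R assume R: "R \<in> {R. R \<in> parabs \<and> R \<subseteq> supp Z}"
      then have "faces_of R = {G. G \<in> ?G \<and> supp G = R}" by (auto simp: faces_of_def)
      then show "E R (face_op Z a) g = (\<Sum>G | G \<in> ?G \<and> supp G = R. \<phi> (prodf Z G))" using ER R by simp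
    qed
    also have "\<dots> = (\<Sum>G\<in>?G. \<phi> (prodf Z G))"
      using parabs_finite supp_parabs by (intro sum.group[OF finG]) auto
    \<comment> \<open>The sum was ungrouped from supports to single faces G; now it is regrouped by
      the product ZG, on which the summand alone depends.\<close>
    also have "\<dots> = (\<Sum>H | H \<in> faces \<and> H \<subseteq> Z. \<Sum>G | G \<in> ?G \<and> prodf Z G = H. \<phi> (prodf Z G))"
      using faces_finite prodf_face(1)[OF Z] prodf_sub[OF Z] by (intro sum.group[OF finG, symmetric]) auto
    also have "\<dots> = (\<Sum>H | H \<in> faces \<and> H \<subseteq> Z. of_nat (mcoef W S K (ftype H)) * \<phi> H)"
    proof (rule sum.cong[OF refl])
      fix H assume "H \<in> {H. H \<in> faces \<and> H \<subseteq> Z}"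
      then have H: "H \<in> faces" "H \<subseteq> Z" by auto
      obtain h where h: "h \<in> H" using face_nonempty[OF H(1)] by blast
      have hW: "h \<in> W" using h H face_sub by blast
      have Hc: "H = coset (ftype H) h" by (rule face_ftype[OF H(1) h])
      have Zc: "Z = coset K h" using coset_eq[OF K y(1)] h H(2) y(2) by blast
      have "ftype H \<subseteq> K" using coset_sub_iff[OF K ftype_sub hW] Hc Zc H(2) by metis
      from card_prodf[OF K this hW]
      have "card {G. G \<in> ?G \<and> prodf Z G = H} = mcoef W S K (ftype H)"
        unfolding Hc[symmetric] Zc[symmetric] by (simp add: conj_assoc)
      moreover have "(\<Sum>G | G \<in> ?G \<and> prodf Z G = H. \<phi> (prodf Z G)) = (\<Sum>G | G \<in> ?G \<and> prodf Z G = H. \<phi> H)"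
        by (intro sum.cong) auto
      ultimately show "(\<Sum>G | G \<in> ?G \<and> prodf Z G = H. \<phi> (prodf Z G)) = of_nat (mcoef W S K (ftype H)) * \<phi> H"
        by simp
    qed
    finally show ?thesis .
  qed
  let ?P = "Sigma (faces_typed K) (\<lambda>Z. {H. H \<in> faces \<and> H \<subseteq> Z})"
  let ?Q = "Sigma (Pow K) faces_typed"
  have finPK: "finite (Pow K)" using K finite_S finite_subset by blast
  have someH: "(SOME h. h \<in> H) \<in> H" if "H \<in> faces" for H
    using face_nonempty[OF that] some_in_eq by blast
  have "(\<Sum>Z\<in>faces_typed K. face_op Z a g) = (\<Sum>Z\<in>faces_typed K. \<Sum>H | H \<in> faces \<and> H \<subseteq> Z. of_nat (mcoef W S K (ftype H)) * \<phi> H)"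
    by (rule sum.cong[OF refl step])
  also have "\<dots> = (\<Sum>(Z, H)\<in>?P. of_nat (mcoef W S K (ftype H)) * \<phi> H)"
    using faces_finite by (intro sum.Sigma faces_typed_fin) auto
  \<comment> \<open>A face H of type L with L \<subseteq> K lies in exactly one face of type K, the
    coset of any of its chambers. The pairs (Z, H) are therefore determined by H.\<close>
  also have "\<dots> = (\<Sum>(L, H)\<in>?Q. of_nat (mcoef W S K L) * \<phi> H)"
  proof (rule sum.reindex_bij_witness[where i = "\<lambda>(L, H). (coset K (SOME h. h \<in> H), H)"
        and j = "\<lambda>(Z, H). (ftype H, H)"])
    fix X assume "X \<in> ?P"
    then obtain Z H where X: "X = (Z, H)" "Z \<in> faces_typed K" "H \<in> faces" "H \<subseteq> Z" by blast
    obtain y where y: "y \<in> W" "Z = coset K y" using X by (auto simp: faces_typed_def)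
    let ?h = "SOME h. h \<in> H"
    have h: "?h \<in> H" by (rule someH[OF X(3)])
    have hW: "?h \<in> W" using h X face_sub by blast
    have Zc: "Z = coset K ?h" using coset_eq[OF K y(1)] h X(4) y(2) by blast
    then show "(\<lambda>(L, H). (coset K (SOME h. h \<in> H), H)) ((\<lambda>(Z, H). (ftype H, H)) X) = X" using X(1) by simp
    have Hc: "H = coset (ftype H) ?h" by (rule face_ftype[OF X(3) h])
    have "ftype H \<subseteq> K" using coset_sub_iff[OF K ftype_sub hW] Hc Zc X(4) by metis
    moreover have "H \<in> faces_typed (ftype H)" unfolding faces_typed_def using Hc hW by blast
    ultimately show "(\<lambda>(Z, H). (ftype H, H)) X \<in> ?Q" using X(1) by simp
    show "(case (\<lambda>(Z, H). (ftype H, H)) X of (L, H) \<Rightarrow> of_nat (mcoef W S K L) * \<phi> H)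
        = (case X of (Z, H) \<Rightarrow> of_nat (mcoef W S K (ftype H)) * \<phi> H)" using X(1) by simp
  next
    fix Y assume "Y \<in> ?Q"
    then obtain L H where Y: "Y = (L, H)" "L \<subseteq> K" "H \<in> faces_typed L" by blast
    have LS: "L \<subseteq> S" using Y K by blast
    obtain y where y: "y \<in> W" "H = coset L y" using Y by (auto simp: faces_typed_def)
    have Hf: "H \<in> faces" by (rule faces_typed_faces[OF LS Y(3)])
    let ?h = "SOME h. h \<in> H"
    have h: "?h \<in> H" by (rule someH[OF Hf])
    have hW: "?h \<in> W" using h Hf face_sub by blast
    have tH: "ftype H = L" using ftype_coset[OF LS y(1)] y(2) by simp
    then show "(\<lambda>(Z, H). (ftype H, H)) ((\<lambda>(L, H). (coset K (SOME h. h \<in> H), H)) Y) = Y" using Y(1) by simp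
    have "H = coset L ?h" using face_ftype[OF Hf h] tH by simp
    then have "H \<subseteq> coset K ?h" using coset_sub_iff[OF K LS hW] Y(2) by metis
    moreover have "coset K ?h \<in> faces_typed K" unfolding faces_typed_def using hW by blast
    ultimately show "(\<lambda>(L, H). (coset K (SOME h. h \<in> H), H)) Y \<in> ?P" using Y(1) Hf by simp
  qed
  also have "\<dots> = (\<Sum>L\<in>Pow K. \<Sum>H\<in>faces_typed L. of_nat (mcoef W S K L) * \<phi> H)"
    by (rule sum.Sigma[symmetric, OF finPK]) (simp add: faces_typed_fin)
  also have "\<dots> = (\<Sum>L\<in>Pow K. of_nat (mcoef W S K L) * opL L a g)"
    by (simp add: opL_def \<phi>_def sum_distrib_left)
  also have "\<dots> = (\<Sum>L\<in>Pow S. of_nat (mcoef W S K L) * opL L a g)"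
    using K finite_S by (intro sum.mono_neutral_left) (auto simp: mcoef_def)
  finally show ?thesis .
qed


section \<open>Identification of Solomon's elements\<close>

lemma clin_opL:
  assumes L: "L \<subseteq> S" shows "clin (opL L)"
proof -
  have c: "clin (E (supp Z))" if "Z \<in> faces_typed L" for Z
    using clin_E[OF supp_parabs[OF faces_typed_faces[OF L that]]] .
  show ?thesis
    unfolding clin_def opL_def
    by (simp add: clin_add[OF clin_face_op] clin_scale[OF clin_face_op] clin_add[OF c] clin_scale[OF c]
        distrib_left sum.distrib sum_distrib_left mult.left_commute add_divide_distrib)
qed

lemma rt_faces_typed:
  assumes w: "w \<in> W" shows "bij_betw (\<lambda>Z. rt Z w) (faces_typed L) (faces_typed L)"
proof (rule bij_betw_byWitness[where f' = "\<lambda>Z. rt Z (matrix_inv w)"])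
  have "rt Z v \<in> faces_typed L" if v: "v \<in> W" and Z: "Z \<in> faces_typed L" for Z v
  proof -
    obtain y where y: "y \<in> W" "Z = coset L y" using Z unfolding faces_typed_def by blast
    have "rt Z v = coset L (y ** v)" unfolding y(2) rt_def by (rule coset_mult[OF y(1) v])
    then show ?thesis unfolding faces_typed_def using y(1) v W_mult by blast
  qed
  then show "(\<lambda>Z. rt Z w) ` faces_typed L \<subseteq> faces_typed L" "(\<lambda>Z. rt Z (matrix_inv w)) ` faces_typed L \<subseteq> faces_typed L"
    using w by (simp_all add: image_subset_iff)
qed (use w in \<open>simp_all add: rt_inv\<close>)

lemma opL_act:
  assumes L: "L \<subseteq> S" and w: "w \<in> W"
  shows "opL L (act w a) = act w (opL L a)"
proof -
  have c: "card (faces_of (conj_set P w)) = card (faces_of P)" for P using bij_betw_same_card[OF faces_of_bij[OF w]] by simp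
  have "opL L (act w a) = (\<lambda>g. \<Sum>Z\<in>faces_typed L. (1 / of_nat (card (faces_of (supp (rt Z w))))) * E (supp (rt Z w)) (face_op (rt Z w) (act w a)) g)"
    unfolding opL_def by (subst sum.reindex_bij_betw[OF rt_faces_typed[OF w, of L], symmetric]) simp
  also have "\<dots> = (\<lambda>g. \<Sum>Z\<in>faces_typed L. (1 / of_nat (card (faces_of (supp Z)))) * act w (E (supp Z) (face_op Z a)) g)"
  proof (intro ext sum.cong refl)
    fix g Z assume "Z \<in> faces_typed L"
    then have Z: "Z \<in> faces" by (rule faces_typed_faces[OF L])
    show "(1 / of_nat (card (faces_of (supp (rt Z w))))) * E (supp (rt Z w)) (face_op (rt Z w) (act w a)) g
        = (1 / of_nat (card (faces_of (supp Z)))) * act w (E (supp Z) (face_op Z a)) g"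
      unfolding rt_supp[OF Z w] c face_op_act[OF Z w] E_act[OF supp_parabs[OF Z] w] ..
  qed
  also have "\<dots> = act w (opL L a)" unfolding opL_def clin_sum[OF clin_act] ..
  finally show ?thesis .
qed

lemma act_delta:
  assumes "w \<in> W" shows "act w (delta (mat 1)) = delta w"
proof
  fix g
  have "g ** matrix_inv w = mat 1 \<longleftrightarrow> g = w" if "g \<in> W"
    using W_right_cancel[OF assms, of "g ** matrix_inv w" "mat 1"] assms by (simp add: mm)
  then show "act w (delta (mat 1)) g = delta w g" using assms by (auto simp: act_def delta_def)
qed

lemma CW_expand:
  assumes "a \<in> CW" shows "a = (\<lambda>g. \<Sum>w\<in>W. a w * delta w g)"
proof
  fix g
  have "(\<Sum>w\<in>W. a w * delta w g) = (\<Sum>w\<in>W. if w = g then a w else 0)"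
    by (intro sum.cong) (auto simp: delta_def)
  then show "a g = (\<Sum>w\<in>W. a w * delta w g)" using finite_W assms by (simp add: CW_def)
qed

text \<open>A linear operator that commutes with right translations is left multiplication by its
  value at the unit.\<close>

lemma opL_gmult:
  assumes L: "L \<subseteq> S" and a: "a \<in> CW"
  shows "gmult W (opL L (delta (mat 1))) a = opL L a"
proof
  fix g
  let ?F = "opL L (delta (mat 1))"
  have "opL L a = opL L (\<lambda>g. \<Sum>w\<in>W. a w * delta w g)" using CW_expand[OF a] by simp
  also have "\<dots> = (\<lambda>g. \<Sum>w\<in>W. a w * opL L (delta w) g)" by (rule clin_sum[OF clin_opL[OF L]])
  also have "\<dots> = (\<lambda>g. \<Sum>w\<in>W. a w * act w ?F g)"
    by (intro ext sum.cong refl) (simp add: opL_act[OF L, symmetric] act_delta)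
  finally have e: "opL L a g = (\<Sum>w\<in>W. a w * act w ?F g)" by simp
  show "gmult W ?F a g = opL L a g"
  proof (cases "g \<in> W")
    case True
    have "(\<Sum>w\<in>W. a w * act w ?F g) = (\<Sum>h\<in>W. ?F h * a (matrix_inv h ** g))"
      by (rule sum.reindex_bij_witness[where i = "\<lambda>h. matrix_inv h ** g" and j = "\<lambda>w. g ** matrix_inv w"])
        (use True in \<open>simp_all add: act_def mm\<close>)
    then show ?thesis unfolding e gmult_def by simp
  next
    case False
    have "a (matrix_inv h ** g) = 0" if h: "h \<in> W" for h
    proof -
      have "matrix_inv h ** g \<notin> W"
      proof
        assume "matrix_inv h ** g \<in> W"
        then have "h ** (matrix_inv h ** g) \<in> W" by (rule W_mult[OF h])
        then show False using False h by simp
      qed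
      then show ?thesis using a by (simp add: CW_def)
    qed
    then show ?thesis unfolding e gmult_def using False by (simp add: act_def)
  qed
qed

lemma mcoef_diag:
  assumes L: "L \<subseteq> S" shows "mcoef W S L L \<noteq> 0"
proof -
  have "Xset W S L \<inter> Xsharp W S L \<subseteq> W" by (auto simp: Xset_def)
  then have f: "finite (Xset W S L \<inter> Xsharp W S L)" using finite_W by (rule finite_subset)
  have "mat 1 \<in> Xset W S L" using Xset_iff[OF L] by simp
  then have "mat 1 \<in> Xset W S L \<inter> Xsharp W S L" using L by (simp add: Xsharp_def)
  then show ?thesis using f by (auto simp: mcoef_def)
qed

text \<open>The definite description needs uniqueness: the system is triangular for inclusion with
  nonzero diagonal entries \<open>mcoef_diag\<close>, so two solutions agree by induction on the
  size of K.\<close>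

lemma eel_eq:
  assumes L: "L \<subseteq> S" shows "eel W S L = opL L (delta (mat 1))"
proof -
  let ?Q = "\<lambda>e. (\<forall>K. K \<subseteq> S \<longrightarrow> xel W S K = (\<lambda>g. \<Sum>L\<in>Pow S. of_nat (mcoef W S K L) * e L g))
     \<and> (\<forall>L. \<not> L \<subseteq> S \<longrightarrow> e L = (\<lambda>_. 0))"
  define e where "e L = (if L \<subseteq> S then opL L (delta (mat 1)) else (\<lambda>_. 0))" for L
  have eQ: "?Q e"
  proof (intro conjI allI impI)
    fix K assume K: "K \<subseteq> S"
    have "(\<Sum>L\<in>Pow S. of_nat (mcoef W S K L) * e L g)
      = (\<Sum>L\<in>Pow S. of_nat (mcoef W S K L) * opL L (delta (mat 1)) g)" for g
      by (intro sum.cong refl) (simp add: e_def)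
    then show "xel W S K = (\<lambda>g. \<Sum>L\<in>Pow S. of_nat (mcoef W S K L) * e L g)"
      using xel_face_op[OF K] sum_faces_typed_opL[OF K] by auto
  qed (simp add: e_def)
  have "e' = e" if e': "?Q e'" for e'
  proof
    fix K show "e' K = e K"
    proof (cases "K \<subseteq> S")
      case True
      then show ?thesis
      proof (induction "card K" arbitrary: K rule: less_induct)
        case less
        have IH: "e' L = e L" if "L \<in> Pow S - {K}" "mcoef W S K L \<noteq> 0" for L
        proof -
          have "L \<subset> K" using that by (auto simp: mcoef_def split: if_splits)
          moreover have "finite K" using less.prems finite_S finite_subset by blast
          ultimately have "card L < card K" by (simp add: psubset_card_mono)
          then show ?thesis using less.hyps that by simp
        qed
        show ?case
        proof
          fix g :: "'n rmat"
          let ?r = "\<lambda>e. \<Sum>L\<in>Pow S - {K}. of_nat (mcoef W S K L) * e L g"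
          have split: "(\<Sum>L\<in>Pow S. of_nat (mcoef W S K L) * e L g) = of_nat (mcoef W S K K) * e K g + ?r e" for e :: "_ \<Rightarrow> _ \<Rightarrow> complex"
            using finite_S less.prems by (simp add: sum.remove)
          have "(\<Sum>L\<in>Pow S. of_nat (mcoef W S K L) * e' L g) = (\<Sum>L\<in>Pow S. of_nat (mcoef W S K L) * e L g)"
            using fun_cong[OF trans[OF e'[THEN conjunct1, rule_format, OF less.prems, symmetric]
                  eQ[THEN conjunct1, rule_format, OF less.prems]], of g] .
          moreover have "?r e' = ?r e"
          proof (intro sum.cong refl)
            fix L assume "L \<in> Pow S - {K}"
            then show "of_nat (mcoef W S K L) * e' L g = of_nat (mcoef W S K L) * e L g"
              using IH by (cases "mcoef W S K L = 0") auto
          qed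
          ultimately show "e' K g = e K g" unfolding split using mcoef_diag[OF less.prems] by simp
        qed
      qed
    qed (use e' eQ in simp)
  qed
  then have "eel W S = e" unfolding eel_def using eQ by (intro the_equality)
  then show ?thesis using L by (simp add: e_def)
qed

lemma face_op_gen_restrict:
  assumes "Z \<in> faces"
  shows "face_op Z (\<lambda>g. if g \<in> Z then a g else 0) = face_op Z a"
  using proj_in[OF assms] by (auto simp: face_op_def)

text \<open>On functions supported on W_L only one face of type L contributes, namely W_L itself,
  since all others are disjoint cosets. Conversely an average over faces with support W_L is
  determined by its values on the chambers of the face W_L.\<close>

lemma eCWL_eq:
  assumes L: "L \<subseteq> S" shows "eCWL W S L = range (E (gen L))"
proof -
  have P: "gen L \<in> parabs" by (rule gen_parabs[OF L])
  let ?k = "1 / of_nat (card (faces_of (gen L))) :: complex"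
  have k: "?k \<noteq> 0" using faces_of_card[OF P] by simp
  have op: "opL L a = (\<lambda>g. ?k * E (gen L) (face_op (gen L) a) g)" if a: "\<forall>g. g \<notin> gen L \<longrightarrow> a g = 0" for a
  proof
    fix g
    have "face_op Z a = (\<lambda>_. 0)" if Z: "Z \<in> faces_typed L" "Z \<noteq> gen L" for Z
    proof -
      obtain y where y: "y \<in> W" "Z = coset L y" using Z by (auto simp: faces_typed_def)
      have "h \<notin> gen L" if h: "h \<in> Z" for h
      proof
        assume hL: "h \<in> gen L"
        then have "coset L h = gen L" using coset_eq[OF L W_one, of h] gen_coset[OF L] by simp
        moreover have "coset L h = Z" using coset_eq[OF L y(1)] h y(2) by simp
        ultimately show False using Z(2) by simp
      qed
      then show ?thesis using a proj_in[OF faces_typed_faces[OF L Z(1)]] by (auto simp: face_op_def)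
    qed
    moreover have "E (supp Z) (\<lambda>_. 0) = (\<lambda>_. 0)" if "Z \<in> faces_typed L" for Z
      by (rule clin_zero[OF clin_E[OF supp_parabs[OF faces_typed_faces[OF L that]]]])
    ultimately have "opL L a g = (\<Sum>Z\<in>{gen L}. (1 / of_nat (card (faces_of (supp Z)))) * E (supp Z) (face_op Z a) g)"
      unfolding opL_def using gen_face(3)[OF L] by (intro sum.mono_neutral_right faces_typed_fin) auto
    then show "opL L a g = ?k * E (gen L) (face_op (gen L) a) g" using gen_face(2)[OF L] by simp
  qed
  have CWa: "a \<in> CW" if "\<forall>g. g \<notin> gen L \<longrightarrow> a g = 0" for a
    using that gen_sub[OF L] by (auto simp: CW_def)
  show ?thesis
  proof
    show "eCWL W S L \<subseteq> range (E (gen L))"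
    proof
      fix v assume "v \<in> eCWL W S L"
      then obtain a where a: "\<forall>g. g \<notin> gen L \<longrightarrow> a g = 0" "v = gmult W (eel W S L) a"
        unfolding eCWL_def by blast
      have "v = opL L a" unfolding a(2) eel_eq[OF L] by (rule opL_gmult[OF L CWa[OF a(1)]])
      also have "\<dots> = E (gen L) (\<lambda>g. ?k * face_op (gen L) a g)" unfolding op[OF a(1)] clin_scale[OF clin_E[OF P]] ..
      finally show "v \<in> range (E (gen L))" by blast
    qed
    show "range (E (gen L)) \<subseteq> eCWL W S L"
    proof
      fix v assume "v \<in> range (E (gen L))"
      then obtain u where u: "v = E (gen L) u" by blast
      let ?u = "avg (gen L) u"
      \<comment> \<open>The restriction of the average to W_L, rescaled by the number of faces with
        that support to undo the weight in \<open>opL\<close>.\<close>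
      define b where "b = (\<lambda>g. (1 / ?k) * (if g \<in> gen L then ?u g else 0))"
      have b0: "\<forall>g. g \<notin> gen L \<longrightarrow> b g = 0" by (simp add: b_def)
      have gf: "gen L \<in> faces" "supp (gen L) = gen L" using gen_face[OF L] by auto
      have same: "face_op (gen L) (face_op Z u) = face_op Z u" if "Z \<in> faces_of (gen L)" for Z
        using TT_same[OF faces_of_faces[OF that] gf(1)] gf(2) faces_of_supp[OF that] by simp
      have face_opu: "face_op (gen L) ?u = ?u"
        unfolding avg_def clin_sum[OF clin_face_op] using same by (intro ext sum.cong refl) simp
      have "face_op (gen L) b = (\<lambda>g. (1 / ?k) * face_op (gen L) (\<lambda>g. if g \<in> gen L then ?u g else 0) g)"
        unfolding b_def by (rule clin_scale[OF clin_face_op])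
      also have "\<dots> = (\<lambda>g. (1 / ?k) * ?u g)" unfolding face_op_gen_restrict[OF gf(1)] face_opu ..
      finally have "E (gen L) (face_op (gen L) b) = (\<lambda>g. (1 / ?k) * E (gen L) ?u g)"
        using clin_scale[OF clin_E[OF P]] by simp
      then have "opL L b = (\<lambda>g. ?k * ((1 / ?k) * E (gen L) ?u g))" unfolding op[OF b0] by simp
      also have "\<dots> = v" using k unfolding u E_avg[OF P] by simp
      finally have "v = gmult W (eel W S L) b" unfolding eel_eq[OF L] opL_gmult[OF L CWa[OF b0]] ..
      then show "v \<in> eCWL W S L" unfolding eCWL_def using b0 by blast
    qed
  qed
qed

section \<open>Traces on the group algebra\<close>

lemma gmult_delta:
  assumes n: "n \<in> W" shows "gmult W a (delta n) = act n a"
proof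
  fix g
  have m: "matrix_inv h ** g = n \<longleftrightarrow> g = h ** n" if "h \<in> W" for h
    using W_left_cancel[OF that, of "matrix_inv h ** g" n] that by simp
  show "gmult W a (delta n) g = act n a g"
  proof (cases "g \<in> W")
    case True
    have "g = h ** n \<longleftrightarrow> h = g ** matrix_inv n" if "h \<in> W" for h
      using W_right_cancel[of "matrix_inv n" g "h ** n"] n by (auto simp: mm)
    then have "gmult W a (delta n) g = (\<Sum>h\<in>W. if h = g ** matrix_inv n then a h else 0)"
      unfolding gmult_def delta_def using m by (intro sum.cong) auto
    then show ?thesis using True n finite_W by (simp add: act_def)
  next
    case False
    then have "g \<noteq> h ** n" if "h \<in> W" for h using that n W_mult by blast
    then show ?thesis using False m by (simp add: gmult_def delta_def act_def)
  qed
qed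

lemma PhiL_eq:
  assumes "L \<subseteq> S" "n \<in> W"
  shows "PhiL W S L n = qtrace (act n) (range (E (gen L))) {\<lambda>_. 0}"
  unfolding PhiL_def eCWL_eq[OF assms(1)] gmult_delta[OF assms(2)] ..

lemma act_zero: "act g ` {\<lambda>_. 0} \<subseteq> {\<lambda>_. 0}"
  by (simp add: clin_zero[OF clin_act])

lemma qtrace_CW:
  assumes g: "g \<in> W" shows "qtrace (act g) CW {\<lambda>_. 0} = reg_char W g"
proof -
  have dsum: "(\<Sum>w\<in>W. c w * delta w x) = (if x \<in> W then c x else 0)" for c x
  proof -
    have "(\<Sum>w\<in>W. c w * delta w x) = (\<Sum>w\<in>W. if w = x then c w else 0)"
      by (intro sum.cong) (auto simp: delta_def)
    then show ?thesis using finite_W by simp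
  qed
  have quot_basis: "quot_basis W delta CW {\<lambda>_. 0}"
    unfolding quot_basis_def
  proof (intro conjI allI impI ballI)
    show "finite W" by (rule finite_W)
    show "delta ` W \<subseteq> CW" by (auto simp: CW_def delta_def)
  next
    fix c w assume c: "(\<lambda>x. \<Sum>w\<in>W. c w * delta w x) \<in> {\<lambda>_. 0}" and w: "w \<in> W"
    have "(\<lambda>x. if x \<in> W then c x else 0) = (\<lambda>_. 0)" using c unfolding dsum by simp
    from fun_cong[OF this, of w] show "c w = 0" using w by simp
  next
    fix u assume "u \<in> CW"
    then have "(\<lambda>x. u x - (\<Sum>w\<in>W. u w * delta w x)) \<in> {\<lambda>_. 0}" unfolding dsum by (auto simp: CW_def)
    then show "\<exists>c. (\<lambda>x. u x - (\<Sum>w\<in>W. c w * delta w x)) \<in> {\<lambda>_. 0}" by (intro exI[of _ u])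
  qed
  let ?m = "\<lambda>i j. if i = j ** g then 1 else 0 :: complex"
  have quot_matrix: "quot_matrix W delta (act g) ?m {\<lambda>_. 0}"
    unfolding quot_matrix_def
  proof
    fix w assume w: "w \<in> W"
    have "act g (delta w) x = (if x \<in> W then ?m x w else 0)" for x
    proof -
      have "x ** matrix_inv g = w \<longleftrightarrow> x = w ** g"
        using W_right_cancel[OF g, of "x ** matrix_inv g" w] g by (simp add: mm)
      then show ?thesis by (simp add: act_def delta_def)
    qed
    then show "(\<lambda>x. act g (delta w) x - (\<Sum>i\<in>W. ?m i w * delta i x)) \<in> {\<lambda>_. 0}"
      unfolding dsum by simp
  qed
  have "w = w ** g \<longleftrightarrow> g = mat 1" if "w \<in> W" for w
    using W_left_cancel[OF that, of "mat 1" g] by auto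
  then have "(\<Sum>w\<in>W. ?m w w) = (\<Sum>w\<in>W. if g = mat 1 then 1 else 0)" by (intro sum.cong) auto
  also have "\<dots> = reg_char W g" by (simp add: reg_char_def)
  finally show ?thesis using qtrace_eqI[OF quot_basis quot_matrix csubspace_zero clin_act act_zero] by simp
qed

lemma csubspace_range: "clin f \<Longrightarrow> csubspace (range f)"
  by (rule csubspace_image) (simp_all add: csubspace_def)

lemma E_range_basis:
  assumes P: "P \<in> parabs" shows "\<exists>B. quot_basis B (\<lambda>a. a) (range (E P)) {\<lambda>_. 0}"
proof (rule quot_basis_exists_family[OF finite_W _ csubspace_zero])
  show "(\<lambda>w. E P (delta w)) ` W \<subseteq> range (E P)" by blast
  fix v assume "v \<in> range (E P)"
  then obtain a where a: "v = E P a" by blast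
  have "v = E P (avg P a)" unfolding a by (rule E_avg[OF P, symmetric])
  also have "\<dots> = E P (\<lambda>g. \<Sum>w\<in>W. avg P a w * delta w g)" using CW_expand[OF avg_CW] by metis
  also have "\<dots> = (\<lambda>g. \<Sum>w\<in>W. avg P a w * E P (delta w) g)" by (rule clin_sum[OF clin_E[OF P]])
  finally show "\<exists>c. (\<lambda>x. v x - (\<Sum>w\<in>W. c w * E P (delta w) x)) \<in> {\<lambda>_. 0}"
    by (intro exI[of _ "avg P a"]) simp
qed

lemma act_E_range:
  assumes "P \<in> parabs" "g \<in> W" shows "act g ` range (E P) \<subseteq> range (E (conj_set P g))"
proof
  fix v assume "v \<in> act g ` range (E P)"
  then obtain a where "v = act g (E P a)" by blast
  then have "v = E (conj_set P g) (act g a)" by (simp add: E_act[OF assms])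
  then show "v \<in> range (E (conj_set P g))" by blast
qed

lemma reg_char_sum:
  assumes g: "g \<in> W"
  shows "reg_char W g = (\<Sum>P | P \<in> parabs \<and> conj_set P g = P. qtrace (act g) (range (E P)) {\<lambda>_. 0})"
  unfolding qtrace_CW[OF g, symmetric]
proof (rule qtrace_direct_sum[OF parabs_finite csubspace_zero clin_act act_zero])
  fix P assume P: "P \<in> parabs"
  show "csubspace (range (E P))" by (rule csubspace_range[OF clin_E[OF P]])
  show "range (E P) \<subseteq> CW" using E_CW[OF P] by blast
  show "\<exists>B. quot_basis B (\<lambda>a. a) (range (E P)) {\<lambda>_. 0}" by (rule E_range_basis[OF P])
  show "conj_set P g \<in> parabs" by (rule conj_set_parabs[OF P g])
  show "act g ` range (E P) \<subseteq> range (E (conj_set P g))" by (rule act_E_range[OF P g])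
next
  fix u assume "u \<in> CW"
  then have "(\<lambda>x. u x - (\<Sum>P\<in>parabs. E P u x)) \<in> {\<lambda>_. 0}" using E_sum by auto
  then show "\<exists>v. (\<forall>P\<in>parabs. v P \<in> range (E P)) \<and> (\<lambda>x. u x - (\<Sum>P\<in>parabs. v P x)) \<in> {\<lambda>_. 0}"
    by (intro exI[of _ "\<lambda>P. E P u"]) blast
next
  fix v assume "\<forall>P\<in>parabs. v P \<in> range (E P)" "(\<lambda>x. \<Sum>P\<in>parabs. v P x) \<in> {\<lambda>_. 0}"
  then show "\<forall>P\<in>parabs. v P \<in> {\<lambda>_. 0}" using E_direct by blast
qed

lemma act_act:
  assumes "g \<in> W" "x \<in> W"
  shows "act x (act g u) = act (conjg g x) (act x u)"
  using assms by (auto simp: act_def conjg_def mm)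

lemma act_image_range:
  assumes P: "P \<in> parabs" and x: "x \<in> W"
  shows "act x ` range (E P) = range (E (conj_set P x))"
proof
  show "range (E (conj_set P x)) \<subseteq> act x ` range (E P)"
  proof
    fix v assume v: "v \<in> range (E (conj_set P x))"
    have Q: "conj_set P x \<in> parabs" by (rule conj_set_parabs[OF P x])
    have "act (matrix_inv x) v \<in> range (E (conj_set (conj_set P x) (matrix_inv x)))"
      by (rule subsetD[OF act_E_range[OF Q W_inv[OF x]] imageI[OF v]])
    then have 1: "act (matrix_inv x) v \<in> range (E P)" using x by simp
    have "v \<in> CW" using v E_CW[OF Q] by blast
    then have "act x (act (matrix_inv x) v) = v" using x by (auto simp: act_def CW_def mm)
    then show "v \<in> act x ` range (E P)" using imageI[OF 1, of "act x"] by simp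
  qed
qed (rule act_E_range[OF P x])

lemma qtrace_act_conj:
  assumes P: "P \<in> parabs" and g: "g \<in> W" "conj_set P g = P" and x: "x \<in> W"
  shows "qtrace (act g) (range (E P)) {\<lambda>_. 0} = qtrace (act (conjg g x)) (range (E (conj_set P x))) {\<lambda>_. 0}"
proof -
  obtain B where B: "quot_basis B (\<lambda>a. a) (range (E P)) {\<lambda>_. 0}" using E_range_basis[OF P] by blast
  show ?thesis
  proof (rule qtrace_transport[OF B clin_act _ act_zero csubspace_range[OF clin_E[OF P]] csubspace_zero
        csubspace_zero clin_act act_zero clin_act[of x] act_image_range[OF P x] act_zero])
    show "act g ` range (E P) \<subseteq> range (E P)" using act_E_range[OF P g(1)] g(2) by simp
    show "act x (act g u) = act (conjg g x) (act x u)" for u by (rule act_act[OF g(1) x])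
    fix u assume u: "u \<in> range (E P)" "act x u \<in> {\<lambda>_. 0}"
    then have "act x u = (\<lambda>_. 0)" by blast
    then have "act (matrix_inv x) (act x u) = (\<lambda>_. 0)" using clin_zero[OF clin_act] by simp
    moreover have "u \<in> CW" using u(1) E_CW[OF P] by blast
    then have "act (matrix_inv x) (act x u) = u" using x by (auto simp: act_def CW_def mm)
    ultimately show "u \<in> {\<lambda>_. 0}" by simp
  qed
qed

end


section \<open>The Orlik--Solomon algebra\<close>

lemma csubspace_cspan: "csubspace (cspan A)"
  unfolding csubspace_def
proof (intro conjI ballI allI)
  show "(\<lambda>_. 0) \<in> cspan A" unfolding cspan_def by (auto intro!: exI[of _ "{}"])
next
  fix u v assume "u \<in> cspan A" "v \<in> cspan A"
  then obtain F c G d where u: "finite F" "F \<subseteq> A" "u = (\<lambda>x. \<Sum>a\<in>F. c a * a x)"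
    and v: "finite G" "G \<subseteq> A" "v = (\<lambda>x. \<Sum>a\<in>G. d a * a x)"
    unfolding cspan_def by blast
  let ?e = "\<lambda>a. (if a \<in> F then c a else 0) + (if a \<in> G then d a else 0)"
  have "(\<Sum>a\<in>F. c a * a x) = (\<Sum>a\<in>F \<union> G. (if a \<in> F then c a else 0) * a x)" for x
    using u v by (intro sum.mono_neutral_cong_left) auto
  moreover have "(\<Sum>a\<in>G. d a * a x) = (\<Sum>a\<in>F \<union> G. (if a \<in> G then d a else 0) * a x)" for x
    using u v by (intro sum.mono_neutral_cong_left) auto
  ultimately have "(\<lambda>x. u x + v x) = (\<lambda>x. \<Sum>a\<in>F \<union> G. ?e a * a x)"
    unfolding u(3) v(3) by (simp add: distrib_right sum.distrib)
  then show "(\<lambda>x. u x + v x) \<in> cspan A"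
    unfolding cspan_def using u v by (intro CollectI exI[of _ "F \<union> G"] exI[of _ ?e]) simp
next
  fix c u assume "u \<in> cspan A"
  then obtain F d where u: "finite F" "F \<subseteq> A" "u = (\<lambda>x. \<Sum>a\<in>F. d a * a x)"
    unfolding cspan_def by blast
  have "(\<lambda>x. c * u x) = (\<lambda>x. \<Sum>a\<in>F. (c * d a) * a x)"
    unfolding u(3) by (simp add: sum_distrib_left mult.assoc)
  then show "(\<lambda>x. c * u x) \<in> cspan A"
    unfolding cspan_def using u by (intro CollectI exI[of _ F] exI[of _ "\<lambda>a. c * d a"]) simp
qed

lemma cspan_base: "a \<in> A \<Longrightarrow> a \<in> cspan A"
  unfolding cspan_def by (intro CollectI exI[of _ "{a}"] exI[of _ "\<lambda>_. 1"]) simp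

lemma cspan_least:
  assumes "A \<subseteq> U" "csubspace U" shows "cspan A \<subseteq> U"
proof
  fix v assume "v \<in> cspan A"
  then obtain F c where v: "finite F" "F \<subseteq> A" "v = (\<lambda>x. \<Sum>a\<in>F. c a * a x)"
    unfolding cspan_def by blast
  show "v \<in> U" unfolding v(3) by (rule csubspace_sum[OF assms(2)]) (use v assms(1) in blast)
qed

lemma cspan_mono: "A \<subseteq> B \<Longrightarrow> cspan A \<subseteq> cspan B"
  by (rule cspan_least[OF _ csubspace_cspan]) (use cspan_base in blast)

lemma csubspace_vimage: "clin f \<Longrightarrow> csubspace U \<Longrightarrow> csubspace {v. f v \<in> U}"
  by (simp add: csubspace_def clin_add clin_scale clin_zero)

lemma cspan_image_sub:
  assumes "clin f" "csubspace U" "\<And>a. a \<in> A \<Longrightarrow> f a \<in> U" "v \<in> cspan A"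
  shows "f v \<in> U"
  using cspan_least[of A "{v. f v \<in> U}"] csubspace_vimage[OF assms(1,2)] assms(3,4) by blast

lemma cspan_eq_on:
  assumes f: "clin f" "clin g" "\<And>a. a \<in> A \<Longrightarrow> f a = g a" and v: "v \<in> cspan A"
  shows "f v = g v"
proof -
  obtain F c where F: "F \<subseteq> A" "v = (\<lambda>x. \<Sum>a\<in>F. c a * a x)" using v unfolding cspan_def by blast
  show ?thesis unfolding F(2) clin_sum[OF f(1)] clin_sum[OF f(2)]
    by (intro ext sum.cong refl) (use F(1) f(3) in auto)
qed

lemma csubspace_plus:
  assumes "csubspace U" "csubspace V" shows "csubspace {(\<lambda>x. u x + v x) | u v. u \<in> U \<and> v \<in> V}"
  unfolding csubspace_def
proof (intro conjI ballI allI)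
  show "(\<lambda>_. 0) \<in> {(\<lambda>x. u x + v x) | u v. u \<in> U \<and> v \<in> V}"
    using csubspace_0[OF assms(1)] csubspace_0[OF assms(2)] by force
next
  fix a b assume "a \<in> {(\<lambda>x. u x + v x) | u v. u \<in> U \<and> v \<in> V}" "b \<in> {(\<lambda>x. u x + v x) | u v. u \<in> U \<and> v \<in> V}"
  then obtain u v u' v' where *: "u \<in> U" "v \<in> V" "a = (\<lambda>x. u x + v x)" "u' \<in> U" "v' \<in> V" "b = (\<lambda>x. u' x + v' x)"
    by blast
  have "(\<lambda>x. a x + b x) = (\<lambda>x. (u x + u' x) + (v x + v' x))" unfolding * by (simp add: algebra_simps)
  then show "(\<lambda>x. a x + b x) \<in> {(\<lambda>x. u x + v x) | u v. u \<in> U \<and> v \<in> V}"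
    using csubspace_add[OF assms(1) *(1,4)] csubspace_add[OF assms(2) *(2,5)]
    by (intro CollectI exI[of _ "\<lambda>x. u x + u' x"] exI[of _ "\<lambda>x. v x + v' x"]) simp
next
  fix c a assume "a \<in> {(\<lambda>x. u x + v x) | u v. u \<in> U \<and> v \<in> V}"
  then obtain u v where *: "u \<in> U" "v \<in> V" "a = (\<lambda>x. u x + v x)" by blast
  have "(\<lambda>x. c * a x) = (\<lambda>x. c * u x + c * v x)" unfolding * by (simp add: algebra_simps)
  then show "(\<lambda>x. c * a x) \<in> {(\<lambda>x. u x + v x) | u v. u \<in> U \<and> v \<in> V}"
    using csubspace_scale[OF assms(1) *(1)] csubspace_scale[OF assms(2) *(2)]
    by (intro CollectI exI[of _ "\<lambda>x. c * u x"] exI[of _ "\<lambda>x. c * v x"]) simp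
qed

lemma mono_nondistinct: "\<not> distinct ts \<Longrightarrow> mono ts = (\<lambda>_. 0)"
  by (auto simp: mono_def)

lemma mono_support: "mono ts us \<noteq> 0 \<Longrightarrow> set us = set ts"
  by (auto simp: mono_def split: if_splits)

text \<open>An injective relabelling does not change the permutation relating the two lists, hence
  not its sign.\<close>

lemma mono_map:
  assumes "inj f" shows "mono (map f ts) (map f us) = mono ts us"
proof (cases "distinct ts \<and> distinct us \<and> set us = set ts")
  case True
  then have l: "length us = length ts" by (metis distinct_card)
  have "(\<sigma> permutes {..<length (map f ts)} \<and> (\<forall>i<length (map f ts). map f us ! i = map f ts ! \<sigma> i))
    \<longleftrightarrow> (\<sigma> permutes {..<length ts} \<and> (\<forall>i<length ts. us ! i = ts ! \<sigma> i))" for \<sigma>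
  proof (rule conj_cong)
    show "\<sigma> permutes {..<length (map f ts)} \<longleftrightarrow> \<sigma> permutes {..<length ts}" by simp
    assume s: "\<sigma> permutes {..<length ts}"
    have "map f us ! i = map f ts ! \<sigma> i \<longleftrightarrow> us ! i = ts ! \<sigma> i" if "i < length ts" for i
    proof -
      have "\<sigma> i < length ts" using permutes_in_image[OF s, of i] that by simp
      then show ?thesis using that l inj_eq[OF assms] by simp
    qed
    then show "(\<forall>i<length (map f ts). map f us ! i = map f ts ! \<sigma> i) \<longleftrightarrow> (\<forall>i<length ts. us ! i = ts ! \<sigma> i)"
      by simp
  qed
  moreover have "distinct (map f ts) \<and> distinct (map f us) \<and> set (map f us) = set (map f ts)"
    using True assms by (auto simp: distinct_map inj_on_def inj_def)
  ultimately show ?thesis using True unfolding mono_def by simp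
next
  case False
  have n: "\<not> (distinct (map f ts) \<and> distinct (map f us) \<and> set (map f us) = set (map f ts))"
    using False assms by (auto simp: distinct_map inj_image_eq_iff)
  show ?thesis unfolding mono_def if_not_P[OF False] if_not_P[OF n] ..
qed

context coxeter_group
begin

section \<open>The Orlik-Solomon ideal and the grading by flats\<close>

lemma inter_hyps_fixW: "inter_hyps ts = fixW (set ts)"
  by (simp add: inter_hyps_def fixW_def)

lemma codim_inter_hyps:
  assumes "set ts \<subseteq> T" shows "codim (inter_hyps ts) \<le> length ts"
  using assms
proof (induction ts)
  case Nil
  then show ?case by (simp add: codim_def inter_hyps_def)
next
  case (Cons t ts)
  have e: "inter_hyps (t # ts) = inter_hyps ts \<inter> Fix t" by (auto simp: inter_hyps_def Fix_def)
  have "dim (inter_hyps ts) \<le> dim (inter_hyps (t # ts)) + 1"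
    unfolding e using Cons.prems by (intro dim_Int_Fix) (simp_all add: inter_hyps_fixW subspace_fixW)
  then show ?case using Cons by (simp add: codim_def)
qed

abbreviation EE where "EE \<equiv> os_E W S"
abbreviation II where "II \<equiv> os_I W S"

definition os_rel :: "'n rmat list \<Rightarrow> 'n rmat list \<Rightarrow> 'n rmat list \<Rightarrow> 'n rmat list \<Rightarrow> complex" where
  "os_rel us ts vs = (\<lambda>x. \<Sum>i<length ts. (-1)^(Suc i) * mono (us @ take i ts @ drop (Suc i) ts @ vs) x)"

lemma os_I_eq: "II = cspan {os_rel us ts vs | us ts vs. set (us @ ts @ vs) \<subseteq> T \<and> os_dep ts}"
  unfolding os_I_def os_rel_def ..

lemma csubspace_II: "csubspace II"
  unfolding os_I_def by (rule csubspace_cspan)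

lemma csubspace_EE: "csubspace EE"
  unfolding os_E_def by (rule csubspace_cspan)

text \<open>Multiply the relation of \<open>ts\<close> by its first generator once more. Every term
  but the one omitting that generator then contains it twice and vanishes; the surviving term has
  index 0 and hence sign -1.\<close>

lemma mono_dep:
  assumes "set (us @ ts @ vs) \<subseteq> T" "os_dep ts"
  shows "mono (us @ ts @ vs) \<in> II"
proof -
  obtain t ts' where ts: "ts = t # ts'" using assms(2) by (cases ts) (auto simp: os_dep_def)
  have "os_rel (us @ [t]) ts vs x = - mono (us @ ts @ vs) x" for x
  proof -
    have z: "mono ((us @ [t]) @ take i ts @ drop (Suc i) ts @ vs) = (\<lambda>_. 0)" if i: "0 < i" for i
    proof (rule mono_nondistinct)
      obtain j where "i = Suc j" using i by (cases i) auto
      then have "t \<in> set (take i ts)" unfolding ts by simp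
      then show "\<not> distinct ((us @ [t]) @ take i ts @ drop (Suc i) ts @ vs)" by auto
    qed
    have "os_rel (us @ [t]) ts vs x = (\<Sum>i\<in>{0}. (-1)^(Suc i) * mono ((us @ [t]) @ take i ts @ drop (Suc i) ts @ vs) x)"
      unfolding os_rel_def using z by (intro sum.mono_neutral_right) (auto simp: ts)
    then show ?thesis unfolding ts by simp
  qed
  then have "os_rel (us @ [t]) ts vs = (\<lambda>x. - mono (us @ ts @ vs) x)" by blast
  moreover have "os_rel (us @ [t]) ts vs \<in> II"
  proof -
    have "set ((us @ [t]) @ ts @ vs) \<subseteq> T" using assms(1) by (auto simp: ts)
    then show ?thesis unfolding os_I_eq using assms(2) by (intro cspan_base) blast
  qed
  ultimately have "(\<lambda>x. - mono (us @ ts @ vs) x) \<in> II" by simp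
  from csubspace_scale[OF csubspace_II this, of "-1"] show ?thesis by simp
qed

lemma mono_dep': "set ts \<subseteq> T \<Longrightarrow> os_dep ts \<Longrightarrow> mono ts \<in> II"
  using mono_dep[of "[]" ts "[]"] by simp

text \<open>Projection of the exterior algebra to the part over the flat X. A monomial is a function
  supported on rearrangements of its list, and these all have the same intersection.\<close>

definition comp :: "(real^'n) set \<Rightarrow> ('n rmat list \<Rightarrow> complex) \<Rightarrow> 'n rmat list \<Rightarrow> complex" where
  "comp X v = (\<lambda>us. if inter_hyps us = X then v us else 0)"

lemma clin_comp: "clin (comp X)"
  by (auto simp: clin_def comp_def)

lemma comp_mono: "comp X (mono ts) = (if inter_hyps ts = X then mono ts else (\<lambda>_. 0))"
proof
  fix us
  have "inter_hyps us = inter_hyps ts" if "mono ts us \<noteq> 0"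
    using mono_support[OF that] by (simp add: inter_hyps_fixW)
  then show "comp X (mono ts) us = (if inter_hyps ts = X then mono ts else (\<lambda>_. 0)) us"
    by (auto simp: comp_def)
qed

text \<open>The terms of a relation need not lie over one flat. A term over a flat other than that
  of the full list comes from removing a hyperplane that genuinely enlarges the intersection of the
  dependent list; what remains is still dependent, so this term is in the ideal by itself.\<close>

lemma comp_II:
  assumes "v \<in> II" shows "comp X v \<in> II"
proof -
  have "comp X (os_rel us ts vs) \<in> II" if s: "set (us @ ts @ vs) \<subseteq> T" and d: "os_dep ts" for us ts vs
  proof -
    define m where "m i = mono (us @ take i ts @ drop (Suc i) ts @ vs)" for i
    define h where "h i = inter_hyps (us @ take i ts @ drop (Suc i) ts @ vs)" for i
    let ?Y = "inter_hyps (us @ ts @ vs)"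
    have r: "os_rel us ts vs = (\<lambda>x. \<Sum>i<length ts. (-1)^(Suc i) * m i x)"
      unfolding os_rel_def m_def ..
    have cr: "comp X (os_rel us ts vs) = (\<lambda>x. \<Sum>i<length ts. (-1)^(Suc i) * comp X (m i) x)"
      unfolding r by (rule clin_sum[OF clin_comp])
    have cm: "comp X (m i) = (if h i = X then m i else (\<lambda>_. 0))" for i
      unfolding m_def h_def by (rule comp_mono)
    have bad: "m i \<in> II" if i: "i < length ts" and n: "h i \<noteq> ?Y" for i
    proof -
      let ?ts = "take i ts @ drop (Suc i) ts"
      have sub: "set ?ts \<subseteq> set ts" by (auto dest: in_set_takeD in_set_dropD)
      have "fixW (set ?ts) \<noteq> fixW (set ts)"
      proof
        assume "fixW (set ?ts) = fixW (set ts)"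
        then have "fixW (set us \<union> (set ?ts \<union> set vs)) = fixW (set us \<union> (set ts \<union> set vs))"
          by (simp add: fixW_Fix INT_Un)
        then show False using n by (simp add: h_def inter_hyps_fixW Un_assoc)
      qed
      then have "fixW (set ts) \<subset> fixW (set ?ts)" using fixW_anti[OF sub] by blast
      \<comment> \<open>The removed letter shortens the list by one, but the codimension falls by at
        least one too, so it stays below the length.\<close>
      then have "dim (fixW (set ts)) < dim (fixW (set ?ts))"
        by (intro dim_less_subspace subspace_fixW)
      moreover have "codim (fixW (set ts)) < length ts" using d by (simp add: os_dep_def inter_hyps_fixW)
      moreover have "length ?ts = length ts - 1" using i by simp
      ultimately have "codim (fixW (set ?ts)) < length ?ts"
        using dim_le_card[of "fixW (set ?ts)"] unfolding codim_def by linarith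
      then have "os_dep ?ts" by (simp add: os_dep_def inter_hyps_fixW)
      moreover have "set (us @ ?ts @ vs) \<subseteq> T" using s sub by auto
      ultimately have "mono (us @ ?ts @ vs) \<in> II" by (intro mono_dep)
      then show ?thesis by (simp add: m_def)
    qed
    show ?thesis
    proof (cases "X = ?Y")
      case False
      have "comp X (m i) \<in> II" if "i < length ts" for i
        unfolding cm using bad[OF that] False csubspace_0[OF csubspace_II] by auto
      then show ?thesis unfolding cr by (intro csubspace_sum[OF csubspace_II]) simp
    next
      case True
      have rI: "os_rel us ts vs \<in> II" unfolding os_I_eq using s d by (intro cspan_base) blast
      have "(\<lambda>x. m i x - comp X (m i) x) \<in> II" if "i < length ts" for i
        unfolding cm using bad[OF that] True csubspace_0[OF csubspace_II] by auto
      then have "(\<lambda>x. \<Sum>i<length ts. (-1)^(Suc i) * (m i x - comp X (m i) x)) \<in> II"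
        by (intro csubspace_sum[OF csubspace_II]) simp
      from csubspace_diff[OF csubspace_II rI this]
      have "(\<lambda>x. os_rel us ts vs x - (\<Sum>i<length ts. (-1)^(Suc i) * (m i x - comp X (m i) x))) \<in> II" .
      also have "(\<lambda>x. os_rel us ts vs x - (\<Sum>i<length ts. (-1)^(Suc i) * (m i x - comp X (m i) x))) = comp X (os_rel us ts vs)"
        unfolding cr unfolding r by (simp only: right_diff_distrib sum_subtractf diff_diff_eq2 add_diff_cancel_left' diff_self add_0)
      finally show ?thesis .
    qed
  qed
  then show ?thesis
    using assms cspan_image_sub[OF clin_comp csubspace_II] unfolding os_I_eq[symmetric]
    by (smt (verit) mem_Collect_eq os_I_eq)
qed

definition monoms :: "'n rmat set \<Rightarrow> ('n rmat list \<Rightarrow> complex) set" where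
  "monoms P = {mono ts | ts. set ts \<subseteq> T \<and> length ts = codim (fixW P) \<and> inter_hyps ts = fixW P}"

definition AX :: "'n rmat set \<Rightarrow> ('n rmat list \<Rightarrow> complex) set" where
  "AX P = {(\<lambda>x. u x + i x) | u i. u \<in> cspan (monoms P) \<and> i \<in> II}"

lemma os_AX_eq: "os_AX W S L = AX (gen L)"
  unfolding os_AX_def AX_def monoms_def ..

lemma csubspace_AX: "csubspace (AX P)"
  unfolding AX_def by (rule csubspace_plus[OF csubspace_cspan csubspace_II])

lemma II_AX: "i \<in> II \<Longrightarrow> i \<in> AX P"
  unfolding AX_def using csubspace_0[OF csubspace_cspan, of "monoms P"]
  by (intro CollectI exI[of _ "\<lambda>_. 0"] exI[of _ i]) simp

lemma monoms_AX: "u \<in> cspan (monoms P) \<Longrightarrow> u \<in> AX P"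
  unfolding AX_def using csubspace_0[OF csubspace_II]
  by (intro CollectI exI[of _ u] exI[of _ "\<lambda>_. 0"]) simp

lemma mono_EE: "set ts \<subseteq> T \<Longrightarrow> mono ts \<in> EE"
  unfolding os_E_def by (intro cspan_base) blast

lemma II_EE: "II \<subseteq> EE"
  unfolding os_I_eq
proof (rule cspan_least[OF _ csubspace_EE])
  show "{os_rel us ts vs | us ts vs. set (us @ ts @ vs) \<subseteq> T \<and> os_dep ts} \<subseteq> EE"
  proof clarify
    fix us ts vs assume s: "set (us @ ts @ vs) \<subseteq> T"
    show "os_rel us ts vs \<in> EE"
      unfolding os_rel_def
    proof (rule csubspace_sum[OF csubspace_EE mono_EE])
      fix i
      show "set (us @ take i ts @ drop (Suc i) ts @ vs) \<subseteq> T"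
        using s by (auto dest: in_set_takeD in_set_dropD)
    qed
  qed
qed

lemma monoms_EE: "cspan (monoms P) \<subseteq> EE"
  unfolding os_E_def by (rule cspan_mono) (auto simp: monoms_def)

lemma AX_EE: "AX P \<subseteq> EE"
proof
  fix v assume "v \<in> AX P"
  then obtain u i where "u \<in> cspan (monoms P)" "i \<in> II" "v = (\<lambda>x. u x + i x)" unfolding AX_def by blast
  then show "v \<in> EE" using csubspace_add[OF csubspace_EE] monoms_EE II_EE by blast
qed

lemma comp_AX:
  assumes u: "u \<in> EE" shows "comp (fixW P) u \<in> AX P"
proof (rule cspan_image_sub[OF clin_comp csubspace_AX _ u[unfolded os_E_def]])
  fix a assume "a \<in> {mono ts | ts. set ts \<subseteq> T}"
  then obtain ts where ts: "a = mono ts" "set ts \<subseteq> T" by blast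
  show "comp (fixW P) a \<in> AX P"
  proof (cases "inter_hyps ts = fixW P")
    case True
    have "mono ts \<in> AX P"
    proof (cases "length ts = codim (fixW P)")
      case len: True
      have "mono ts \<in> monoms P" unfolding monoms_def using len True ts(2) by blast
      then show ?thesis by (intro monoms_AX cspan_base)
    next
      case False
      \<comment> \<open>The codimension never exceeds the length, so a length different from it
        means dependence.\<close>
      then have "os_dep ts" using codim_inter_hyps[OF ts(2)] True by (simp add: os_dep_def)
      then show ?thesis by (intro II_AX mono_dep' ts(2))
    qed
    then show ?thesis using True by (simp add: ts(1) comp_mono)
  next
    case False
    then show ?thesis using csubspace_0[OF csubspace_AX] by (simp add: ts(1) comp_mono)
  qed
qed

lemma comp_sum:
  assumes u: "u \<in> EE" shows "(\<lambda>x. \<Sum>P\<in>parabs. comp (fixW P) u x) = u"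
proof -
  have c1: "clin (\<lambda>u x. \<Sum>P\<in>parabs. comp (fixW P) u x)"
    unfolding clin_def by (simp add: clin_add[OF clin_comp] clin_scale[OF clin_comp] sum.distrib sum_distrib_left)
  have c2: "clin (\<lambda>u. u)" by (simp add: clin_def)
  show ?thesis
  proof (rule cspan_eq_on[OF c1 c2 _ u[unfolded os_E_def]])
    fix a assume "a \<in> {mono ts | ts. set ts \<subseteq> T}"
    then obtain ts where ts: "a = mono ts" "set ts \<subseteq> T" by blast
    obtain Q where Q: "Q \<in> parabs" "fixW Q = inter_hyps ts" using inter_hyps_parab[OF ts(2)] by blast
    show "(\<lambda>x. \<Sum>P\<in>parabs. comp (fixW P) a x) = a"
    proof
      fix x
      have "comp (fixW P) a x = 0" if "P \<in> parabs - {Q}" for P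
        using that Q fixW_inj[of P Q] by (auto simp: ts(1) comp_mono)
      then have "(\<Sum>P\<in>parabs. comp (fixW P) a x) = (\<Sum>P\<in>{Q}. comp (fixW P) a x)"
        using Q(1) by (intro sum.mono_neutral_right parabs_finite) auto
      then show "(\<Sum>P\<in>parabs. comp (fixW P) a x) = a x" using Q(2) by (simp add: ts(1) comp_mono)
    qed
  qed
qed

lemma comp_monoms:
  assumes u: "u \<in> cspan (monoms P)"
  shows "comp X u = (if fixW P = X then u else (\<lambda>_. 0))"
proof (cases "fixW P = X")
  case True
  have c2: "clin (\<lambda>u. u)" by (simp add: clin_def)
  have "comp X u = u"
    by (rule cspan_eq_on[OF clin_comp c2 _ u]) (use True in \<open>auto simp: monoms_def comp_mono\<close>)
  then show ?thesis using True by simp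
next
  case False
  have c2: "clin (\<lambda>u _. 0)" by (simp add: clin_def)
  have "comp X u = (\<lambda>_. 0)"
    by (rule cspan_eq_on[OF clin_comp c2 _ u]) (use False in \<open>auto simp: monoms_def comp_mono\<close>)
  then show ?thesis using False by simp
qed

text \<open>Modulo the ideal each summand is a combination of monomials over its own flat. The
  projection to the flat of Q keeps the ideal stable and singles out the summand of Q, because
  distinct parabolic subgroups have distinct flats.\<close>

lemma AX_direct:
  assumes v: "\<forall>P\<in>parabs. v P \<in> AX P" and s: "(\<lambda>x. \<Sum>P\<in>parabs. v P x) \<in> II"
  shows "\<forall>P\<in>parabs. v P \<in> II"
proof
  fix Q assume Q: "Q \<in> parabs"
  have "\<forall>P\<in>parabs. \<exists>u. u \<in> cspan (monoms P) \<and> (\<lambda>x. v P x - u x) \<in> II"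
  proof
    fix P assume "P \<in> parabs"
    then obtain u i where "u \<in> cspan (monoms P)" "i \<in> II" "v P = (\<lambda>x. u x + i x)" using v unfolding AX_def by blast
    then show "\<exists>u. u \<in> cspan (monoms P) \<and> (\<lambda>x. v P x - u x) \<in> II" by (intro exI[of _ u]) simp
  qed
  from bchoice[OF this] obtain u where u: "\<forall>P\<in>parabs. u P \<in> cspan (monoms P) \<and> (\<lambda>x. v P x - u P x) \<in> II" ..
  have vu: "(\<lambda>x. v P x - u P x) \<in> II" and uP: "u P \<in> cspan (monoms P)" if "P \<in> parabs" for P
    using bspec[OF u that] by auto
  have "(\<lambda>x. \<Sum>P\<in>parabs. v P x - u P x) \<in> II" by (rule csubspace_sum1[OF csubspace_II vu])
  from csubspace_diff[OF csubspace_II s this] have "(\<lambda>x. \<Sum>P\<in>parabs. u P x) \<in> II"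
    by (simp add: sum_subtractf)
  then have "comp (fixW Q) (\<lambda>x. \<Sum>P\<in>parabs. u P x) \<in> II" by (rule comp_II)
  then have "(\<lambda>x. \<Sum>P\<in>parabs. comp (fixW Q) (u P) x) \<in> II" unfolding clin_sum1[OF clin_comp] .
  moreover have "(\<Sum>P\<in>parabs. comp (fixW Q) (u P) x) = u Q x" for x
  proof -
    have "comp (fixW Q) (u P) x = 0" if "P \<in> parabs - {Q}" for P
      using that Q fixW_inj[of P Q] uP comp_monoms[of "u P" P] by auto
    then have "(\<Sum>P\<in>parabs. comp (fixW Q) (u P) x) = (\<Sum>P\<in>{Q}. comp (fixW Q) (u P) x)"
      using Q by (intro sum.mono_neutral_right parabs_finite) auto
    then show ?thesis using comp_monoms[OF uP[OF Q]] by simp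
  qed
  ultimately have "u Q \<in> II" by simp
  from csubspace_add[OF csubspace_II vu[OF Q] this] show "v Q \<in> II" by simp
qed

section \<open>The action of W on the graded pieces\<close>

lemma clin_os_act: "clin (os_act w)"
  by (simp add: clin_def os_act_def)

lemma os_act_mono:
  assumes w: "w \<in> W" shows "os_act w (mono ts) = mono (map (\<lambda>t. conjg t w) ts)"
proof
  fix us
  have inj: "inj (\<lambda>t. conjg t w)" using conjg_inj[OF w] by (simp add: inj_def)
  have "map (\<lambda>t. conjg t w) (map (\<lambda>t. w ** t ** matrix_inv w) us) = us"
    using w by (simp add: conjg_def mm map_idI)
  then show "os_act w (mono ts) us = mono (map (\<lambda>t. conjg t w) ts) us"
    using mono_map[OF inj, of ts "map (\<lambda>t. w ** t ** matrix_inv w) us"] by (simp add: os_act_def)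
qed

lemma inter_hyps_conj:
  assumes "set ts \<subseteq> T" "w \<in> W"
  shows "inter_hyps (map (\<lambda>t. conjg t w) ts) = (\<lambda>v. v v* w) ` inter_hyps ts"
proof -
  have "set ts \<subseteq> W" using assms(1) T_W by blast
  then show ?thesis using fixW_conj[OF assms(2), of "set ts"] by (simp add: inter_hyps_fixW)
qed

lemma codim_image_W: "w \<in> W \<Longrightarrow> codim ((\<lambda>v. v v* w) ` U) = codim U"
  by (simp add: codim_def dim_image_W)

lemma fixW_conj_set: "P \<in> parabs \<Longrightarrow> w \<in> W \<Longrightarrow> fixW (conj_set P w) = (\<lambda>v. v v* w) ` fixW P"
  unfolding conj_set_def by (rule fixW_conj[OF _ parabs_sub])

lemma os_act_II:
  assumes w: "w \<in> W" shows "os_act w ` II \<subseteq> II"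
proof clarify
  fix v assume v: "v \<in> II"
  show "os_act w v \<in> II"
  proof (rule cspan_image_sub[OF clin_os_act csubspace_II _ v[unfolded os_I_eq]])
    fix a assume "a \<in> {os_rel us ts vs | us ts vs. set (us @ ts @ vs) \<subseteq> T \<and> os_dep ts}"
    then obtain us ts vs where a: "a = os_rel us ts vs" "set (us @ ts @ vs) \<subseteq> T" "os_dep ts" by blast
    let ?f = "map (\<lambda>t. conjg t w)"
    have "os_act w a = os_rel (?f us) (?f ts) (?f vs)"
      unfolding a(1) os_rel_def clin_sum[OF clin_os_act]
      by (simp add: os_act_mono[OF w] take_map drop_map)
    moreover have "set (?f us @ ?f ts @ ?f vs) \<subseteq> T" using a(2) T_conjg w by auto
    moreover have "os_dep (?f ts)"
      using a(2,3) w by (simp add: os_dep_def inter_hyps_conj codim_image_W)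
    ultimately show "os_act w a \<in> II" unfolding os_I_eq by (intro cspan_base) blast
  qed
qed

lemma os_act_AX:
  assumes P: "P \<in> parabs" and w: "w \<in> W" shows "os_act w ` AX P \<subseteq> AX (conj_set P w)"
proof clarify
  fix v assume "v \<in> AX P"
  then obtain u i where v: "u \<in> cspan (monoms P)" "i \<in> II" "v = (\<lambda>x. u x + i x)" unfolding AX_def by blast
  have "os_act w u \<in> cspan (monoms (conj_set P w))"
  proof (rule cspan_image_sub[OF clin_os_act csubspace_cspan _ v(1)])
    fix a assume "a \<in> monoms P"
    then obtain ts where a: "a = mono ts" "set ts \<subseteq> T" "length ts = codim (fixW P)" "inter_hyps ts = fixW P"
      unfolding monoms_def by blast
    have "set (map (\<lambda>t. conjg t w) ts) \<subseteq> T" using a(2) T_conjg w by auto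
    then have "os_act w a \<in> monoms (conj_set P w)"
      unfolding monoms_def a(1) os_act_mono[OF w] fixW_conj_set[OF P w] codim_image_W[OF w]
      using a inter_hyps_conj[OF a(2) w] by (intro CollectI exI[of _ "map (\<lambda>t. conjg t w) ts"]) simp
    then show "os_act w a \<in> cspan (monoms (conj_set P w))" by (rule cspan_base)
  qed
  moreover have "os_act w i \<in> II" using os_act_II[OF w] v(2) by blast
  ultimately show "os_act w v \<in> AX (conj_set P w)"
    unfolding v(3) clin_add[OF clin_os_act] by (intro csubspace_add[OF csubspace_AX] monoms_AX II_AX)
qed

lemma os_act_mult: "a \<in> W \<Longrightarrow> b \<in> W \<Longrightarrow> os_act a (os_act b v) = os_act (b ** a) v"
  by (simp add: os_act_def o_def mm)

lemma os_act_one: "os_act (mat 1) v = v"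
  by (simp add: os_act_def)

lemma AX_basis: "\<exists>B. quot_basis B (\<lambda>a. a) (AX P) II"
proof -
  let ?A = "monoms P"
  \<comment> \<open>There are infinitely many lists, but those with a repeated generator all give
    the zero monomial.\<close>
  have "monoms P \<subseteq> insert (\<lambda>_. 0) (mono ` {ts. set ts \<subseteq> T \<and> distinct ts})"
    unfolding monoms_def using mono_nondistinct by blast
  moreover have "finite T" by (rule finite_T)
  then have "finite (insert (\<lambda>_. 0) (mono ` {ts. set ts \<subseteq> T \<and> distinct ts}))"
    by (intro finite.insertI finite_imageI finite_subset_distinct)
  ultimately have fin: "finite ?A" by (rule finite_subset)
  have sub: "?A \<subseteq> AX P" using monoms_AX cspan_base by blast
  show ?thesis
  proof (rule quot_basis_exists[OF fin sub csubspace_II])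
    fix v assume "v \<in> AX P"
    then obtain u i where v: "u \<in> cspan ?A" "i \<in> II" "v = (\<lambda>x. u x + i x)" unfolding AX_def by blast
    obtain F c where F: "finite F" "F \<subseteq> ?A" "u = (\<lambda>x. \<Sum>a\<in>F. c a * a x)" using v(1) unfolding cspan_def by blast
    have "u x = (\<Sum>a\<in>?A. (if a \<in> F then c a else 0) * a x)" for x
      unfolding F(3) using fin F by (intro sum.mono_neutral_cong_left) auto
    then have "(\<lambda>x. v x - (\<Sum>a\<in>?A. (if a \<in> F then c a else 0) * a x)) = i" unfolding v(3) by simp
    then show "\<exists>c. (\<lambda>x. v x - (\<Sum>a\<in>?A. c a * a x)) \<in> II" using v(2) by (intro exI[of _ "\<lambda>a. if a \<in> F then c a else 0"]) simp
  qed
qed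

lemma PsiL_eq: "PsiL W S L n = qtrace (os_act n) (AX (gen L)) II"
  unfolding PsiL_def os_AX_eq ..

lemma omegaW_sum:
  assumes g: "g \<in> W"
  shows "omegaW W S g = (\<Sum>P | P \<in> parabs \<and> conj_set P g = P. qtrace (os_act g) (AX P) II)"
  unfolding omegaW_def
proof (rule qtrace_direct_sum[OF parabs_finite csubspace_II clin_os_act os_act_II[OF g]])
  fix P assume P: "P \<in> parabs"
  show "csubspace (AX P)" by (rule csubspace_AX)
  show "AX P \<subseteq> EE" by (rule AX_EE)
  show "\<exists>B. quot_basis B (\<lambda>a. a) (AX P) II" by (rule AX_basis)
  show "conj_set P g \<in> parabs" by (rule conj_set_parabs[OF P g])
  show "os_act g ` AX P \<subseteq> AX (conj_set P g)" by (rule os_act_AX[OF P g])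
next
  fix u assume u: "u \<in> EE"
  have "(\<lambda>x. u x - (\<Sum>P\<in>parabs. comp (fixW P) u x)) = (\<lambda>_. 0)"
    using fun_cong[OF comp_sum[OF u]] by auto
  then show "\<exists>v. (\<forall>P\<in>parabs. v P \<in> AX P) \<and> (\<lambda>x. u x - (\<Sum>P\<in>parabs. v P x)) \<in> II"
    using comp_AX[OF u] csubspace_0[OF csubspace_II] by (intro exI[of _ "\<lambda>P. comp (fixW P) u"]) simp
next
  fix v assume "\<forall>P\<in>parabs. v P \<in> AX P" "(\<lambda>x. \<Sum>P\<in>parabs. v P x) \<in> II"
  then show "\<forall>P\<in>parabs. v P \<in> II" by (rule AX_direct)
qed

lemma os_act_inv: "x \<in> W \<Longrightarrow> os_act x (os_act (matrix_inv x) v) = v" "x \<in> W \<Longrightarrow> os_act (matrix_inv x) (os_act x v) = v"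
  by (simp_all add: os_act_mult os_act_one)

lemma qtrace_os_conj:
  assumes P: "P \<in> parabs" and g: "g \<in> W" "conj_set P g = P" and x: "x \<in> W"
  shows "qtrace (os_act g) (AX P) II = qtrace (os_act (conjg g x)) (AX (conj_set P x)) II"
proof -
  obtain B where B: "quot_basis B (\<lambda>a. a) (AX P) II" using AX_basis by blast
  have im: "os_act x ` AX P = AX (conj_set P x)"
  proof
    show "AX (conj_set P x) \<subseteq> os_act x ` AX P"
    proof
      fix v assume v: "v \<in> AX (conj_set P x)"
      have "os_act (matrix_inv x) v \<in> AX (conj_set (conj_set P x) (matrix_inv x))"
        by (rule subsetD[OF os_act_AX[OF conj_set_parabs[OF P x] W_inv[OF x]] imageI[OF v]])
      then have "os_act (matrix_inv x) v \<in> AX P" using x by simp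
      then have "os_act x (os_act (matrix_inv x) v) \<in> os_act x ` AX P" by (rule imageI)
      then show "v \<in> os_act x ` AX P" using os_act_inv(1)[OF x] by simp
    qed
  qed (rule os_act_AX[OF P x])
  show ?thesis
  proof (rule qtrace_transport[OF B clin_os_act _ os_act_II[OF g(1)] csubspace_AX csubspace_II csubspace_II
        clin_os_act os_act_II[OF conjg_W[OF g(1) x]] clin_os_act[of x] im os_act_II[OF x]])
    show "os_act g ` AX P \<subseteq> AX P" using os_act_AX[OF P g(1)] g(2) by simp
    show "os_act x (os_act g u) = os_act (conjg g x) (os_act x u)" for u
      using g(1) x by (simp add: os_act_mult conjg_def mm)
    fix u assume "os_act x u \<in> II"
    then have "os_act (matrix_inv x) (os_act x u) \<in> II" using os_act_II[OF W_inv[OF x]] by blast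
    then show "u \<in> II" using os_act_inv(2)[OF x] by simp
  qed
qed

end


section \<open>Induced characters\<close>

lemma Ex1_unique: "\<exists>!x. Q x \<Longrightarrow> Q a \<Longrightarrow> Q b \<Longrightarrow> a = b"
  by blast

lemma sum_fibers:
  fixes G :: "'b \<Rightarrow> complex"
  assumes "finite A" "\<And>y. y \<in> f ` A \<Longrightarrow> card {x\<in>A. f x = y} = k"
  shows "(\<Sum>x\<in>A. G (f x)) = of_nat k * (\<Sum>y\<in>f ` A. G y)"
proof -
  have "(\<Sum>x\<in>A. G (f x)) = (\<Sum>y\<in>f ` A. \<Sum>x | x \<in> A \<and> f x = y. G (f x))"
    by (rule sum.image_gen[OF assms(1)])
  also have "\<dots> = (\<Sum>y\<in>f ` A. of_nat k * G y)"
  proof (rule sum.cong[OF refl])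
    fix y assume "y \<in> f ` A"
    then have "card {x\<in>A. f x = y} = k" by (rule assms(2))
    moreover have "(\<Sum>x | x \<in> A \<and> f x = y. G (f x)) = (\<Sum>x | x \<in> A \<and> f x = y. G y)"
      by (rule sum.cong) auto
    ultimately show "(\<Sum>x | x \<in> A \<and> f x = y. G (f x)) = of_nat k * G y" by simp
  qed
  finally show ?thesis by (simp add: sum_distrib_left)
qed

text \<open>If two indices had the same image, one could be dropped without shrinking the family of
  images; the remaining sizes would then add up to too little.\<close>

lemma inj_on_if_card_sum:
  assumes fin: "finite J" and pos: "\<And>j. j \<in> J \<Longrightarrow> card (\<kappa> j) > 0"
    and eq: "(\<Sum>j\<in>J. card (\<kappa> j)) = (\<Sum>D\<in>\<kappa> ` J. card D)"
  shows "inj_on \<kappa> J"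
proof (rule inj_onI, rule ccontr)
  fix i j assume ij: "i \<in> J" "j \<in> J" "\<kappa> i = \<kappa> j" "i \<noteq> j"
  have "\<kappa> ` (J - {j}) = \<kappa> ` J"
  proof
    show "\<kappa> ` J \<subseteq> \<kappa> ` (J - {j})"
    proof
      fix D assume "D \<in> \<kappa> ` J"
      then obtain l where l: "l \<in> J" "D = \<kappa> l" by blast
      show "D \<in> \<kappa> ` (J - {j})"
      proof (cases "l = j")
        case True
        then have "D = \<kappa> i" using l ij by simp
        moreover have "i \<in> J - {j}" using ij by simp
        ultimately show ?thesis by blast
      qed (use l in blast)
    qed
  qed blast
  moreover have "(\<Sum>D\<in>\<kappa> ` (J - {j}). card D) \<le> (\<Sum>l\<in>J - {j}. card (\<kappa> l))"
    using sum_image_le[of "J - {j}" card \<kappa>] fin by simp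
  moreover have "(\<Sum>l\<in>J. card (\<kappa> l)) = card (\<kappa> j) + (\<Sum>l\<in>J - {j}. card (\<kappa> l))"
    using fin ij(2) by (simp add: sum.remove)
  ultimately show False using eq pos[OF ij(2)] by simp
qed

lemma ind_cong:
  assumes "\<And>n. n \<in> H \<Longrightarrow> f n = f' n" shows "ind G H f g = ind G H f' g"
  unfolding ind_def using assms by (intro arg_cong2[where f = "(/)"] sum.cong) auto

lemma ind_sum: "ind G H (\<lambda>n. \<Sum>C\<in>A. f C n) g = (\<Sum>C\<in>A. ind G H (f C) g)"
proof -
  have "(if conjg g x \<in> H then \<Sum>C\<in>A. f C (conjg g x) else 0)
      = (\<Sum>C\<in>A. if conjg g x \<in> H then f C (conjg g x) else 0)" for x
    by simp
  then show ?thesis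
    unfolding ind_def by (simp only: sum.swap[of _ A G] sum_divide_distrib)
qed

context coxeter_group
begin

section \<open>Orbits of parabolic subgroups and induction\<close>

lemma conj_set_mult: "g \<in> W \<Longrightarrow> h \<in> W \<Longrightarrow> conj_set P (g ** h) = conj_set (conj_set P g) h"
  unfolding conj_set_def image_image by (intro image_cong refl) (rule conjg_mult)

lemma conj_set_one [simp]: "conj_set P (mat 1) = P"
  by (simp add: conj_set_def)

lemma normalizer_conj_set: "g \<in> normalizer W P \<longleftrightarrow> g \<in> W \<and> conj_set P g = P"
  by (simp add: normalizer_def conj_set_def)

lemma normalizer_sub: "normalizer W P \<subseteq> W"
  by (auto simp: normalizer_def)

lemma normalizer_mult: "g \<in> normalizer W P \<Longrightarrow> h \<in> normalizer W P \<Longrightarrow> g ** h \<in> normalizer W P"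
  by (simp add: normalizer_conj_set conj_set_mult)

lemma normalizer_inv: "g \<in> normalizer W P \<Longrightarrow> matrix_inv g \<in> normalizer W P"
  unfolding normalizer_conj_set by (metis W_inv conj_set_inv_r)

text \<open>The induced character counts fixed points: \<open>conjg g x\<close> normalizes
  \<open>P0\<close> exactly when \<open>g\<close> fixes the conjugate of \<open>P0\<close> by the
  inverse of \<open>x\<close>, and each conjugate arises from one coset of the normalizer.\<close>

lemma ind_orbit:
  assumes g: "g \<in> W" and P0: "P0 \<in> parabs"
    and inv: "\<And>P x. P \<in> parabs \<Longrightarrow> conj_set P g = P \<Longrightarrow> x \<in> W \<Longrightarrow> ch P g = ch (conj_set P x) (conjg g x)"
  shows "ind W (normalizer W P0) (ch P0) g = (\<Sum>P | P \<in> conj_set P0 ` W \<and> conj_set P g = P. ch P g)"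
proof -
  let ?N = "normalizer W P0"
  define p where "p x = conj_set P0 (matrix_inv x)" for x
  define G where "G P = (if conj_set P g = P then ch P g else 0)" for P
  have FG: "(if conjg g x \<in> ?N then ch P0 (conjg g x) else 0) = G (p x)" if x: "x \<in> W" for x
  proof -
    have px: "p x \<in> parabs" unfolding p_def using conj_set_parabs[OF P0] x by simp
    have pxx: "conj_set (p x) x = P0" unfolding p_def using x by simp
    have "conj_set P0 (conjg g x) = conj_set (conj_set (p x) g) x"
      unfolding p_def conjg_def using g x by (simp add: conj_set_mult)
    moreover have "conj_set Q x = conj_set (p x) x \<longleftrightarrow> Q = p x" for Q
      using conj_set_inv_r[OF x] by metis
    ultimately have "conjg g x \<in> ?N \<longleftrightarrow> conj_set (p x) g = p x"
      using g x pxx by (simp add: normalizer_conj_set)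
    then show ?thesis using inv[OF px _ x] pxx by (simp add: G_def)
  qed
  have fib: "card {x\<in>W. p x = P} = card ?N" if "P \<in> p ` W" for P
  proof -
    obtain x0 where x0: "x0 \<in> W" "P = p x0" using \<open>P \<in> p ` W\<close> by blast
    have "bij_betw (\<lambda>n. x0 ** n) ?N {x\<in>W. p x = P}"
    proof (rule bij_betw_byWitness[where f' = "\<lambda>y. matrix_inv x0 ** y"])
      show "\<forall>n\<in>?N. matrix_inv x0 ** (x0 ** n) = n" using x0 by simp
      show "\<forall>y\<in>{x\<in>W. p x = P}. x0 ** (matrix_inv x0 ** y) = y" using x0 by simp
      show "(\<lambda>n. x0 ** n) ` ?N \<subseteq> {x\<in>W. p x = P}"
      proof clarify
        fix n assume n: "n \<in> ?N"
        then have nW: "n \<in> W" using normalizer_sub by blast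
        have "conj_set P0 (matrix_inv n) = P0" using normalizer_inv[OF n] by (simp add: normalizer_conj_set)
        then show "x0 ** n \<in> W \<and> p (x0 ** n) = P" using x0 nW by (simp add: p_def conj_set_mult)
      qed
      show "(\<lambda>y. matrix_inv x0 ** y) ` {x\<in>W. p x = P} \<subseteq> ?N"
      proof clarify
        fix y assume y: "y \<in> W" "P = p y"
        then have "conj_set (conj_set P0 (matrix_inv x0)) y = P0" using x0 by (simp add: p_def)
        then show "matrix_inv x0 ** y \<in> ?N" using x0 y by (simp add: normalizer_conj_set conj_set_mult)
      qed
    qed
    then show ?thesis by (rule bij_betw_same_card[symmetric])
  qed
  have img: "p ` W = conj_set P0 ` W"
  proof
    show "p ` W \<subseteq> conj_set P0 ` W" unfolding p_def using W_inv by blast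
    show "conj_set P0 ` W \<subseteq> p ` W"
    proof clarify
      fix x assume x: "x \<in> W"
      then have "conj_set P0 x = p (matrix_inv x)" by (simp add: p_def)
      then show "conj_set P0 x \<in> p ` W" using x by simp
    qed
  qed
  have "?N \<subseteq> W" by (rule normalizer_sub)
  then have finN: "finite ?N" using finite_W by (rule finite_subset)
  have "mat 1 \<in> ?N" by (simp add: normalizer_conj_set)
  then have N0: "of_nat (card ?N) \<noteq> (0::complex)" using finN by auto
  have fs: "(\<Sum>x\<in>W. G (p x)) = of_nat (card ?N) * (\<Sum>P\<in>p ` W. G P)"
    by (rule sum_fibers[OF finite_W fib])
  have "ind W ?N (ch P0) g = (\<Sum>x\<in>W. G (p x)) / of_nat (card ?N)"
    unfolding ind_def using FG by (intro arg_cong2[where f = "(/)"] sum.cong) auto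
  also have "\<dots> = (\<Sum>P\<in>conj_set P0 ` W. G P)"
    unfolding fs img using N0 by simp
  also have "\<dots> = (\<Sum>P | P \<in> conj_set P0 ` W \<and> conj_set P g = P. ch P g)"
    unfolding G_def using finite_W by (simp add: sum.inter_filter)
  finally show ?thesis .
qed

text \<open>The subsets L are taken up to conjugacy of the subgroups W_L. One choice function on
  parabolic subgroups provides them.\<close>

lemma orbit_reps:
  obtains \<Lambda> where "\<Lambda> \<subseteq> Pow S" "\<And>P. P \<in> parabs \<Longrightarrow> \<exists>!L. L \<in> \<Lambda> \<and> P \<in> conj_set (gen L) ` W"
proof -
  define r where "r P = (SOME L. L \<subseteq> S \<and> P \<in> conj_set (gen L) ` W)" for P
  have r: "r P \<subseteq> S \<and> P \<in> conj_set (gen (r P)) ` W" if "P \<in> parabs" for P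
  proof -
    obtain K h where K: "K \<subseteq> S" "h \<in> W" "P = par K h" using \<open>P \<in> parabs\<close> by (rule parabs_E)
    have "par K h = conj_set (gen K) h" using par_conj[OF W_one K(2), of K] par_one[OF K(1)] by (simp add: conj_set_def)
    then have "K \<subseteq> S \<and> P \<in> conj_set (gen K) ` W" using K by blast
    then show ?thesis unfolding r_def by (rule someI)
  qed
  have orb: "P \<in> conj_set A ` W \<longleftrightarrow> Q \<in> conj_set A ` W" if "Q \<in> conj_set P ` W" for P Q A
  proof -
    obtain x where x: "x \<in> W" "Q = conj_set P x" using \<open>Q \<in> conj_set P ` W\<close> by blast
    show ?thesis
    proof
      assume "P \<in> conj_set A ` W"
      then obtain y where "y \<in> W" "P = conj_set A y" by blast
      then have "Q = conj_set A (y ** x)" "y ** x \<in> W" using x by (simp_all add: conj_set_mult)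
      then show "Q \<in> conj_set A ` W" by blast
    next
      assume "Q \<in> conj_set A ` W"
      then obtain y where y: "y \<in> W" "Q = conj_set A y" by blast
      have "P = conj_set Q (matrix_inv x)" using x by simp
      then have "P = conj_set A (y ** matrix_inv x)" "y ** matrix_inv x \<in> W" using x(1) y by (simp_all add: conj_set_mult)
      then show "P \<in> conj_set A ` W" by blast
    qed
  qed
  \<comment> \<open>For conjugate subgroups the choice is made under equivalent predicates and
    therefore gives the same subset.\<close>
  have req: "r P = r Q" if "Q \<in> conj_set P ` W" for P Q
    unfolding r_def orb[OF that] ..
  show ?thesis
  proof (rule that)
    show "r ` parabs \<subseteq> Pow S" using r by blast
    fix P assume P: "P \<in> parabs"
    show "\<exists>!L. L \<in> r ` parabs \<and> P \<in> conj_set (gen L) ` W"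
    proof (rule ex1I[of _ "r P"])
      show "r P \<in> r ` parabs \<and> P \<in> conj_set (gen (r P)) ` W" using r P by blast
      fix L assume L: "L \<in> r ` parabs \<and> P \<in> conj_set (gen L) ` W"
      then obtain Q where Q: "Q \<in> parabs" "L = r Q" by blast
      have "r (gen L) = r P" using req L by blast
      moreover have "r (gen L) = r Q" using req r[OF Q(1)] Q(2) by blast
      ultimately show "L = r P" using Q(2) by simp
    qed
  qed
qed

lemma sum_orbits:
  assumes \<Lambda>: "\<Lambda> \<subseteq> Pow S" "\<And>P. P \<in> parabs \<Longrightarrow> \<exists>!L. L \<in> \<Lambda> \<and> P \<in> conj_set (gen L) ` W" and g: "g \<in> W"
    and inv: "\<And>P x. P \<in> parabs \<Longrightarrow> conj_set P g = P \<Longrightarrow> x \<in> W \<Longrightarrow> ch P g = ch (conj_set P x) (conjg g x)"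
  shows "(\<Sum>P | P \<in> parabs \<and> conj_set P g = P. ch P g) = (\<Sum>L\<in>\<Lambda>. ind W (normalizer W (gen L)) (ch (gen L)) g)"
proof -
  have fin: "finite \<Lambda>" using \<Lambda>(1) finite_S by (meson finite_Pow_iff finite_subset)
  have LS: "L \<subseteq> S" if "L \<in> \<Lambda>" for L using that \<Lambda>(1) by blast
  let ?O = "\<lambda>L. {P. P \<in> conj_set (gen L) ` W \<and> conj_set P g = P}"
  have sub: "conj_set (gen L) ` W \<subseteq> parabs" if "L \<in> \<Lambda>" for L
    using conj_set_parabs[OF gen_parabs[OF LS[OF that]]] by blast
  have "{P. P \<in> parabs \<and> conj_set P g = P} = (\<Union>L\<in>\<Lambda>. ?O L)"
  proof (intro set_eqI iffI)
    fix P assume P: "P \<in> {P. P \<in> parabs \<and> conj_set P g = P}"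
    then obtain L where "L \<in> \<Lambda>" "P \<in> conj_set (gen L) ` W" using \<Lambda>(2)[of P] by auto
    then show "P \<in> (\<Union>L\<in>\<Lambda>. ?O L)" using P by (intro UN_I[of L]) simp_all
  next
    fix P assume "P \<in> (\<Union>L\<in>\<Lambda>. ?O L)"
    then obtain L where "L \<in> \<Lambda>" "P \<in> conj_set (gen L) ` W" "conj_set P g = P" by (elim UN_E CollectE conjE)
    then show "P \<in> {P. P \<in> parabs \<and> conj_set P g = P}" using subsetD[OF sub] by simp
  qed
  then have "(\<Sum>P | P \<in> parabs \<and> conj_set P g = P. ch P g) = (\<Sum>P\<in>(\<Union>L\<in>\<Lambda>. ?O L). ch P g)" by simp
  also have "\<dots> = (\<Sum>L\<in>\<Lambda>. \<Sum>P\<in>?O L. ch P g)"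
  proof (rule sum.UNION_disjoint[OF fin])
    show "\<forall>L\<in>\<Lambda>. finite (?O L)" using finite_W by simp
    show "\<forall>L\<in>\<Lambda>. \<forall>K\<in>\<Lambda>. L \<noteq> K \<longrightarrow> ?O L \<inter> ?O K = {}"
    proof (intro ballI impI, rule ccontr)
      fix L K assume LM: "L \<in> \<Lambda>" "K \<in> \<Lambda>" "L \<noteq> K" "?O L \<inter> ?O K \<noteq> {}"
      then obtain P where P: "P \<in> conj_set (gen L) ` W" "P \<in> conj_set (gen K) ` W" by auto
      then have "P \<in> parabs" using subsetD[OF sub[OF LM(1)]] by simp
      from Ex1_unique[OF \<Lambda>(2)[OF this], of L K] show False using P LM by simp
    qed
  qed
  also have "\<dots> = (\<Sum>L\<in>\<Lambda>. ind W (normalizer W (gen L)) (ch (gen L)) g)"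
  proof (rule sum.cong[OF refl])
    fix L assume L: "L \<in> \<Lambda>"
    show "(\<Sum>P\<in>?O L. ch P g) = ind W (normalizer W (gen L)) (ch (gen L)) g"
      using ind_orbit[OF g gen_parabs[OF LS[OF L]], of ch] inv by simp
  qed
  finally show ?thesis .
qed

text \<open>The substitution of \<open>x ** y\<close> for \<open>x\<close> in the double sum. The
  inclusion of H in the normalizer ensures that whenever \<open>conjg g (x ** y)\<close> is in H,
  the intermediate conjugate is already in the normalizer.\<close>

lemma ind_trans:
  assumes H: "H \<subseteq> normalizer W P" and g: "g \<in> W"
  shows "ind W (normalizer W P) (ind (normalizer W P) H f) g = ind W H f g"
proof -
  let ?N = "normalizer W P"
  let ?F = "\<lambda>z. if conjg g z \<in> H then f (conjg g z) else 0"
  have finN: "finite ?N" using normalizer_sub finite_W by (rule finite_subset)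
  have "mat 1 \<in> ?N" by (simp add: normalizer_conj_set)
  then have N0: "of_nat (card ?N) \<noteq> (0::complex)" using finN by auto
  have NW: "n \<in> W" if "n \<in> ?N" for n using that normalizer_sub by blast
  have step: "(if conjg g x \<in> ?N then (\<Sum>y\<in>?N. if conjg (conjg g x) y \<in> H then f (conjg (conjg g x) y) else 0) else 0)
      = (\<Sum>y\<in>?N. ?F (x ** y))" if x: "x \<in> W" for x
  proof (cases "conjg g x \<in> ?N")
    case False
    have "conjg g (x ** y) \<notin> H" if y: "y \<in> ?N" for y
    proof
      assume "conjg g (x ** y) \<in> H"
      then have "conjg (conjg g x) y \<in> ?N" using H conjg_mult[OF x NW[OF y]] by auto
      then have "y ** (conjg (conjg g x) y ** matrix_inv y) \<in> ?N"
        using normalizer_mult normalizer_inv y by blast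
      then show False using False NW[OF y] by (simp add: conjg_def mm)
    qed
    then show ?thesis using False by simp
  next
    case True
    have "(\<Sum>y\<in>?N. if conjg (conjg g x) y \<in> H then f (conjg (conjg g x) y) else 0) = (\<Sum>y\<in>?N. ?F (x ** y))"
      by (rule sum.cong[OF refl]) (simp only: conjg_mult[OF x NW])
    then show ?thesis using True by simp
  qed
  have "(\<Sum>x\<in>W. \<Sum>y\<in>?N. ?F (x ** y)) = (\<Sum>y\<in>?N. \<Sum>x\<in>W. ?F (x ** y))" by (rule sum.swap)
  also have "\<dots> = (\<Sum>y\<in>?N. \<Sum>x\<in>W. ?F x)"
  proof (rule sum.cong[OF refl])
    fix y assume "y \<in> ?N"
    then have "y \<in> W" by (rule NW)
    then show "(\<Sum>x\<in>W. ?F (x ** y)) = (\<Sum>x\<in>W. ?F x)"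
      by (intro sum.reindex_bij_witness[where i = "\<lambda>x. x ** matrix_inv y" and j = "\<lambda>x. x ** y"])
        (simp_all add: mm)
  qed
  finally have tot: "(\<Sum>x\<in>W. \<Sum>y\<in>?N. ?F (x ** y)) = of_nat (card ?N) * (\<Sum>x\<in>W. ?F x)" by simp
  have "ind W ?N (ind ?N H f) g
    = (\<Sum>x\<in>W. (if conjg g x \<in> ?N then (\<Sum>y\<in>?N. if conjg (conjg g x) y \<in> H then f (conjg (conjg g x) y) else 0) else 0)
        / of_nat (card H)) / of_nat (card ?N)"
    unfolding ind_def by (intro arg_cong2[where f = "(/)"] sum.cong refl) simp
  also have "\<dots> = ((\<Sum>x\<in>W. \<Sum>y\<in>?N. ?F (x ** y)) / of_nat (card H)) / of_nat (card ?N)"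
    unfolding sum_divide_distrib using step
    by (intro arg_cong2[where f = "(/)"] sum.cong refl) (simp add: sum_divide_distrib)
  also have "\<dots> = ind W H f g" unfolding tot ind_def using N0 by simp
  finally show ?thesis .
qed

lemma ind_sum_trans:
  assumes "g \<in> W" "\<And>C. C \<in> A \<Longrightarrow> H C \<subseteq> normalizer W P"
    and "\<And>n. n \<in> normalizer W P \<Longrightarrow> X n = (\<Sum>C\<in>A. ind (normalizer W P) (H C) (f C) n)"
  shows "ind W (normalizer W P) X g = (\<Sum>C\<in>A. ind W (H C) (f C) g)"
proof -
  have "ind W (normalizer W P) X g
      = ind W (normalizer W P) (\<lambda>n. \<Sum>C\<in>A. ind (normalizer W P) (H C) (f C) n) g"
    by (rule ind_cong) (rule assms(3))
  also have "\<dots> = (\<Sum>C\<in>A. ind W (normalizer W P) (ind (normalizer W P) (H C) (f C)) g)"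
    by (rule ind_sum)
  also have "\<dots> = (\<Sum>C\<in>A. ind W (H C) (f C) g)"
    by (rule sum.cong[OF refl]) (rule ind_trans[OF assms(2,1)])
  finally show ?thesis .
qed

lemma ind_conj:
  assumes x: "x \<in> W" and H: "H \<subseteq> W" and g: "g \<in> W"
  shows "ind W {c\<in>W. conjg c x \<in> H} (\<lambda>c. f (conjg c x)) g = ind W H f g"
proof -
  have "bij_betw (\<lambda>c. conjg c x) {c\<in>W. conjg c x \<in> H} H"
    by (rule bij_betw_byWitness[where f' = "\<lambda>c. conjg c (matrix_inv x)"]) (use x H in auto)
  then have c: "card {c\<in>W. conjg c x \<in> H} = card H" by (rule bij_betw_same_card)
  have "(\<Sum>y\<in>W. if conjg g y \<in> {c\<in>W. conjg c x \<in> H} then f (conjg (conjg g y) x) else 0)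
      = (\<Sum>y\<in>W. if conjg g y \<in> H then f (conjg g y) else 0)"
    by (rule sum.reindex_bij_witness[where i = "\<lambda>y. y ** matrix_inv x" and j = "\<lambda>y. y ** x"])
      (use x g in \<open>simp_all add: conjg_mult mm\<close>)
  then show ?thesis unfolding ind_def c by simp
qed

section \<open>Centralizers and conjugacy classes\<close>

lemma cent_conj:
  assumes "x \<in> W" "w \<in> W"
  shows "cent W w = {c\<in>W. conjg c x \<in> cent W (conjg w x)}"
proof -
  have "conjg c x ** conjg w x = conjg w x ** conjg c x \<longleftrightarrow> c ** w = w ** c" for c
    using conjg_hom[OF assms(1)] conjg_inj[OF assms(1)] by metis
  then show ?thesis using assms by (auto simp: cent_def)
qed

lemma lin_char_one:
  assumes "lin_char H f" "mat 1 \<in> H" shows "f (mat 1) = 1"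
proof -
  have "f (mat 1 ** mat 1) = f (mat 1) * f (mat 1)" "f (mat 1) \<noteq> 0"
    using assms by (auto simp: lin_char_def simp del: matrix_mul_lid matrix_mul_rid)
  then show ?thesis by simp
qed

definition cls :: "'n rmat \<Rightarrow> 'n rmat set" where
  "cls w = (\<lambda>x. conjg w x) ` W"

lemma conj_classes_eq: "conj_classes W = cls ` W"
  by (auto simp: conj_classes_def cls_def)

lemma cls_self: "w \<in> W \<Longrightarrow> w \<in> cls w"
  unfolding cls_def by (rule image_eqI[of _ _ "mat 1"]) simp_all

lemma cls_conj:
  assumes "w \<in> W" "x \<in> W" shows "cls (conjg w x) = cls w"
proof
  show "cls (conjg w x) \<subseteq> cls w"
    unfolding cls_def by (auto simp: conjg_mult[symmetric] assms)
  show "cls w \<subseteq> cls (conjg w x)"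
  proof
    fix z assume "z \<in> cls w"
    then obtain y where y: "y \<in> W" "z = conjg w y" unfolding cls_def by blast
    then have "z = conjg (conjg w x) (matrix_inv x ** y)" using assms by (simp add: conjg_def mm)
    then show "z \<in> cls (conjg w x)" unfolding cls_def
      by (rule image_eqI) (use y(1) assms in simp)
  qed
qed

lemma cls_eq_iff:
  assumes "w \<in> W" "v \<in> W" shows "cls v = cls w \<longleftrightarrow> v \<in> cls w"
proof
  assume "cls v = cls w"
  then show "v \<in> cls w" using cls_self[OF assms(2)] by simp
next
  assume "v \<in> cls w"
  then obtain x where "x \<in> W" "v = conjg w x" unfolding cls_def by blast
  then show "cls v = cls w" using cls_conj[OF assms(1)] by simp
qed

lemma cls_sub: "w \<in> W \<Longrightarrow> cls w \<subseteq> W"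
  by (auto simp: cls_def)

lemma card_cls:
  assumes w: "w \<in> W"
  shows "of_nat (card W) / of_nat (card (cent W w)) = (of_nat (card (cls w)) :: complex)"
proof -
  have fib: "card {x\<in>W. conjg w x = y} = card (cent W w)" if "y \<in> (\<lambda>x. conjg w x) ` W" for y
  proof -
    obtain x0 where x0: "x0 \<in> W" "y = conjg w x0" using \<open>y \<in> (\<lambda>x. conjg w x) ` W\<close> by blast
    have c1: "conjg w (c ** x0) = y" if "c \<in> cent W w" for c
    proof -
      have c: "c \<in> W" "w ** c = c ** w" using that by (simp_all add: cent_def)
      then have "conjg w c = w" by (simp add: conjg_def mm)
      then show ?thesis using x0 c(1) by (simp add: conjg_mult)
    qed
    have c2: "x ** matrix_inv x0 \<in> cent W w" if "x \<in> W" "conjg w x = y" for x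
    proof -
      let ?c = "x ** matrix_inv x0"
      have "conjg w ?c = w" using that x0 by (simp add: conjg_mult)
      then have "?c ** conjg w ?c = ?c ** w" by simp
      then have "w ** ?c = ?c ** w" using that x0 by (simp add: conjg_def mm)
      then show ?thesis using that x0 by (simp add: cent_def)
    qed
    have "bij_betw (\<lambda>c. c ** x0) (cent W w) {x\<in>W. conjg w x = y}"
      by (rule bij_betw_byWitness[where f' = "\<lambda>x. x ** matrix_inv x0"])
        (use x0 c1 c2 in \<open>auto simp: mm cent_def\<close>)
    then show ?thesis by (rule bij_betw_same_card[symmetric])
  qed
  have "of_nat (card W) = (\<Sum>x\<in>W. 1 :: complex)" by simp
  also have "\<dots> = of_nat (card (cent W w)) * (\<Sum>y\<in>(\<lambda>x. conjg w x) ` W. 1)"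
    by (rule sum_fibers[OF finite_W fib])
  finally have "of_nat (card W) = of_nat (card (cent W w)) * (of_nat (card (cls w)) :: complex)"
    by (simp add: cls_def)
  moreover have "finite (cent W w)" "mat 1 \<in> cent W w"
    using finite_W by (auto simp: cent_def)
  then have "of_nat (card (cent W w)) \<noteq> (0::complex)" by auto
  ultimately show ?thesis by simp
qed

text \<open>A linear character has value 1 at the identity, so the induced degree is the index of
  the centralizer. This turns the decomposition of the regular character into a count of class
  sizes.\<close>

lemma ind_cent_one:
  assumes "w \<in> W" "lin_char (cent W w) f"
  shows "ind W (cent W w) f (mat 1) = of_nat (card (cls w))"
proof -
  have 1: "mat 1 \<in> cent W w" by (simp add: cent_def)
  have "conjg (mat 1) x = mat 1" if "x \<in> W" for x using that by (simp add: conjg_def)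
  then have "(\<Sum>x\<in>W. if conjg (mat 1) x \<in> cent W w then f (conjg (mat 1) x) else 0) = (\<Sum>x\<in>W. 1)"
    using 1 lin_char_one[OF assms(2) 1] by (intro sum.cong) auto
  then show ?thesis using card_cls[OF assms(1)] by (simp add: ind_def)
qed

lemma card_W_classes: "card W = (\<Sum>D\<in>cls ` W. card D)"
proof -
  have "\<Union> (cls ` W) = W" using cls_sub cls_self by blast
  moreover have "D \<inter> D' = {}" if D: "D \<in> cls ` W" "D' \<in> cls ` W" "D \<noteq> D'" for D D'
  proof (rule ccontr)
    assume "D \<inter> D' \<noteq> {}"
    then obtain z where z: "z \<in> D" "z \<in> D'" by blast
    obtain w w' where w: "w \<in> W" "D = cls w" "w' \<in> W" "D' = cls w'" using D by blast
    have "z \<in> W" using z w cls_sub by blast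
    then have "cls z = D" "cls z = D'" using cls_eq_iff z w by auto
    then show False using D(3) by simp
  qed
  then have "pairwise disjnt (cls ` W)" by (simp add: pairwise_def disjnt_def)
  moreover have "finite D" if "D \<in> cls ` W" for D
    using that cls_sub finite_W finite_subset by blast
  ultimately show ?thesis using card_Union_disjoint[of "cls ` W"] by simp
qed

text \<open>The predicate under the choice in \<open>det_restr\<close>, named so that two such
  choices can be compared.\<close>

definition is_det_restr :: "'n rmat \<Rightarrow> (real^'n) set \<Rightarrow> real \<Rightarrow> bool" where
  "is_det_restr c U d \<longleftrightarrow> (\<exists>bs M. distinct bs \<and> independent (set bs) \<and> span (set bs) = U
      \<and> (\<forall>j<length bs. bs!j v* c = (\<Sum>i<length bs. M i j *\<^sub>R bs!i))
      \<and> d = (\<Sum>p | p permutes {..<length bs}. of_int (sign p) * (\<Prod>i<length bs. M (p i) i)))"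

lemma is_det_restr_conj:
  assumes x: "x \<in> W" and d: "is_det_restr c U d"
  shows "is_det_restr (conjg c x) ((\<lambda>v. v v* x) ` U) d"
proof -
  let ?T = "\<lambda>v :: real^'n. v v* x"
  have lin: "linear ?T" by (rule linear_vmult)
  have undo: "(u v* x) v* matrix_inv x = u" for u :: "real^'n" using x by (simp add: vector_matrix_mul_assoc)
  have inj: "inj ?T" by (metis undo injI)
  obtain bs M where bs: "distinct bs" "independent (set bs)" "span (set bs) = U"
    "\<forall>j<length bs. bs!j v* c = (\<Sum>i<length bs. M i j *\<^sub>R bs!i)"
    "d = (\<Sum>p | p permutes {..<length bs}. of_int (sign p) * (\<Prod>i<length bs. M (p i) i))"
    using d unfolding is_det_restr_def by blast
  let ?bs = "map ?T bs"
  have 1: "distinct ?bs" using bs(1) inj by (simp add: distinct_map inj_on_def inj_def)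
  have 2: "independent (set ?bs)"
    using linear_independent_injective_image[OF lin bs(2) inj_on_subset[OF inj subset_UNIV]] by simp
  have 3: "span (set ?bs) = ?T ` U" using linear_span_image[OF lin, of "set bs"] bs(3) by simp
  have 4: "\<forall>j<length ?bs. ?bs!j v* conjg c x = (\<Sum>i<length ?bs. M i j *\<^sub>R ?bs!i)"
  proof (intro allI impI)
    fix j assume j: "j < length ?bs"
    have "?bs!j v* conjg c x = (bs!j v* c) v* x"
      using j x by (simp add: conjg_def vector_matrix_mul_assoc mm)
    also have "\<dots> = (\<Sum>i<length bs. (M i j *\<^sub>R bs!i) v* x)"
      using bs(4) j linear_sum[OF lin, of "\<lambda>i. M i j *\<^sub>R bs!i" "{..<length bs}"] by simp
    finally show "?bs!j v* conjg c x = (\<Sum>i<length ?bs. M i j *\<^sub>R ?bs!i)"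
      by (simp add: scaleR_vector_matrix_assoc)
  qed
  show ?thesis
    unfolding is_det_restr_def
    by (rule exI[of _ ?bs], rule exI[of _ M]) (intro conjI 1 2 3 4, simp add: bs(5))
qed

text \<open>Transporting a basis by \<open>x\<close> shows that the same numbers are admissible on
  both sides, so the two choices coincide; independence of the determinant from the basis does not
  enter.\<close>

lemma det_restr_conj:
  assumes x: "x \<in> W"
  shows "det_restr (conjg c x) ((\<lambda>v. v v* x) ` U) = det_restr c U"
proof -
  have "is_det_restr (conjg c x) ((\<lambda>v. v v* x) ` U) d \<longleftrightarrow> is_det_restr c U d" for d
  proof
    assume d: "is_det_restr (conjg c x) ((\<lambda>v. v v* x) ` U) d"
    have "(\<lambda>v. v v* matrix_inv x) ` (\<lambda>v. v v* x) ` U = U"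
      using x by (simp add: image_image vector_matrix_mul_assoc)
    then show "is_det_restr c U d" using is_det_restr_conj[OF W_inv[OF x] d] x by simp
  qed (rule is_det_restr_conj[OF x])
  then show ?thesis unfolding det_restr_def is_det_restr_def by simp
qed

lemma alpha_conj:
  assumes "w \<in> W" "x \<in> W" shows "alpha (conjg w x) (conjg c x) = alpha w c"
  using det_restr_conj[OF assms(2), of c "Fix w"] Fix_conj[OF assms]
  by (simp add: alpha_def Fix_def)

lemma sgn_char_conj:
  assumes "c \<in> W" "x \<in> W" shows "sgn_char S (conjg c x) = sgn_char S c"
proof -
  have "det (matrix_inv x) * det x = det (matrix_inv x ** x)" by (simp add: det_mul)
  then have "det (matrix_inv x) * det x = 1" using assms by simp
  then have "det (conjg c x) = det c"
    unfolding conjg_def det_mul by (simp add: mult.commute mult.left_commute)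
  then show ?thesis using assms by (simp add: sgn_char_det)
qed

section \<open>Cuspidal classes and the two decompositions\<close>

lemma cuspidal_conj:
  assumes L: "L \<subseteq> S" and w: "cuspidal L w" and u: "u \<in> gen L"
  shows "cuspidal L (conjg w u)"
proof -
  have w': "w \<in> gen L" "Fix w = fixW (gen L)" using w cuspidal_iff[OF L] by auto
  have W: "w \<in> W" "u \<in> W" using w' u gen_sub[OF L] by auto
  have "conjg w u \<in> gen L" unfolding conjg_def using w' u gen_inv[OF u L] by (intro gen_mult)
  moreover have "(\<lambda>v. v v* u) ` fixW (gen L) = fixW (gen L)"
    using u by (force simp: fixW_def)
  then have "Fix (conjg w u) = fixW (gen L)" using Fix_conj[OF W] w'(2) by simp
  ultimately show ?thesis using cuspidal_iff[OF L] by simp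
qed

lemma cuspidal_conj_set:
  assumes L: "L \<subseteq> S" "K \<subseteq> S" and w: "cuspidal K w" and y: "y \<in> W" "conj_set (gen L) y = gen K"
  shows "cuspidal L (conjg w (matrix_inv y))"
proof -
  have w': "w \<in> gen K" "Fix w = fixW (gen K)" using w cuspidal_iff[OF L(2)] by auto
  have W: "w \<in> W" using w' gen_sub[OF L(2)] by auto
  have e: "conj_set (gen K) (matrix_inv y) = gen L" using y conj_set_inv_r[of y "gen L"] by simp
  have "conjg w (matrix_inv y) \<in> gen L" unfolding e[symmetric] conj_set_def using w'(1) by (rule imageI)
  moreover have "Fix (conjg w (matrix_inv y)) = fixW (gen L)"
    using Fix_conj[OF W W_inv[OF y(1)]] fixW_conj_set[OF gen_parabs[OF L(2)] W_inv[OF y(1)]] e w'(2) by simp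
  ultimately show ?thesis using cuspidal_iff[OF L(1)] by simp
qed

lemma alphaL_alpha: "L \<subseteq> S \<Longrightarrow> cuspidal L w \<Longrightarrow> alphaL L c = alpha w c"
  using cuspidal_iff[of L w] by (simp add: alphaL_def alpha_def Fix_def)


lemma cusp_classes_rep:
  assumes L: "L \<subseteq> S" and C: "C \<in> cusp_classes L" and r: "r \<in> C"
  shows "cuspidal L r" "r \<in> W" "cent W r \<subseteq> normalizer W (gen L)"
proof -
  obtain w u where "cuspidal L w" "u \<in> gen L" "r = conjg w u"
    using C r unfolding cusp_classes_def by blast
  then show c: "cuspidal L r" using cuspidal_conj[OF L] by simp
  then show "r \<in> W" using gen_sub[OF L] by (auto simp: cuspidal_def)
  show "cent W r \<subseteq> normalizer W (gen L)" by (rule cent_normalizer[OF L c])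
qed

lemma finite_cusp_classes:
  assumes L: "L \<subseteq> S" shows "finite (cusp_classes L)"
proof -
  have "cusp_classes L \<subseteq> Pow W"
  proof
    fix C assume C: "C \<in> cusp_classes L"
    show "C \<in> Pow W" using cusp_classes_rep(2)[OF L C] by blast
  qed
  then show ?thesis using finite_W by (meson finite_Pow_iff finite_subset)
qed

lemma reg_char_orbits:
  assumes \<Lambda>: "\<Lambda> \<subseteq> Pow S" "\<forall>P\<in>parabs. \<exists>!L. L \<in> \<Lambda> \<and> P \<in> conj_set (gen L) ` W" and g: "g \<in> W"
  shows "reg_char W g = (\<Sum>L\<in>\<Lambda>. ind W (normalizer W (gen L)) (PhiL W S L) g)"
proof -
  let ?ch = "\<lambda>P g. qtrace (act g) (range (E P)) {\<lambda>_. 0}"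
  have "reg_char W g = (\<Sum>L\<in>\<Lambda>. ind W (normalizer W (gen L)) (?ch (gen L)) g)"
    unfolding reg_char_sum[OF g] by (rule sum_orbits[OF \<Lambda>(1) bspec[OF \<Lambda>(2)] g]) (assumption, rule qtrace_act_conj[OF _ g])
  also have "\<dots> = (\<Sum>L\<in>\<Lambda>. ind W (normalizer W (gen L)) (PhiL W S L) g)"
  proof (rule sum.cong[OF refl], rule ind_cong)
    fix L n assume "L \<in> \<Lambda>" "n \<in> normalizer W (gen L)"
    then have "L \<subseteq> S" "n \<in> W" using \<Lambda>(1) normalizer_sub by blast+
    then show "?ch (gen L) n = PhiL W S L n" by (rule PhiL_eq[symmetric])
  qed
  finally show ?thesis .
qed

lemma omegaW_orbits:
  assumes \<Lambda>: "\<Lambda> \<subseteq> Pow S" "\<forall>P\<in>parabs. \<exists>!L. L \<in> \<Lambda> \<and> P \<in> conj_set (gen L) ` W" and g: "g \<in> W"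
  shows "omegaW W S g = (\<Sum>L\<in>\<Lambda>. ind W (normalizer W (gen L)) (PsiL W S L) g)"
proof -
  let ?ch = "\<lambda>P g. qtrace (os_act g) (AX P) II"
  have "omegaW W S g = (\<Sum>L\<in>\<Lambda>. ind W (normalizer W (gen L)) (?ch (gen L)) g)"
    unfolding omegaW_sum[OF g] by (rule sum_orbits[OF \<Lambda>(1) bspec[OF \<Lambda>(2)] g]) (assumption, rule qtrace_os_conj[OF _ g])
  then show ?thesis unfolding PsiL_eq .
qed

lemma classes_rep_bij:
  assumes R: "R \<subseteq> W" "\<forall>C\<in>conj_classes W. \<exists>!w. w \<in> R \<and> w \<in> C"
  shows "bij_betw cls R (cls ` W)"
  unfolding bij_betw_def
proof
  show "inj_on cls R"
  proof (rule inj_onI)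
    fix v w assume vw: "v \<in> R" "w \<in> R" "cls v = cls w"
    then have W: "v \<in> W" "w \<in> W" using R(1) by auto
    have "v \<in> cls v" "w \<in> cls v" using cls_self[OF W(1)] cls_self[OF W(2)] vw(3) by auto
    moreover have "cls v \<in> conj_classes W" using W(1) by (simp add: conj_classes_eq)
    ultimately show "v = w" using R(2) vw by (intro Ex1_unique[OF bspec[OF R(2)]]) auto
  qed
  show "cls ` R = cls ` W"
  proof
    show "cls ` W \<subseteq> cls ` R"
    proof
      fix D assume D: "D \<in> cls ` W"
      then obtain w where w: "w \<in> R" "w \<in> D" using R(2) unfolding conj_classes_eq by blast
      obtain v where v: "v \<in> W" "D = cls v" using D by blast
      have "cls w = D" using cls_eq_iff[OF v(1), of w] w v(2) R(1) by auto
      then show "D \<in> cls ` R" using w(1) by blast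
    qed
  qed (use R(1) in blast)
qed

text \<open>An element is cuspidal in a parabolic subgroup, which is conjugate to W_L for one of the
  chosen L; inside W_L it is then conjugate to the representative of its cuspidal class. Distinct
  pairs (L, C) might still give the same class of W at this point.\<close>

lemma cusp_classes_cover:
  assumes \<Lambda>: "\<Lambda> \<subseteq> Pow S" "\<forall>P\<in>parabs. \<exists>!L. L \<in> \<Lambda> \<and> P \<in> conj_set (gen L) ` W"
    and rep: "\<forall>L. L \<subseteq> S \<longrightarrow> (\<forall>C\<in>cusp_classes L. rep C \<in> C)"
  shows "(\<lambda>j. cls (rep (snd j))) ` Sigma \<Lambda> cusp_classes = cls ` W"
proof
  have LS: "L \<subseteq> S" if "L \<in> \<Lambda>" for L using that \<Lambda>(1) by blast
  show "(\<lambda>j. cls (rep (snd j))) ` Sigma \<Lambda> cusp_classes \<subseteq> cls ` W"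
  proof clarify
    fix L C assume LC: "L \<in> \<Lambda>" "C \<in> cusp_classes L"
    then have "rep C \<in> C" using rep LS by blast
    then have "rep C \<in> W" by (rule cusp_classes_rep(2)[OF LS[OF LC(1)] LC(2)])
    then show "cls (rep (snd (L, C))) \<in> cls ` W" by simp
  qed
  show "cls ` W \<subseteq> (\<lambda>j. cls (rep (snd j))) ` Sigma \<Lambda> cusp_classes"
  proof clarify
    fix w assume w: "w \<in> W"
    obtain K x where K: "K \<subseteq> S" "x \<in> W" "cuspidal K (conjg w x)" by (rule conj_cuspidal[OF w])
    obtain L where L: "L \<in> \<Lambda>" "gen K \<in> conj_set (gen L) ` W" using bspec[OF \<Lambda>(2) gen_parabs[OF K(1)]] by blast
    then obtain y where y: "y \<in> W" "conj_set (gen L) y = gen K" by auto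
    let ?v = "conjg (conjg w x) (matrix_inv y)"
    let ?C = "(\<lambda>u. conjg ?v u) ` gen L"
    have v: "cuspidal L ?v" by (rule cuspidal_conj_set[OF LS[OF L(1)] K(1,3) y])
    have vW: "?v \<in> W" using w K y by simp
    have C: "?C \<in> cusp_classes L" unfolding cusp_classes_def using v by blast
    then have "rep ?C \<in> ?C" using rep LS[OF L(1)] by blast
    then obtain u where u: "u \<in> gen L" "rep ?C = conjg ?v u" by blast
    have uW: "u \<in> W" using subsetD[OF gen_sub[OF LS[OF L(1)]] u(1)] .
    have "cls (rep ?C) = cls w"
      unfolding u(2) cls_conj[OF vW uW] using w K y by (simp add: cls_conj)
    moreover have "(L, ?C) \<in> Sigma \<Lambda> cusp_classes" using L(1) C by blast
    ultimately show "cls w \<in> (\<lambda>j. cls (rep (snd j))) ` Sigma \<Lambda> cusp_classes"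
      by (intro image_eqI[of _ _ "(L, ?C)"]) simp_all
  qed
qed

end

section \<open>Transport of the characters to the representatives of the classes of W\<close>

theorem theorem4p5:
  fixes W S :: "('n::finite) rmat set"
    and rep :: "'n rmat set \<Rightarrow> 'n rmat"
    and R :: "'n rmat set"
  assumes cox: "finite_coxeter W S"
    and rep: "\<forall>L. L \<subseteq> S \<longrightarrow> (\<forall>C\<in>cusp_classes L. rep C \<in> C)"
    and hyp: "\<forall>L. L \<subseteq> S \<longrightarrow> (\<exists>\<phi> \<psi> :: 'n rmat set \<Rightarrow> 'n rmat \<Rightarrow> complex.
        (\<forall>C\<in>cusp_classes L.
            lin_char (cent W (rep C)) (\<phi> C) \<and> lin_char (cent W (rep C)) (\<psi> C)
          \<and> (\<forall>c\<in>cent W (rep C). \<psi> C c = \<phi> C c * sgn_char S c * alphaL L c))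
      \<and> (\<forall>n\<in>normalizer W (gen L).
            PhiL W S L n = (\<Sum>C\<in>cusp_classes L. ind (normalizer W (gen L)) (cent W (rep C)) (\<phi> C) n))
      \<and> (\<forall>n\<in>normalizer W (gen L).
            PsiL W S L n = (\<Sum>C\<in>cusp_classes L. ind (normalizer W (gen L)) (cent W (rep C)) (\<psi> C) n)))"
    and R: "R \<subseteq> W" "\<forall>C\<in>conj_classes W. \<exists>!w. w \<in> R \<and> w \<in> C"
  shows "\<exists>\<phi> \<psi> :: 'n rmat \<Rightarrow> 'n rmat \<Rightarrow> complex.
      (\<forall>w\<in>R. lin_char (cent W w) (\<phi> w) \<and> lin_char (cent W w) (\<psi> w))
    \<and> (\<forall>g\<in>W. reg_char W g = (\<Sum>w\<in>R. ind W (cent W w) (\<phi> w) g))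
    \<and> (\<forall>g\<in>W. omegaW W S g = (\<Sum>w\<in>R. ind W (cent W w) (\<psi> w) g))
    \<and> (\<forall>w\<in>R. \<forall>c\<in>cent W w. \<psi> w c = \<phi> w c * sgn_char S c * alpha w c)"
proof -
  interpret coxeter_group W S by unfold_locales (rule cox)
  obtain \<Lambda> where \<Lambda>: "\<Lambda> \<subseteq> Pow S" "\<forall>P\<in>parabs. \<exists>!L. L \<in> \<Lambda> \<and> P \<in> conj_set (gen L) ` W"
  proof (rule orbit_reps)
    fix \<Lambda> assume a: "\<Lambda> \<subseteq> Pow S" "\<And>P. P \<in> parabs \<Longrightarrow> \<exists>!L. L \<in> \<Lambda> \<and> P \<in> conj_set (gen L) ` W"
    show thesis by (rule that[OF a(1) ballI[OF a(2)]])
  qed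
  have LS: "L \<subseteq> S" if "L \<in> \<Lambda>" for L using that \<Lambda>(1) by blast
  \<comment> \<open>The two families are kept as a pair, so that one choice over L fixes both and
    the relation between them survives.\<close>
  define Q :: "'n rmat set \<Rightarrow> ('n rmat set \<Rightarrow> 'n rmat \<Rightarrow> complex) \<times> ('n rmat set \<Rightarrow> 'n rmat \<Rightarrow> complex) \<Rightarrow> bool"
    where "Q L p \<longleftrightarrow> (\<forall>C\<in>cusp_classes L.
            lin_char (cent W (rep C)) (fst p C) \<and> lin_char (cent W (rep C)) (snd p C)
          \<and> (\<forall>c\<in>cent W (rep C). snd p C c = fst p C c * sgn_char S c * alphaL L c))
      \<and> (\<forall>n\<in>normalizer W (gen L).
            PhiL W S L n = (\<Sum>C\<in>cusp_classes L. ind (normalizer W (gen L)) (cent W (rep C)) (fst p C) n))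
      \<and> (\<forall>n\<in>normalizer W (gen L).
            PsiL W S L n = (\<Sum>C\<in>cusp_classes L. ind (normalizer W (gen L)) (cent W (rep C)) (snd p C) n))" for L p
  have "\<forall>L\<in>\<Lambda>. \<exists>p. Q L p"
  proof
    fix L assume L: "L \<in> \<Lambda>"
    have "\<exists>\<phi> \<psi>. Q L (\<phi>, \<psi>)"
      unfolding Q_def fst_conv snd_conv by (rule mp[OF spec[OF hyp] LS[OF L]])
    then show "\<exists>p. Q L p" by blast
  qed
  from bchoice[OF this] obtain p where p: "\<forall>L\<in>\<Lambda>. Q L (p L)" ..
  define J where "J = Sigma \<Lambda> cusp_classes"
  define z where "z j = rep (snd j)" for j :: "'n rmat set \<times> 'n rmat set"
  define ph where "ph j = fst (p (fst j)) (snd j)" for j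
  define ps where "ps j = snd (p (fst j)) (snd j)" for j
  have finJ: "finite J"
    unfolding J_def using \<Lambda>(1) finite_S finite_cusp_classes LS
    by (intro finite_SigmaI) (auto intro: finite_subset[OF \<Lambda>(1)])
  have repC: "rep C \<in> C" if "L \<in> \<Lambda>" "C \<in> cusp_classes L" for L C
    using rep LS that by blast
  have zJ: "z j \<in> W" "cuspidal (fst j) (z j)" "fst j \<subseteq> S" if "j \<in> J" for j
  proof -
    have j: "fst j \<in> \<Lambda>" "snd j \<in> cusp_classes (fst j)" using that unfolding J_def by auto
    show "z j \<in> W" "cuspidal (fst j) (z j)"
      unfolding z_def using cusp_classes_rep(1,2)[OF LS[OF j(1)] j(2) repC[OF j]] by auto
    show "fst j \<subseteq> S" by (rule LS[OF j(1)])
  qed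
  have chJ: "lin_char (cent W (z j)) (ph j)" "lin_char (cent W (z j)) (ps j)"
    "\<And>c. c \<in> cent W (z j) \<Longrightarrow> ps j c = ph j c * sgn_char S c * alphaL (fst j) c" if "j \<in> J" for j
  proof -
    have j: "fst j \<in> \<Lambda>" "snd j \<in> cusp_classes (fst j)" using that unfolding J_def by auto
    have "lin_char (cent W (z j)) (ph j) \<and> lin_char (cent W (z j)) (ps j)
        \<and> (\<forall>c\<in>cent W (z j). ps j c = ph j c * sgn_char S c * alphaL (fst j) c)"
      unfolding z_def ph_def ps_def by (rule bspec[OF conjunct1[OF bspec[OF p j(1), unfolded Q_def]] j(2)])
    then show "lin_char (cent W (z j)) (ph j)" "lin_char (cent W (z j)) (ps j)"
      "\<And>c. c \<in> cent W (z j) \<Longrightarrow> ps j c = ph j c * sgn_char S c * alphaL (fst j) c"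
      by simp_all
  qed
  have Jsum: "(\<Sum>L\<in>\<Lambda>. \<Sum>C\<in>cusp_classes L. F (L, C)) = (\<Sum>j\<in>J. F j)" for F :: "_ \<Rightarrow> complex"
    unfolding J_def using \<Lambda>(1) finite_S finite_cusp_classes LS
    by (subst sum.Sigma) (auto intro: finite_subset[OF \<Lambda>(1)])
  have reg: "reg_char W g = (\<Sum>j\<in>J. ind W (cent W (z j)) (ph j) g)" if g: "g \<in> W" for g
  proof -
    have "reg_char W g = (\<Sum>L\<in>\<Lambda>. \<Sum>C\<in>cusp_classes L. ind W (cent W (z (L, C))) (ph (L, C)) g)"
      unfolding reg_char_orbits[OF \<Lambda> g]
    proof (rule sum.cong[OF refl], rule ind_sum_trans[OF g])
      fix L assume L: "L \<in> \<Lambda>"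
      show "cent W (z (L, C)) \<subseteq> normalizer W (gen L)" if "C \<in> cusp_classes L" for C
        using cusp_classes_rep(3)[OF LS[OF L] that repC[OF L that]] by (simp add: z_def)
      show "PhiL W S L n = (\<Sum>C\<in>cusp_classes L. ind (normalizer W (gen L)) (cent W (z (L, C))) (ph (L, C)) n)"
        if "n \<in> normalizer W (gen L)" for n
        using bspec[OF p L] that unfolding Q_def z_def ph_def by simp
    qed
    from this Jsum[of "\<lambda>j. ind W (cent W (z j)) (ph j) g"] show ?thesis by (rule trans)
  qed
  have om: "omegaW W S g = (\<Sum>j\<in>J. ind W (cent W (z j)) (ps j) g)" if g: "g \<in> W" for g
  proof -
    have "omegaW W S g = (\<Sum>L\<in>\<Lambda>. \<Sum>C\<in>cusp_classes L. ind W (cent W (z (L, C))) (ps (L, C)) g)"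
      unfolding omegaW_orbits[OF \<Lambda> g]
    proof (rule sum.cong[OF refl], rule ind_sum_trans[OF g])
      fix L assume L: "L \<in> \<Lambda>"
      show "cent W (z (L, C)) \<subseteq> normalizer W (gen L)" if "C \<in> cusp_classes L" for C
        using cusp_classes_rep(3)[OF LS[OF L] that repC[OF L that]] by (simp add: z_def)
      show "PsiL W S L n = (\<Sum>C\<in>cusp_classes L. ind (normalizer W (gen L)) (cent W (z (L, C))) (ps (L, C)) n)"
        if "n \<in> normalizer W (gen L)" for n
        using bspec[OF p L] that unfolding Q_def z_def ps_def by simp
    qed
    from this Jsum[of "\<lambda>j. ind W (cent W (z j)) (ps j) g"] show ?thesis by (rule trans)
  qed
  have img: "(\<lambda>j. cls (z j)) ` J = cls ` W"
    unfolding J_def z_def by (rule cusp_classes_cover[OF \<Lambda> rep])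
  text \<open>Comparing degrees: the classes of the cuspidal representatives cover \<open>W\<close> and their sizes add
    up to the order of \<open>W\<close>, so each class of \<open>W\<close> occurs exactly once. This replaces the case-by-case
    fact that cuspidal classes do not fuse.\<close>
  have inj: "inj_on (\<lambda>j. cls (z j)) J"
  proof (rule inj_on_if_card_sum[OF finJ])
    fix j assume j: "j \<in> J"
    have "finite (cls (z j))" using finite_subset[OF cls_sub[OF zJ(1)[OF j]] finite_W] .
    then show "card (cls (z j)) > 0" using cls_self[OF zJ(1)[OF j]] card_gt_0_iff by blast
  next
    have "of_nat (card W) = reg_char W (mat 1)" by (simp add: reg_char_def)
    also have "\<dots> = (\<Sum>j\<in>J. of_nat (card (cls (z j))))"
      unfolding reg[OF W_one] using ind_cent_one[OF zJ(1) chJ(1)] by (intro sum.cong refl) simp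
    finally have "of_nat (card W) = (of_nat (\<Sum>j\<in>J. card (cls (z j))) :: complex)" by simp
    then have "card W = (\<Sum>j\<in>J. card (cls (z j)))" by (rule of_nat_eq_iff[THEN iffD1])
    then show "(\<Sum>j\<in>J. card (cls (z j))) = (\<Sum>D\<in>(\<lambda>j. cls (z j)) ` J. card D)"
      unfolding img card_W_classes[symmetric] ..
  qed
  have bijJ: "bij_betw (\<lambda>j. cls (z j)) J (cls ` W)" using inj img by (simp add: bij_betw_def)
  \<comment> \<open>The unique pair (L, C) whose cuspidal representative is conjugate to
    \<open>w\<close>.\<close>
  define \<tau> where "\<tau> w = inv_into J (\<lambda>j. cls (z j)) (cls w)" for w
  have bij\<tau>: "bij_betw \<tau> R J"
    using bij_betw_trans[OF classes_rep_bij[OF R] bij_betw_inv_into[OF bijJ]]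
    unfolding \<tau>_def o_def .
  have \<tau>J: "\<tau> w \<in> J" if "w \<in> R" for w using bij_betwE[OF bij\<tau>] that by blast
  have "\<forall>w\<in>R. \<exists>x. x \<in> W \<and> z (\<tau> w) = conjg w x"
  proof
    fix w assume w: "w \<in> R"
    have wW: "w \<in> W" using w R(1) by blast
    have "cls (z (\<tau> w)) = cls w"
      unfolding \<tau>_def using bij_betw_inv_into_right[OF bijJ, of "cls w"] wW by simp
    then have "z (\<tau> w) \<in> cls w" using cls_self[OF zJ(1)[OF \<tau>J[OF w]]] by simp
    then show "\<exists>x. x \<in> W \<and> z (\<tau> w) = conjg w x" unfolding cls_def by blast
  qed
  from bchoice[OF this] obtain \<xi> where \<xi>: "\<forall>w\<in>R. \<xi> w \<in> W \<and> z (\<tau> w) = conjg w (\<xi> w)" ..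
  have x: "\<xi> w \<in> W" "z (\<tau> w) = conjg w (\<xi> w)" "w \<in> W" if "w \<in> R" for w
    using bspec[OF \<xi> that] R(1) that by auto
  \<comment> \<open>Conjugation by \<open>\<xi> w\<close> takes the centralizer of \<open>w\<close>
    to that of the cuspidal representative, and the character is pulled back along it.\<close>
  define \<phi> where "\<phi> w c = ph (\<tau> w) (conjg c (\<xi> w))" for w c
  define \<psi> where "\<psi> w c = ps (\<tau> w) (conjg c (\<xi> w))" for w c
  have cent: "cent W w = {c\<in>W. conjg c (\<xi> w) \<in> cent W (z (\<tau> w))}" if w: "w \<in> R" for w
    unfolding x(2)[OF w] by (rule cent_conj[OF x(1,3)[OF w]])
  have cc: "conjg c (\<xi> w) \<in> cent W (z (\<tau> w))" "c \<in> W" if "w \<in> R" "c \<in> cent W w" for w c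
    using that cent by blast+
  have lin: "lin_char (cent W w) (\<lambda>c. f (conjg c (\<xi> w)))"
    if w: "w \<in> R" and f: "lin_char (cent W (z (\<tau> w))) f" for w f
    unfolding lin_char_def conjg_hom[OF x(1)[OF w]] using f cc[OF w] by (simp add: lin_char_def)
  have ind: "ind W (cent W w) (\<lambda>c. f (conjg c (\<xi> w))) g = ind W (cent W (z (\<tau> w))) f g"
    if w: "w \<in> R" and g: "g \<in> W" for w g f
    unfolding cent[OF w] using ind_conj[OF x(1)[OF w] _ g, of "cent W (z (\<tau> w))" f] by (simp add: cent_def)
  have R1: "\<forall>w\<in>R. lin_char (cent W w) (\<phi> w) \<and> lin_char (cent W w) (\<psi> w)"
    unfolding \<phi>_def \<psi>_def using lin chJ(1,2)[OF \<tau>J] by blast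
  have R2: "\<forall>g\<in>W. reg_char W g = (\<Sum>w\<in>R. ind W (cent W w) (\<phi> w) g)"
  proof
    fix g assume g: "g \<in> W"
    have "(\<Sum>w\<in>R. ind W (cent W w) (\<phi> w) g) = (\<Sum>w\<in>R. ind W (cent W (z (\<tau> w))) (ph (\<tau> w)) g)"
      unfolding \<phi>_def by (rule sum.cong[OF refl]) (rule ind[OF _ g])
    also have "\<dots> = reg_char W g"
      unfolding reg[OF g] by (rule sum.reindex_bij_betw[OF bij\<tau>])
    finally show "reg_char W g = (\<Sum>w\<in>R. ind W (cent W w) (\<phi> w) g)" ..
  qed
  have R3: "\<forall>g\<in>W. omegaW W S g = (\<Sum>w\<in>R. ind W (cent W w) (\<psi> w) g)"
  proof
    fix g assume g: "g \<in> W"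
    have "(\<Sum>w\<in>R. ind W (cent W w) (\<psi> w) g) = (\<Sum>w\<in>R. ind W (cent W (z (\<tau> w))) (ps (\<tau> w)) g)"
      unfolding \<psi>_def by (rule sum.cong[OF refl]) (rule ind[OF _ g])
    also have "\<dots> = omegaW W S g"
      unfolding om[OF g] by (rule sum.reindex_bij_betw[OF bij\<tau>])
    finally show "omegaW W S g = (\<Sum>w\<in>R. ind W (cent W w) (\<psi> w) g)" ..
  qed
  have R4: "\<forall>w\<in>R. \<forall>c\<in>cent W w. \<psi> w c = \<phi> w c * sgn_char S c * alpha w c"
  proof (intro ballI)
    fix w c assume w: "w \<in> R" and c: "c \<in> cent W w"
    let ?c = "conjg c (\<xi> w)"
    \<comment> \<open>A cuspidal element of W_L has the same fixed space as W_L, so the determinant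
      character of L is that of the element, and the latter is invariant under simultaneous
      conjugation.\<close>
    have "alphaL (fst (\<tau> w)) ?c = alpha (conjg w (\<xi> w)) ?c"
      using alphaL_alpha zJ(2,3)[OF \<tau>J[OF w]] x(2)[OF w] by simp
    also have "\<dots> = alpha w c" by (rule alpha_conj[OF x(3,1)[OF w]])
    finally show "\<psi> w c = \<phi> w c * sgn_char S c * alpha w c"
      unfolding \<psi>_def \<phi>_def chJ(3)[OF \<tau>J[OF w] cc(1)[OF w c]]
      using sgn_char_conj[OF cc(2)[OF w c] x(1)[OF w]] by simp
  qed
  show ?thesis using R1 R2 R3 R4 by blast
qed

end
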